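(* Let $u$ be the exact solution of problem (P) and $U^n$ the solution of the implicit finite difference scheme (S), both described in the context, and let $u^n$ denote the grid function $u^n_{ij}=u(x_i,y_j,t_n)$. Suppose $u\in C^{4,4,3}_{x,y,t}(\overline\Omega\times[0,T])$. Then there exists a positive constant $C$, independent of $h_x,h_y$ and $\tau$, such that for all grids and all $1\le n\le N$, $$\|u^n-U^n\|_{1}\le C\sqrt{\frac{TL_xL_y}{\sum_{l=1}^{p}\frac{a_lT^{1-\gamma_l}}{\Gamma(2-\gamma_l)}+2b_1}}\ \Big(\tau^{\min_{l,m,r}\{3-\gamma_l,\,2-\alpha_m,\,2-\beta_r\}}+h_x^2+h_y^2\Big).$$
   Context: Parameters: integers $p,q,s\ge1$; reals $a_l>0$ ($1\le l\le p$), $b_1,b_2,b_3>0$, $c_m>0$ ($1\le m\le q$), $d_r>0$ ($1\le r\le s$); orders $1<\gamma_l<2$, $0<\alpha_m<1$, $0<\beta_r<1$; $T,L_x,L_y>0$, $\Omega=(0,L_x)\times(0,L_y)$. Problem (P): $$\sum_{l=1}^pa_lD_t^{\gamma_l}u+b_1u_t+\sum_{m=1}^q c_mD_t^{\alpha_m}u+b_2u=b_3(u_{xx}+u_{yy})+\sum_{r=1}^s d_rD_t^{\beta_r}(u_{xx}+u_{yy})+f(x,y,t)$$ on $\Omega\times(0,T]$, with $u(x,y,0)=\varphi(x,y)$, $u_t(x,y,0)=\phi(x,y)$ in $\Omega$ and $u=0$ on $\partial\Omega$. The Caputo derivatives are $D_t^\gamma u=\frac1{\Gamma(2-\gamma)}\int_0^t(t-s)^{1-\gamma}\partial_s^2u(x,y,s)\,ds$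 for $1<\gamma<2$ and $D_t^\alpha u=\frac1{\Gamma(1-\alpha)}\int_0^t(t-s)^{-\alpha}\partial_su(x,y,s)\,ds$ for $0<\alpha<1$. $u\in C^{4,4,3}_{x,y,t}$ means that all partial derivatives $\partial_x^a\partial_y^b\partial_t^cu$ with $a\le4$, $b\le4$, $c\le3$ exist and are continuous. Grid: $M_x,M_y\ge2$, $N\ge1$, $h_x=L_x/M_x$, $h_y=L_y/M_y$, $\tau=T/N$, $x_i=ih_x$, $y_j=jh_y$, $t_n=n\tau$. $\mathcal V_h$ is the space of real grid functions $v=(v_{ij})_{0\le i\le M_x,0\le j\le M_y}$ with $v_{0j}=v_{M_xj}=v_{i0}=v_{iM_y}=0$. Notation: $\nabla_tv^n_{ij}=(v^n_{ij}-v^{n-1}_{ij})/\tau$, $v^{n-\frac12}_{ij}=(v^n_{ij}+v^{n-1}_{ij})/2$, $\nabla_xv_{ij}=(v_{ij}-v_{i-1,j})/h_x$, $\nabla_yv_{ij}=(v_{ij}-v_{i,j-1})/h_y$, $\delta_x^2v_{ij}=(v_{i-1,j}-2v_{ij}+v_{i+1,j})/h_x^2$, $\delta_y^2v_{ij}=(v_{i,j-1}-2v_{ij}+v_{i,j+1})/h_y^2$, $f^n_{ij}=f(x_i,y_j,t_n)$, $\phi_{ij}=\phi(x_i,y_j)$, $\varphi_{ij}=\varphi(x_i,y_j)$. Norms: $\|v\|_0^2=h_xh_y\sum_{i=1}^{M_x-1}\sum_{j=1}^{M_y-1}v_{ij}^2$, $|v|_1^2=h_xh_y\sum_{i=1}^{M_x}\sum_{j=1}^{M_y}\big[(\nabla_xv_{ij})^2+(\nabla_yv_{ij})^2\big]$,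 $\|v\|_1^2=b_2\|v\|_0^2+b_3|v|_1^2$. Coefficients: $\mu_{1,l}=\tau^{1-\gamma_l}/\Gamma(3-\gamma_l)$, $\mu_{2,m}=\tau^{1-\alpha_m}/\Gamma(2-\alpha_m)$, $\mu_{3,r}=\tau^{1-\beta_r}/\Gamma(2-\beta_r)$. For $\gamma\in(1,2)$, $a_k^{(\gamma)}=(k+1)^{2-\gamma}-k^{2-\gamma}$, $k\ge0$. For $\alpha\in(0,1)$: $\tilde a_0^{(\alpha)}=(\tfrac12)^{1-\alpha}$ and, for $k\ge1$, $\tilde a_k^{(\alpha)}=(k+\tfrac12)^{1-\alpha}-(k-\tfrac12)^{1-\alpha}$, $\tilde b_k^{(\alpha)}=\frac1{2-\alpha}[(k+\tfrac12)^{2-\alpha}-(k-\tfrac12)^{2-\alpha}]-\frac12[(k+\tfrac12)^{1-\alpha}+(k-\tfrac12)^{1-\alpha}]$; $c_0^{(1,\alpha)}=\tilde a_0^{(\alpha)}$, and for $n\ge2$: $c_0^{(n,\alpha)}=\tilde a_0^{(\alpha)}+\tilde b_1^{(\alpha)}$, $c_k^{(n,\alpha)}=\tilde a_k^{(\alpha)}+\tilde b_{k+1}^{(\alpha)}-\tilde b_k^{(\alpha)}$ ($1\le k\le n-2$), $c_{n-1}^{(n,\alpha)}=\tilde a_{n-1}^{(\alpha)}-\tilde b_{n-1}^{(\alpha)}$. Scheme (S): for $1\le n\le N$, $1\le i\le M_x-1$, $1\le j\le M_y-1$, $$\sum_{l=1}^{p}a_l\mu_{1,l}\Big[a_0^{(\gamma_l)}\nabla_tU_{ij}^{n}-\sum_{k=1}^{n-1}(a_{n-k-1}^{(\gamma_l)}-a_{n-k}^{(\gamma_l)})\nabla_tU_{ij}^{k}-a_{n-1}^{(\gamma_l)}\phi_{ij}\Big]+b_1\nabla_tU_{ij}^{n}+\sum_{m=1}^qc_m\mu_{2,m}\sum_{k=1}^n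 c_{n-k}^{(n,\alpha_m)}\nabla_tU_{ij}^k+b_2U_{ij}^{n-\frac12}$$ $$=b_3(\delta_x^2+\delta_y^2)U_{ij}^{n-\frac12}+\sum_{r=1}^sd_r\mu_{3,r}\sum_{k=1}^n c_{n-k}^{(n,\beta_r)}\nabla_t(\delta_x^2+\delta_y^2)U_{ij}^k+f_{ij}^{n-\frac12},$$ with $U^0_{ij}=\varphi_{ij}$ on the grid ($\varphi$ vanishing on $\partial\Omega$) and $U^n\in\mathcal V_h$ for $1\le n\le N$. *)

theory Defs
  imports "HOL-Analysis.Analysis"
begin

section \<open>The continuous problem\<close>

definition Omega :: "real \<Rightarrow> real \<Rightarrow> (real \<times> real) set" where
  "Omega Lx Ly = {0<..<Lx} \<times> {0<..<Ly}"

text \<open>Functions of space and time are curried, \<open>u x y t\<close>, and only their values for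
  \<open>(x, y) \<in> closure (Omega Lx Ly)\<close>, \<open>t \<in> {0..T}\<close> matter. Partial derivatives are therefore taken
  within the closed intervals: at interior points they are the usual ones, at the end points
  (e.g. \<open>t = 0\<close> in the initial condition) they are one-sided.\<close>

definition Dx :: "real \<Rightarrow> (real \<Rightarrow> real \<Rightarrow> real \<Rightarrow> real) \<Rightarrow> real \<Rightarrow> real \<Rightarrow> real \<Rightarrow> real" where
  "Dx Lx u x y t = vector_derivative (\<lambda>x'. u x' y t) (at x within {0..Lx})"

definition Dy :: "real \<Rightarrow> (real \<Rightarrow> real \<Rightarrow> real \<Rightarrow> real) \<Rightarrow> real \<Rightarrow> real \<Rightarrow> real \<Rightarrow> real" where
  "Dy Ly u x y t = vector_derivative (\<lambda>y'. u x y' t) (at y within {0..Ly})"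

definition Dt :: "real \<Rightarrow> (real \<Rightarrow> real \<Rightarrow> real \<Rightarrow> real) \<Rightarrow> real \<Rightarrow> real \<Rightarrow> real \<Rightarrow> real" where
  "Dt T u x y t = vector_derivative (\<lambda>t'. u x y t') (at t within {0..T})"

definition laplacian ::
  "real \<Rightarrow> real \<Rightarrow> (real \<Rightarrow> real \<Rightarrow> real \<Rightarrow> real) \<Rightarrow> real \<Rightarrow> real \<Rightarrow> real \<Rightarrow> real" where
  "laplacian Lx Ly u x y t = Dx Lx (Dx Lx u) x y t + Dy Ly (Dy Ly u) x y t"

text \<open>Caputo derivatives of order \<open>\<alpha> \<in> (0,1)\<close> and \<open>\<gamma> \<in> (1,2)\<close>. The value \<open>0 powr e = 0\<close> of the
  kernel at the end point \<open>s = t\<close> does not affect the integral.\<close>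

definition caputo1 ::
  "real \<Rightarrow> real \<Rightarrow> (real \<Rightarrow> real \<Rightarrow> real \<Rightarrow> real) \<Rightarrow> real \<Rightarrow> real \<Rightarrow> real \<Rightarrow> real" where
  "caputo1 T \<alpha> u x y t =
     1 / Gamma (1 - \<alpha>) * integral {0..t} (\<lambda>s. (t - s) powr (- \<alpha>) * Dt T u x y s)"

definition caputo2 ::
  "real \<Rightarrow> real \<Rightarrow> (real \<Rightarrow> real \<Rightarrow> real \<Rightarrow> real) \<Rightarrow> real \<Rightarrow> real \<Rightarrow> real \<Rightarrow> real" where
  "caputo2 T \<gamma> u x y t =
     1 / Gamma (2 - \<gamma>) * integral {0..t} (\<lambda>s. (t - s) powr (1 - \<gamma>) * Dt T (Dt T u) x y s)"

text \<open>\<open>u \<in> C\<^sup>4\<^sup>,\<^sup>4\<^sup>,\<^sup>3\<close>: \<open>D a b c\<close> is the derivative of order \<open>a\<close> in \<open>x\<close>, \<open>b\<close> in \<open>y\<close> and \<open>c\<close> in \<open>t\<close>; the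
  conditions determine it on the closed cylinder.\<close>

definition C443 :: "real \<Rightarrow> real \<Rightarrow> real \<Rightarrow> (real \<Rightarrow> real \<Rightarrow> real \<Rightarrow> real) \<Rightarrow> bool" where
  "C443 Lx Ly T u \<longleftrightarrow>
    (\<exists>D :: nat \<Rightarrow> nat \<Rightarrow> nat \<Rightarrow> real \<Rightarrow> real \<Rightarrow> real \<Rightarrow> real.
      (\<forall>x\<in>{0..Lx}. \<forall>y\<in>{0..Ly}. \<forall>t\<in>{0..T}. D 0 0 0 x y t = u x y t) \<and>
      (\<forall>a\<le>4. \<forall>b\<le>4. \<forall>c\<le>3.
        continuous_on ({0..Lx} \<times> {0..Ly} \<times> {0..T}) (\<lambda>(x, y, t). D a b c x y t) \<and>
        (\<forall>x\<in>{0..Lx}. \<forall>y\<in>{0..Ly}. \<forall>t\<in>{0..T}.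
          (a < 4 \<longrightarrow>
            ((\<lambda>x'. D a b c x' y t) has_real_derivative D (Suc a) b c x y t) (at x within {0..Lx})) \<and>
          (b < 4 \<longrightarrow>
            ((\<lambda>y'. D a b c x y' t) has_real_derivative D a (Suc b) c x y t) (at y within {0..Ly})) \<and>
          (c < 3 \<longrightarrow>
            ((\<lambda>t'. D a b c x y t') has_real_derivative D a b (Suc c) x y t) (at t within {0..T})))))"

definition solves_P ::
  "nat \<Rightarrow> nat \<Rightarrow> nat \<Rightarrow> (nat \<Rightarrow> real) \<Rightarrow> real \<Rightarrow> real \<Rightarrow> real \<Rightarrow> (nat \<Rightarrow> real) \<Rightarrow> (nat \<Rightarrow> real) \<Rightarrow>
   (nat \<Rightarrow> real) \<Rightarrow> (nat \<Rightarrow> real) \<Rightarrow> (nat \<Rightarrow> real) \<Rightarrow> real \<Rightarrow> real \<Rightarrow> real \<Rightarrow>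
   (real \<Rightarrow> real \<Rightarrow> real \<Rightarrow> real) \<Rightarrow> (real \<Rightarrow> real \<Rightarrow> real) \<Rightarrow> (real \<Rightarrow> real \<Rightarrow> real) \<Rightarrow>
   (real \<Rightarrow> real \<Rightarrow> real \<Rightarrow> real) \<Rightarrow> bool" where
  "solves_P p q s a b1 b2 b3 c d \<gamma> \<alpha> \<beta> T Lx Ly f \<phi>0 \<phi>1 u \<longleftrightarrow>
    (\<forall>(x, y)\<in>Omega Lx Ly. \<forall>t\<in>{0<..T}.
      (\<Sum>l=1..p. a l * caputo2 T (\<gamma> l) u x y t) + b1 * Dt T u x y t
        + (\<Sum>m=1..q. c m * caputo1 T (\<alpha> m) u x y t) + b2 * u x y t
      = b3 * laplacian Lx Ly u x y t
        + (\<Sum>r=1..s. d r * caputo1 T (\<beta> r) (laplacian Lx Ly u) x y t) + f x y t) \<and>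
    (\<forall>(x, y)\<in>Omega Lx Ly. u x y 0 = \<phi>0 x y \<and> Dt T u x y 0 = \<phi>1 x y) \<and>
    (\<forall>(x, y)\<in>frontier (Omega Lx Ly). \<forall>t\<in>{0..T}. u x y t = 0)"


section \<open>The finite difference scheme\<close>

text \<open>A spatial grid function is \<open>v i j\<close>, a time-dependent one \<open>V n i j\<close>; only indices
  \<open>i \<le> Mx\<close>, \<open>j \<le> My\<close>, \<open>n \<le> N\<close> matter.\<close>

definition in_Vh :: "nat \<Rightarrow> nat \<Rightarrow> (nat \<Rightarrow> nat \<Rightarrow> real) \<Rightarrow> bool" where
  "in_Vh Mx My v \<longleftrightarrow>
    (\<forall>j\<le>My. v 0 j = 0 \<and> v Mx j = 0) \<and> (\<forall>i\<le>Mx. v i 0 = 0 \<and> v i My = 0)"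

definition nabla_t :: "real \<Rightarrow> (nat \<Rightarrow> nat \<Rightarrow> nat \<Rightarrow> real) \<Rightarrow> nat \<Rightarrow> nat \<Rightarrow> nat \<Rightarrow> real" where
  "nabla_t \<tau> V n i j = (V n i j - V (n - 1) i j) / \<tau>"

definition half_avg :: "(nat \<Rightarrow> nat \<Rightarrow> nat \<Rightarrow> real) \<Rightarrow> nat \<Rightarrow> nat \<Rightarrow> nat \<Rightarrow> real" where
  "half_avg V n i j = (V n i j + V (n - 1) i j) / 2"

definition nabla_x :: "real \<Rightarrow> (nat \<Rightarrow> nat \<Rightarrow> real) \<Rightarrow> nat \<Rightarrow> nat \<Rightarrow> real" where
  "nabla_x hx v i j = (v i j - v (i - 1) j) / hx"

definition nabla_y :: "real \<Rightarrow> (nat \<Rightarrow> nat \<Rightarrow> real) \<Rightarrow> nat \<Rightarrow> nat \<Rightarrow> real" where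
  "nabla_y hy v i j = (v i j - v i (j - 1)) / hy"

definition laplacian_h :: "real \<Rightarrow> real \<Rightarrow> (nat \<Rightarrow> nat \<Rightarrow> real) \<Rightarrow> nat \<Rightarrow> nat \<Rightarrow> real" where
  "laplacian_h hx hy v i j =
     (v (i - 1) j - 2 * v i j + v (i + 1) j) / hx\<^sup>2
     + (v i (j - 1) - 2 * v i j + v i (j + 1)) / hy\<^sup>2"

definition norm0 :: "nat \<Rightarrow> nat \<Rightarrow> real \<Rightarrow> real \<Rightarrow> (nat \<Rightarrow> nat \<Rightarrow> real) \<Rightarrow> real" where
  "norm0 Mx My hx hy v = sqrt (hx * hy * (\<Sum>i=1..Mx-1. \<Sum>j=1..My-1. (v i j)\<^sup>2))"

definition seminorm1 :: "nat \<Rightarrow> nat \<Rightarrow> real \<Rightarrow> real \<Rightarrow> (nat \<Rightarrow> nat \<Rightarrow> real) \<Rightarrow> real" where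
  "seminorm1 Mx My hx hy v =
     sqrt (hx * hy * (\<Sum>i=1..Mx. \<Sum>j=1..My. (nabla_x hx v i j)\<^sup>2 + (nabla_y hy v i j)\<^sup>2))"

definition norm1 ::
  "real \<Rightarrow> real \<Rightarrow> nat \<Rightarrow> nat \<Rightarrow> real \<Rightarrow> real \<Rightarrow> (nat \<Rightarrow> nat \<Rightarrow> real) \<Rightarrow> real" where
  "norm1 b2 b3 Mx My hx hy v =
     sqrt (b2 * (norm0 Mx My hx hy v)\<^sup>2 + b3 * (seminorm1 Mx My hx hy v)\<^sup>2)"

definition a_coeff :: "real \<Rightarrow> nat \<Rightarrow> real" where
  "a_coeff \<gamma> k = (real k + 1) powr (2 - \<gamma>) - real k powr (2 - \<gamma>)"

definition at_coeff :: "real \<Rightarrow> nat \<Rightarrow> real" where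
  "at_coeff \<alpha> k =
     (if k = 0 then (1/2) powr (1 - \<alpha>)
      else (real k + 1/2) powr (1 - \<alpha>) - (real k - 1/2) powr (1 - \<alpha>))"

definition bt_coeff :: "real \<Rightarrow> nat \<Rightarrow> real" where
  "bt_coeff \<alpha> k =
     1 / (2 - \<alpha>) * ((real k + 1/2) powr (2 - \<alpha>) - (real k - 1/2) powr (2 - \<alpha>))
     - 1/2 * ((real k + 1/2) powr (1 - \<alpha>) + (real k - 1/2) powr (1 - \<alpha>))"

text \<open>\<open>c_coeff n \<alpha> k\<close> is used for \<open>n \<ge> 1\<close> and \<open>k \<le> n - 1\<close> only.\<close>

definition c_coeff :: "nat \<Rightarrow> real \<Rightarrow> nat \<Rightarrow> real" where
  "c_coeff n \<alpha> k =
     (if n = 1 then at_coeff \<alpha> 0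
      else if k = 0 then at_coeff \<alpha> 0 + bt_coeff \<alpha> 1
      else if k = n - 1 then at_coeff \<alpha> k - bt_coeff \<alpha> k
      else at_coeff \<alpha> k + bt_coeff \<alpha> (k + 1) - bt_coeff \<alpha> k)"

definition mu1 :: "real \<Rightarrow> real \<Rightarrow> real" where
  "mu1 \<tau> \<gamma> = \<tau> powr (1 - \<gamma>) / Gamma (3 - \<gamma>)"

definition mu2 :: "real \<Rightarrow> real \<Rightarrow> real" where
  "mu2 \<tau> \<alpha> = \<tau> powr (1 - \<alpha>) / Gamma (2 - \<alpha>)"

text \<open>The coefficients \<open>\<mu>\<^sub>2\<close> and \<open>\<mu>\<^sub>3\<close> are given by the same expression, \<open>mu2\<close>, in \<open>\<alpha>\<close> and \<open>\<beta>\<close>.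

  The scheme discretises the equation at \<open>t\<^sub>n - \<tau>/2\<close>. The source \<open>f\<close> is a given function rather
  than a grid unknown, and its half-index value is the one obtained from
  \<open>f\<^sup>n\<^sub>i\<^sub>j = f (x\<^sub>i, y\<^sub>j, n \<tau>)\<close> at the index \<open>n - 1/2\<close>, that is, the value at that time level. The
  mean of the values at \<open>t\<^sub>n\<close> and \<open>t\<^bsub>n-1\<^esub>\<close> is not meant: it would involve \<open>f\<close> at \<open>t = 0\<close>, where
  the equation is not posed; and on the first step the mean of a Caputo derivative of order
  \<open>\<alpha> < 1\<close> of a smooth function over the two levels differs from its midpoint value, which the
  weights \<open>c_coeff\<close> approximate, by a term of order \<open>\<tau>\<^bsup>1-\<alpha>\<^esup>\<close>, too large for the error estimate.
  For the unknown \<open>U\<close> the half-index value is the mean of two time levels, \<open>half_avg\<close>.\<close>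

definition solves_S ::
  "nat \<Rightarrow> nat \<Rightarrow> nat \<Rightarrow> (nat \<Rightarrow> real) \<Rightarrow> real \<Rightarrow> real \<Rightarrow> real \<Rightarrow> (nat \<Rightarrow> real) \<Rightarrow> (nat \<Rightarrow> real) \<Rightarrow>
   (nat \<Rightarrow> real) \<Rightarrow> (nat \<Rightarrow> real) \<Rightarrow> (nat \<Rightarrow> real) \<Rightarrow> real \<Rightarrow> real \<Rightarrow> real \<Rightarrow>
   (real \<Rightarrow> real \<Rightarrow> real \<Rightarrow> real) \<Rightarrow> (real \<Rightarrow> real \<Rightarrow> real) \<Rightarrow> (real \<Rightarrow> real \<Rightarrow> real) \<Rightarrow>
   nat \<Rightarrow> nat \<Rightarrow> nat \<Rightarrow> (nat \<Rightarrow> nat \<Rightarrow> nat \<Rightarrow> real) \<Rightarrow> bool" where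
  "solves_S p q s a b1 b2 b3 c d \<gamma> \<alpha> \<beta> T Lx Ly f \<phi>0 \<phi>1 Mx My N U \<longleftrightarrow>
    (let hx = Lx / real Mx; hy = Ly / real My; \<tau> = T / real N in
      (\<forall>n\<in>{1..N}. \<forall>i\<in>{1..Mx-1}. \<forall>j\<in>{1..My-1}.
        (\<Sum>l=1..p. a l * mu1 \<tau> (\<gamma> l) *
           (a_coeff (\<gamma> l) 0 * nabla_t \<tau> U n i j
            - (\<Sum>k=1..n-1. (a_coeff (\<gamma> l) (n - k - 1) - a_coeff (\<gamma> l) (n - k)) * nabla_t \<tau> U k i j)
            - a_coeff (\<gamma> l) (n - 1) * \<phi>1 (real i * hx) (real j * hy)))
        + b1 * nabla_t \<tau> U n i j
        + (\<Sum>m=1..q. c m * mu2 \<tau> (\<alpha> m) *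
             (\<Sum>k=1..n. c_coeff n (\<alpha> m) (n - k) * nabla_t \<tau> U k i j))
        + b2 * half_avg U n i j
        = b3 * laplacian_h hx hy (half_avg U n) i j
        + (\<Sum>r=1..s. d r * mu2 \<tau> (\<beta> r) *
             (\<Sum>k=1..n. c_coeff n (\<beta> r) (n - k) *
                nabla_t \<tau> (\<lambda>k'. laplacian_h hx hy (U k')) k i j))
        + f (real i * hx) (real j * hy) ((real n - 1/2) * \<tau>)) \<and>
      (\<forall>i\<le>Mx. \<forall>j\<le>My. U 0 i j = \<phi>0 (real i * hx) (real j * hy)) \<and>
      (\<forall>n\<in>{1..N}. in_Vh Mx My (U n)))"

end

theory Submission
  imports Defs
begin

text \<open>
  Testing the error equation with \<open>\<nabla>\<^sub>t e\<^sup>n\<close> and summing over \<open>n\<close>, the fractional terms give nonnegative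
  quadratic forms and \<open>b\<^sub>1\<close> absorbs the right hand side, so \<open>\<parallel>e\<^sup>n\<parallel>\<^sub>1\<close> is bounded by the maximum of the
  truncation error. For the terms of order \<open>\<gamma>\<close> this is not good enough: since \<open>\<phi>\<close> is the velocity at
  \<open>t = 0\<close> and not at \<open>t = - \<tau>/2\<close>, the first cell of the scheme has half the length that its weight
  assumes, and the truncation error has a part of size \<open>\<tau>\<^bsup>2-\<gamma>\<^esup> n\<^bsup>-\<gamma>\<^esup> u\<^sub>t\<^sub>t(x,y,0)\<close>. This part is summable
  in \<open>n\<close> and is an explicit function of \<open>n\<close> times a smooth function of space. It is removed by
  replacing \<open>u\<close> by \<open>u + \<zeta>\<^sub>n u\<^sub>t\<^sub>t(x,y,0)\<close>, where the velocities \<open>\<eta>\<^sub>n\<close> of \<open>\<zeta>\<close> solve the scalar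
  discrete equation consisting of the \<open>\<gamma>\<close> terms and the \<open>b\<^sub>1\<close> term. Its matrix is an M-matrix, so
  \<open>\<eta> \<ge> 0\<close>, and summing the equation over \<open>n\<close> bounds \<open>\<zeta>\<close> by \<open>\<tau>\<^bsup>3-\<gamma>\<^esup>\<close> and the contribution of \<open>\<zeta>\<close> to
  the terms of order less than one by \<open>\<tau>\<^bsup>3-\<gamma>\<^esup> + \<tau>\<^bsup>2-\<alpha>\<^esup>\<close>.
\<close>

text \<open>The weights \<open>c_coeff\<close> are not a function of \<open>n - k\<close> alone: the
  oldest quotient lacks a slope correction, so their form is not Toeplitz. Positivity is therefore
  drawn from sign conditions on first and mixed differences of a triangular array, and these from
  writing every weight as a moment of the kernel over one cell. Only the condition at the diagonal
  does not follow from monotonicity and convexity of the kernel; there the half cell ending at the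
  midpoint leads to a numerical inequality between powers of 3 and 5. For the orders above one, a
  bound of the truncation error cell by cell yields only order \<tau>. The missing power is gained
  because the error in the second derivative has mean zero on each interior cell, so that only
  increments of the kernel count, and these telescope. In space, the discrete Laplacian of u at a
  fixed grid point is treated as a function of time whose derivatives are bounded independently of
  the mesh. The truncation results in time then apply to it as they do to u, and only its distance
  to the true Laplacian remains. The square root in the claim does not depend on the grid, so a
  suitable choice of C absorbs it.\<close>

section \<open>Quadratic forms and moments of power kernels\<close>

text \<open>With \<open>S\<close> the partial sums of \<open>v\<close>, summation by parts in \<open>k\<close> turns the form into the increments of the
  potential \<open>E m = (\<Sum>i<m. (A (m+1) (i+1) - A (m+1) i) * (S m - S i)\<^sup>2)\<close> plus nonnegative terms.\<close>
lemma quadratic_form_nonneg: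
  fixes A :: "nat \<Rightarrow> nat \<Rightarrow> real" and v :: "nat \<Rightarrow> real"
  assumes zero: "\<And>n. A n 0 = 0"
    and mono: "\<And>n i. i < n \<Longrightarrow> A (Suc n) i \<le> A (Suc n) (Suc i)"
    and mixed: "\<And>m i. i < m \<Longrightarrow>
      A (Suc (Suc m)) (Suc i) - A (Suc (Suc m)) i \<le> A (Suc m) (Suc i) - A (Suc m) i"
    and diag: "\<And>m. A (Suc (Suc m)) (Suc m) - A (Suc (Suc m)) m + A (Suc m) m
      \<le> 2 * A (Suc m) (Suc m)"
  shows "0 \<le> (\<Sum>n=1..N. \<Sum>k=1..n. A n k * (v k * v n))"
proof -
  define S where "S n = (\<Sum>j=1..n. v j)" for n
  define B where "B n i = A n (Suc i) - A n i" for n i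
  define E where "E m = (\<Sum>i<m. B (Suc m) i * (S m - S i)\<^sup>2)" for m
  have S_Suc: "S (Suc m) = S m + v (Suc m)" for m
    by (simp add: S_def)
  have row: "(\<Sum>k=1..n. A n k * v k) = (\<Sum>i<n. B n i * (S n - S i))" for n
  proof -
    have "(\<Sum>i<n. A n (Suc i) * (S n - S (Suc i)) - A n i * (S n - S i)) = 0"
      using sum_lessThan_telescope[of "\<lambda>i. A n i * (S n - S i)" n] zero by simp
    moreover have "A n (Suc i) * (S n - S (Suc i)) - A n i * (S n - S i)
        = B n i * (S n - S i) - A n (Suc i) * v (Suc i)" for i
      by (simp add: B_def S_Suc algebra_simps)
    ultimately have "(\<Sum>i<n. B n i * (S n - S i)) = (\<Sum>i<n. A n (Suc i) * v (Suc i))"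
      by (simp add: sum_subtractf)
    also have "\<dots> = (\<Sum>k=1..n. A n k * v k)"
      by (simp add: sum.atLeast1_atMost_eq)
    finally show ?thesis by simp
  qed
  have step: "E (Suc m) - E m \<le> 2 * (\<Sum>k=1..Suc m. A (Suc m) k * (v k * v (Suc m)))" for m
  proof -
    let ?n = "Suc m"
    let ?v = "v (Suc m)"
    have sumB: "(\<Sum>i<?n. B ?n i) = A ?n ?n"
      using sum_lessThan_telescope[of "A ?n" ?n] zero by (simp add: B_def)
    have "2 * (\<Sum>k=1..?n. A ?n k * (v k * ?v)) = 2 * ?v * (\<Sum>k=1..?n. A ?n k * v k)"
      by (simp only: sum_distrib_left sum_distrib_right mult_ac)
    also have "\<dots> = (\<Sum>i<?n. B ?n i * (2 * ?v * (S ?n - S i)))"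
      unfolding row sum_distrib_left by (intro sum.cong) (auto simp: algebra_simps)
    \<comment> \<open>Since \<open>S ?n = S m + ?v\<close>, twice \<open>?v * (S ?n - S i)\<close>
      is a difference of squares plus \<open>?v\<^sup>2\<close>. Summed over i, the extra squares
      carry the full weight \<open>A ?n ?n\<close> by \<open>sumB\<close>.\<close>
    also have "\<dots> = (\<Sum>i<?n. B ?n i * (S ?n - S i)\<^sup>2 - B ?n i * (S m - S i)\<^sup>2 + B ?n i * ?v\<^sup>2)"
      by (intro sum.cong) (auto simp: S_Suc power2_eq_square algebra_simps)
    also have "\<dots> = (\<Sum>i<m. B ?n i * (S ?n - S i)\<^sup>2) + B ?n m * ?v\<^sup>2 - E m + A ?n ?n * ?v\<^sup>2"
      by (simp add: sum.distrib sum_subtractf E_def S_Suc sumB[symmetric] sum_distrib_right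
          del: sum.lessThan_Suc) (simp add: sum_distrib_right algebra_simps S_Suc)
    also have "\<dots> \<ge> (\<Sum>i<m. B (Suc ?n) i * (S ?n - S i)\<^sup>2) + B ?n m * ?v\<^sup>2 - E m + A ?n ?n * ?v\<^sup>2"
      using mixed by (intro add_mono diff_mono sum_mono mult_right_mono) (auto simp: B_def)
    moreover have "E ?n = (\<Sum>i<m. B (Suc ?n) i * (S ?n - S i)\<^sup>2) + B (Suc ?n) m * ?v\<^sup>2"
      by (simp add: E_def S_Suc)
    \<comment> \<open>The new potential has one summand more, \<open>i = m\<close>. Its weight must
      be paid by the last increment and the diagonal entry, which is what \<open>diag\<close>
      grants.\<close>
    moreover have "B (Suc ?n) m * ?v\<^sup>2 \<le> (B ?n m + A ?n ?n) * ?v\<^sup>2"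
      using diag[of m] by (intro mult_right_mono) (auto simp: B_def)
    ultimately show ?thesis by (simp add: algebra_simps)
  qed
  have "E N \<le> 2 * (\<Sum>n=1..N. \<Sum>k=1..n. A n k * (v k * v n))"
  proof (induction N)
    case 0
    then show ?case by (simp add: E_def)
  next
    case (Suc N)
    then show ?case using step[of N] by simp
  qed
  moreover have "0 \<le> E N"
    using mono by (auto simp: E_def B_def intro!: sum_nonneg)
  ultimately show ?thesis by simp
qed

text \<open>For \<open>r = t\<close> and \<theta> < 1 the kernel is singular at the end point, but
  the antiderivative is continuous there; hence the fundamental theorem in the form that
  differentiates in the interior only.\<close>

lemma powr_kernel_integral:
  fixes t l r \<theta> :: real
  assumes "l \<le> r" "r \<le> t" "\<theta> > 0"
  shows "((\<lambda>s. (t - s) powr (\<theta> - 1)) has_integral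
    ((t - l) powr \<theta> - (t - r) powr \<theta>) / \<theta>) {l..r}"
proof -
  have "((\<lambda>s. (t - s) powr (\<theta> - 1)) has_integral
      (- ((t - r) powr \<theta>) / \<theta>) - (- ((t - l) powr \<theta>) / \<theta>)) {l..r}"
  proof (rule fundamental_theorem_of_calculus_interior)
    show "continuous_on {l..r} (\<lambda>s. - ((t - s) powr \<theta>) / \<theta>)"
      using assms by (intro continuous_intros continuous_on_powr') auto
    fix s assume "s \<in> {l<..<r}"
    then have "((\<lambda>s. - ((t - s) powr \<theta>) / \<theta>) has_real_derivative (t - s) powr (\<theta> - 1)) (at s)"
      using assms by (auto intro!: derivative_eq_intros simp: field_simps)
    then show "((\<lambda>s. - ((t - s) powr \<theta>) / \<theta>) has_vector_derivative (t - s) powr (\<theta> - 1)) (at s)"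
      by (simp add: has_real_derivative_iff_has_vector_derivative)
  qed (use assms in auto)
  then show ?thesis by (simp add: diff_divide_distrib)
qed

lemma powr_kernel_moment:
  fixes t l r \<theta> c :: real
  assumes "l \<le> r" "r \<le> t" "\<theta> > 0"
  shows "((\<lambda>s. (t - s) powr (\<theta> - 1) * (s - c)) has_integral
    (l - c) * (t - l) powr \<theta> / \<theta> - (r - c) * (t - r) powr \<theta> / \<theta>
    + ((t - l) powr (\<theta> + 1) - (t - r) powr (\<theta> + 1)) / (\<theta> * (\<theta> + 1))) {l..r}"
proof -
  \<comment> \<open>\<open>F\<close> comes from integration by parts. \<open>A\<close> and
    \<open>B\<close> hide the divisions, and the relations \<open>AB\<close> are all that its
    differentiation uses.\<close>
  define A where "A = 1 / \<theta>"
  define B where "B = 1 / (\<theta> * (\<theta> + 1))"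
  have AB: "A * \<theta> = 1" "B * (\<theta> + 1) = A"
    using assms by (simp_all add: A_def B_def)
  define F where "F s = - (A * ((s - c) * (t - s) powr \<theta>)) - B * (t - s) powr (\<theta> + 1)" for s
  have "((\<lambda>s. (t - s) powr (\<theta> - 1) * (s - c)) has_integral F r - F l) {l..r}"
  proof (rule fundamental_theorem_of_calculus_interior)
    show "continuous_on {l..r} F"
      unfolding F_def using assms by (intro continuous_intros continuous_on_powr') auto
    fix s assume s: "s \<in> {l<..<r}"
    have "(F has_real_derivative - (A * ((t - s) powr \<theta> - (s - c) * (\<theta> * (t - s) powr (\<theta> - 1))))
        + B * ((\<theta> + 1) * (t - s) powr \<theta>)) (at s)"
      unfolding F_def using assms s
      by (auto intro!: derivative_eq_intros simp: algebra_simps)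
    also have "- (A * ((t - s) powr \<theta> - (s - c) * (\<theta> * (t - s) powr (\<theta> - 1))))
        + B * ((\<theta> + 1) * (t - s) powr \<theta>)
      = (A * \<theta>) * ((t - s) powr (\<theta> - 1) * (s - c)) + (B * (\<theta> + 1) - A) * (t - s) powr \<theta>"
      by (simp add: algebra_simps)
    finally show "(F has_vector_derivative (t - s) powr (\<theta> - 1) * (s - c)) (at s)"
      by (simp add: AB has_real_derivative_iff_has_vector_derivative)
  qed (use assms in auto)
  moreover have "F r - F l = (l - c) * (t - l) powr \<theta> / \<theta> - (r - c) * (t - r) powr \<theta> / \<theta>
    + ((t - l) powr (\<theta> + 1) - (t - r) powr (\<theta> + 1)) / (\<theta> * (\<theta> + 1))"
    by (simp add: F_def A_def B_def diff_divide_distrib)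
  ultimately show ?thesis by simp
qed

lemma powr_neg_antimono: "0 < x \<Longrightarrow> x \<le> y \<Longrightarrow> 0 \<le> \<beta> \<Longrightarrow> y powr (- \<beta>) \<le> x powr (- \<beta>)" for x :: real
  using powr_mono2'[of "-\<beta>" x y] by simp

text \<open>Log-convexity: by x (x + 2) \<le> (x + 1)^2 the middle value is at most the geometric
  mean of the outer ones, hence at most their arithmetic mean.\<close>

lemma powr_neg_second_difference:
  fixes x \<beta> :: real
  assumes "x > 0" "\<beta> > 0"
  shows "2 * (x + 1) powr (- \<beta>) \<le> x powr (- \<beta>) + (x + 2) powr (- \<beta>)"
proof -
  define p where "p = x powr (- \<beta> / 2)"
  define q where "q = (x + 2) powr (- \<beta> / 2)"
  have "x * (x + 2) \<le> (x + 1)\<^sup>2" by (simp add: power2_eq_square algebra_simps)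
  then have "((x + 1)\<^sup>2) powr (- \<beta> / 2) \<le> (x * (x + 2)) powr (- \<beta> / 2)"
    using powr_neg_antimono[of "x * (x + 2)" "(x + 1)\<^sup>2" "\<beta> / 2"] assms by simp
  moreover have "((x + 1)\<^sup>2) powr (- \<beta> / 2) = (x + 1) powr (- \<beta>)"
    using assms by (simp add: powr_powr flip: powr_numeral)
  moreover have "(x * (x + 2)) powr (- \<beta> / 2) = p * q"
    using assms by (simp add: p_def q_def powr_mult)
  moreover have "x powr (- \<beta>) = p\<^sup>2" "(x + 2) powr (- \<beta>) = q\<^sup>2"
    using assms by (simp_all add: p_def q_def power2_eq_square flip: powr_add)
  moreover have "2 * (p * q) \<le> p\<^sup>2 + q\<^sup>2"
    using sum_squares_bound[of p q] by simp
  ultimately show ?thesis by linarith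
qed

text \<open>On both sides of 0, replacing \<open>g s\<close> by \<open>g 0\<close> can only decrease
  \<open>g s * s\<close>, and the identity has mean zero on the centred cell. This turns
  monotonicity of a kernel into the sign of its first moment.\<close>

lemma centred_moment_nonneg:
  fixes g :: "real \<Rightarrow> real"
  assumes "((\<lambda>s. g s * s) has_integral I) {-1/2..1/2}"
    and mono: "\<And>s s'. - 1/2 \<le> s \<Longrightarrow> s \<le> s' \<Longrightarrow> s' \<le> 1/2 \<Longrightarrow> g s \<le> g s'"
  shows "0 \<le> I"
proof -
  have "((\<lambda>s. s\<^sup>2 / 2) has_vector_derivative s) (at s within {- 1/2..1/2})" for s :: real
    by (auto intro!: derivative_eq_intros simp: has_real_derivative_iff_has_vector_derivative[symmetric])
  then have "((\<lambda>s::real. s) has_integral (1/2)\<^sup>2 / 2 - (- 1/2)\<^sup>2 / 2) {-1/2..1/2}"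
    by (intro fundamental_theorem_of_calculus) auto
  then have "((\<lambda>s::real. s) has_integral 0) {-1/2..1/2}"
    by (simp add: power2_eq_square)
  then have "((\<lambda>s. g 0 * s) has_integral g 0 * 0) {-1/2..1/2}"
    by (rule has_integral_mult_right)
  moreover have "g 0 * s \<le> g s * s" if "s \<in> {-1/2..1/2}" for s
    using that mono[of 0 s] mono[of s 0]
    by (cases "s \<ge> 0") (auto intro: mult_right_mono mult_right_mono_neg)
  ultimately show ?thesis
    using has_integral_le[OF _ assms(1), of "\<lambda>s. g 0 * s" "g 0 * 0"] by simp
qed

section \<open>The weights of the approximation of order less than one\<close>

text \<open>This and the next lemma are instances of complete monotonicity: differentiation lowers
  the exponent by one and leaves a difference of the same shape, whose sign is known.\<close>

lemma powr_neg_diff_antimono: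
  fixes x y \<alpha> :: real
  assumes "0 < x" "x \<le> y" "\<alpha> > 0"
  shows "y powr (- \<alpha>) - (y + 1) powr (- \<alpha>) \<le> x powr (- \<alpha>) - (x + 1) powr (- \<alpha>)"
proof (rule DERIV_nonpos_imp_nonincreasing[OF assms(2), of "\<lambda>z. z powr (- \<alpha>) - (z + 1) powr (- \<alpha>)"])
  fix z assume "x \<le> z" "z \<le> y"
  then have z: "z > 0" using assms by simp
  have "((\<lambda>z. z powr (- \<alpha>) - (z + 1) powr (- \<alpha>)) has_real_derivative
      - \<alpha> * (z powr (- \<alpha> - 1) - (z + 1) powr (- \<alpha> - 1))) (at z)"
    using z by (auto intro!: derivative_eq_intros simp: algebra_simps)
  moreover have "(z + 1) powr (- \<alpha> - 1) \<le> z powr (- \<alpha> - 1)"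
    using powr_neg_antimono[of z "z + 1" "\<alpha> + 1"] z assms by simp
  ultimately show "\<exists>d. ((\<lambda>z. z powr (- \<alpha>) - (z + 1) powr (- \<alpha>)) has_real_derivative d) (at z) \<and> d \<le> 0"
    using assms by (auto simp: mult_nonneg_nonneg)
qed

lemma powr_neg_second_difference_antimono:
  fixes x y \<alpha> :: real
  assumes "0 < x" "x \<le> y" "\<alpha> > 0"
  shows "y powr (- \<alpha>) - 2 * (y + 1) powr (- \<alpha>) + (y + 2) powr (- \<alpha>)
    \<le> x powr (- \<alpha>) - 2 * (x + 1) powr (- \<alpha>) + (x + 2) powr (- \<alpha>)"
proof (rule DERIV_nonpos_imp_nonincreasing[OF assms(2),
      of "\<lambda>z. z powr (- \<alpha>) - 2 * (z + 1) powr (- \<alpha>) + (z + 2) powr (- \<alpha>)"])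
  fix z assume "x \<le> z" "z \<le> y"
  then have z: "z > 0" using assms by simp
  let ?d = "- \<alpha> * (z powr (- \<alpha> - 1) - 2 * (z + 1) powr (- \<alpha> - 1) + (z + 2) powr (- \<alpha> - 1))"
  have "((\<lambda>z. z powr (- \<alpha>) - 2 * (z + 1) powr (- \<alpha>) + (z + 2) powr (- \<alpha>))
      has_real_derivative ?d) (at z)"
    using z by (auto intro!: derivative_eq_intros simp: algebra_simps)
  moreover have "?d \<le> 0"
    using powr_neg_second_difference[of z "\<alpha> + 1"] z assms by (auto simp: mult_nonneg_nonneg)
  ultimately show "\<exists>d. ((\<lambda>z. z powr (- \<alpha>) - 2 * (z + 1) powr (- \<alpha>) + (z + 2) powr (- \<alpha>))
      has_real_derivative d) (at z) \<and> d \<le> 0"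
    by blast
qed

lemma has_integral_eq_both:
  "(f has_integral I) S \<Longrightarrow> (\<And>x. f x = g x) \<Longrightarrow> I = J \<Longrightarrow> (g has_integral J) S"
  by (metis ext)

lemma of_nat_Suc_diff:
  "real (Suc j) - s = real j - s + 1" "real (Suc (Suc j)) - s = real j - s + 2"
  by simp_all

text \<open>Identifies \<open>bt_coeff\<close>, up to 1 - \<alpha>, as the first centred moment of
  the kernel over a unit cell at distance j. Its sign, monotonicity and convexity in j thereby
  reduce to monotonicity in s of the kernel and its differences, through
  \<open>centred_moment_nonneg\<close>.\<close>

lemma bt_coeff_integral:
  assumes "j \<ge> 1" "0 < \<alpha>" "\<alpha> < 1"
  shows "((\<lambda>s. (real j - s) powr (- \<alpha>) * s) has_integral bt_coeff \<alpha> j / (1 - \<alpha>)) {-1/2..1/2}"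
proof -
  have "((\<lambda>s. (real j - s) powr ((1 - \<alpha>) - 1) * (s - 0)) has_integral
    (- 1/2 - 0) * (real j - - 1/2) powr (1 - \<alpha>) / (1 - \<alpha>) - (1/2 - 0) * (real j - 1/2) powr (1 - \<alpha>) / (1 - \<alpha>)
    + ((real j - - 1/2) powr (1 - \<alpha> + 1) - (real j - 1/2) powr (1 - \<alpha> + 1)) / ((1 - \<alpha>) * (1 - \<alpha> + 1))) {-1/2..1/2}"
    using assms by (intro powr_kernel_moment) auto
  also have "(- 1/2 - 0) * (real j - - 1/2) powr (1 - \<alpha>) / (1 - \<alpha>) - (1/2 - 0) * (real j - 1/2) powr (1 - \<alpha>) / (1 - \<alpha>)
    + ((real j - - 1/2) powr (1 - \<alpha> + 1) - (real j - 1/2) powr (1 - \<alpha> + 1)) / ((1 - \<alpha>) * (1 - \<alpha> + 1))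
    = bt_coeff \<alpha> j / (1 - \<alpha>)"
    by (simp add: bt_coeff_def add_divide_distrib diff_divide_distrib mult.commute)
  finally show ?thesis by simp
qed

text \<open>Weight of the difference quotient of the oldest cell; the other weights of \<^const>\<open>c_coeff\<close> have
  an additional \<^const>\<open>bt_coeff\<close> from the slope correction of the cell before.\<close>
definition pt_coeff :: "real \<Rightarrow> nat \<Rightarrow> real" where
  "pt_coeff \<alpha> j = (if j = 0 then at_coeff \<alpha> 0 else at_coeff \<alpha> j - bt_coeff \<alpha> j)"

text \<open>The linear function with the value of this cell's quotient at s = 0 and of the next
  quotient at s = 1 gives this quotient the weight 1 - s. That weight is positive on the cell, so
  here the sign properties pass from the kernel pointwise.\<close>

lemma pt_coeff_integral:
  assumes "j \<ge> 1" "0 < \<alpha>" "\<alpha> < 1"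
  shows "((\<lambda>s. (real j - s) powr (- \<alpha>) * (1 - s)) has_integral pt_coeff \<alpha> j / (1 - \<alpha>)) {-1/2..1/2}"
proof -
  have *: "((\<lambda>s. (real j - s) powr (- \<alpha>)) has_integral at_coeff \<alpha> j / (1 - \<alpha>)) {-1/2..1/2}"
    by (rule has_integral_eq_both[OF powr_kernel_integral[where \<theta> = "1 - \<alpha>"]])
      (use assms in \<open>auto simp: at_coeff_def\<close>)
  show ?thesis
    by (rule has_integral_eq_both[OF has_integral_diff[OF * bt_coeff_integral[OF assms]]])
      (simp only: right_diff_distrib mult_1_right, use assms in \<open>simp only: pt_coeff_def diff_divide_distrib[symmetric]\<close>, simp)
qed

context
  fixes \<alpha> :: real
  assumes \<alpha>: "0 < \<alpha>" "\<alpha> < 1"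
begin

lemma div_nonneg_imp: "0 \<le> x / (1 - \<alpha>) \<Longrightarrow> 0 \<le> x"
  using \<alpha> by (simp add: zero_le_divide_iff)

lemma bt_coeff_nonneg: "j \<ge> 1 \<Longrightarrow> 0 \<le> bt_coeff \<alpha> j"
  using \<alpha>
  by (intro div_nonneg_imp[OF centred_moment_nonneg[OF bt_coeff_integral]])
    (auto intro!: powr_neg_antimono)

lemma bt_coeff_decreasing:
  assumes "j \<ge> 1"
  shows "bt_coeff \<alpha> (Suc j) \<le> bt_coeff \<alpha> j"
proof -
  let ?g = "\<lambda>s. (real j - s) powr (- \<alpha>) - (real j - s + 1) powr (- \<alpha>)"
  have "((\<lambda>s. ?g s * s) has_integral (bt_coeff \<alpha> j - bt_coeff \<alpha> (Suc j)) / (1 - \<alpha>)) {-1/2..1/2}"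
    by (rule has_integral_eq_both[OF has_integral_diff[OF bt_coeff_integral[OF assms \<alpha>]
          bt_coeff_integral[of "Suc j", OF _ \<alpha>]]])
      (simp, simp only: of_nat_Suc_diff[of j] left_diff_distrib distrib_right mult.assoc, simp only: diff_divide_distrib)
  then have "0 \<le> (bt_coeff \<alpha> j - bt_coeff \<alpha> (Suc j)) / (1 - \<alpha>)"
    by (rule centred_moment_nonneg) (use assms \<alpha> in \<open>auto intro!: powr_neg_diff_antimono\<close>)
  from div_nonneg_imp[OF this] show ?thesis by simp
qed

lemma bt_coeff_convex:
  assumes "j \<ge> 1"
  shows "2 * bt_coeff \<alpha> (Suc j) \<le> bt_coeff \<alpha> j + bt_coeff \<alpha> (Suc (Suc j))"
proof -
  let ?g = "\<lambda>s. (real j - s) powr (- \<alpha>) - 2 * (real j - s + 1) powr (- \<alpha>) + (real j - s + 2) powr (- \<alpha>)"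
  have "((\<lambda>s. ?g s * s) has_integral
      (bt_coeff \<alpha> j - 2 * bt_coeff \<alpha> (Suc j) + bt_coeff \<alpha> (Suc (Suc j))) / (1 - \<alpha>)) {-1/2..1/2}"
    by (rule has_integral_eq_both[OF has_integral_add[OF has_integral_diff[OF bt_coeff_integral[OF assms \<alpha>]
          has_integral_mult_right[OF bt_coeff_integral[of "Suc j", OF _ \<alpha>], of 2]]
          bt_coeff_integral[of "Suc (Suc j)", OF _ \<alpha>]]])
      (simp, simp, simp only: of_nat_Suc_diff[of j] left_diff_distrib distrib_right mult.assoc, simp only: diff_divide_distrib add_divide_distrib times_divide_eq_right)
  then have "0 \<le> (bt_coeff \<alpha> j - 2 * bt_coeff \<alpha> (Suc j) + bt_coeff \<alpha> (Suc (Suc j))) / (1 - \<alpha>)"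
    by (rule centred_moment_nonneg)
      (use assms \<alpha> in \<open>auto intro!: powr_neg_second_difference_antimono\<close>)
  from div_nonneg_imp[OF this] show ?thesis by simp
qed

lemma pt_coeff_nonneg: "0 \<le> pt_coeff \<alpha> j"
proof (cases "j = 0")
  case False
  then have "0 \<le> pt_coeff \<alpha> j / (1 - \<alpha>)"
    using has_integral_nonneg[OF pt_coeff_integral[OF _ \<alpha>, of j]] by auto
  then show ?thesis by (rule div_nonneg_imp)
qed (simp add: pt_coeff_def at_coeff_def)

lemma pt_coeff_decreasing:
  assumes "j \<ge> 1"
  shows "pt_coeff \<alpha> (Suc j) \<le> pt_coeff \<alpha> j"
proof -
  have "pt_coeff \<alpha> (Suc j) / (1 - \<alpha>) \<le> pt_coeff \<alpha> j / (1 - \<alpha>)"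
  proof (rule has_integral_le[OF pt_coeff_integral[of "Suc j", OF _ \<alpha>] pt_coeff_integral[OF assms \<alpha>]])
    fix s :: real assume "s \<in> {-1/2..1/2}"
    then show "(real (Suc j) - s) powr (- \<alpha>) * (1 - s) \<le> (real j - s) powr (- \<alpha>) * (1 - s)"
      using assms \<alpha> by (intro mult_right_mono powr_neg_antimono) auto
  qed simp
  then show ?thesis using \<alpha> by (simp add: divide_le_cancel)
qed

lemma pt_coeff_convex:
  assumes "j \<ge> 1"
  shows "2 * pt_coeff \<alpha> (Suc j) \<le> pt_coeff \<alpha> j + pt_coeff \<alpha> (Suc (Suc j))"
proof -
  let ?g = "\<lambda>s. (real j - s) powr (- \<alpha>) - 2 * (real j - s + 1) powr (- \<alpha>) + (real j - s + 2) powr (- \<alpha>)"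
  have "((\<lambda>s. ?g s * (1 - s)) has_integral
      (pt_coeff \<alpha> j - 2 * pt_coeff \<alpha> (Suc j) + pt_coeff \<alpha> (Suc (Suc j))) / (1 - \<alpha>)) {-1/2..1/2}"
    by (rule has_integral_eq_both[OF has_integral_add[OF has_integral_diff[OF pt_coeff_integral[OF assms \<alpha>]
          has_integral_mult_right[OF pt_coeff_integral[of "Suc j", OF _ \<alpha>], of 2]]
          pt_coeff_integral[of "Suc (Suc j)", OF _ \<alpha>]]])
      (simp, simp, simp only: of_nat_Suc_diff[of j] left_diff_distrib distrib_right mult.assoc, simp only: diff_divide_distrib add_divide_distrib times_divide_eq_right)
  then have "0 \<le> (pt_coeff \<alpha> j - 2 * pt_coeff \<alpha> (Suc j) + pt_coeff \<alpha> (Suc (Suc j))) / (1 - \<alpha>)"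
  proof (rule has_integral_nonneg)
    fix s :: real assume "s \<in> {-1/2..1/2}"
    then show "0 \<le> ?g s * (1 - s)"
      using assms \<alpha> powr_neg_second_difference[of "real j - s" \<alpha>]
      by (intro mult_nonneg_nonneg) auto
  qed
  from div_nonneg_imp[OF this] show ?thesis by simp
qed

text \<open>Dividing by 9, this is weighted Young with exponents 4/9 and 5/9 applied to 1 and
  \<open>5 powr (- \<alpha>)\<close>. It applies because \<open>5 powr (5/9)\<close> is at most 3,
  that is 5^5 \<le> 3^9.\<close>

lemma three_powr_bound: "3 * 3 powr (1 - \<alpha>) \<le> 4 + 5 powr (1 - \<alpha>)"
proof -
  have "(5::real) powr (5/9) = (5 powr 5) powr (1/9)"
    by (simp only: powr_powr) simp
  also have "\<dots> \<le> (3 powr 9) powr (1/9)"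
    by (intro powr_mono2) auto
  also have "\<dots> = (3::real)"
    by (simp only: powr_powr) simp
  finally have "3 powr (- \<alpha>) \<le> (5 powr (5/9)) powr (- \<alpha>)"
    using \<alpha> by (intro powr_neg_antimono) auto
  also have "\<dots> = 1 powr (4/9) * (5 powr (- \<alpha>)) powr (5/9)"
    by (simp add: powr_powr mult.commute)
  also have "\<dots> \<le> 4/9 * 1 + 5/9 * 5 powr (- \<alpha>)"
    by (rule Youngs_inequality_0) auto
  finally show ?thesis
    by (simp add: powr_diff powr_minus field_simps)
qed

text \<open>Both serve the diagonal condition of \<open>quadratic_form_nonneg\<close>. In the first
  the \<open>bt_coeff\<close> cancel; with \<open>(1/2) powr (1 - \<alpha>)\<close> taken out, what
  remains is \<open>three_powr_bound\<close>.\<close>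

lemma pt_coeff_diag:
  "2 * pt_coeff \<alpha> 1 - pt_coeff \<alpha> 2 \<le> 2 * pt_coeff \<alpha> 0 - 2 * bt_coeff \<alpha> 1 + bt_coeff \<alpha> 2"
  "pt_coeff \<alpha> 1 \<le> 2 * pt_coeff \<alpha> 0"
proof -
  let ?h = "(1/2) powr (1 - \<alpha>)"
  have eq: "(3/2) powr (1 - \<alpha>) = 3 powr (1 - \<alpha>) * ?h" "(5/2) powr (1 - \<alpha>) = 5 powr (1 - \<alpha>) * ?h"
    by (simp_all flip: powr_mult)
  have "3 * 3 powr (1 - \<alpha>) * ?h \<le> (4 + 5 powr (1 - \<alpha>)) * ?h"
    using three_powr_bound by (intro mult_right_mono) auto
  then show "2 * pt_coeff \<alpha> 1 - pt_coeff \<alpha> 2 \<le> 2 * pt_coeff \<alpha> 0 - 2 * bt_coeff \<alpha> 1 + bt_coeff \<alpha> 2"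
    by (simp add: pt_coeff_def at_coeff_def eq algebra_simps)
  have "(3::real) powr (1 - \<alpha>) \<le> 3 powr 1"
    using \<alpha> by (intro powr_mono) auto
  then have "3 powr (1 - \<alpha>) * ?h \<le> 3 * ?h"
    by (intro mult_right_mono) auto
  moreover have "pt_coeff \<alpha> 1 = 3 powr (1 - \<alpha>) * ?h - ?h - bt_coeff \<alpha> 1" "pt_coeff \<alpha> 0 = ?h"
    by (simp_all add: pt_coeff_def at_coeff_def eq)
  ultimately show "pt_coeff \<alpha> 1 \<le> 2 * pt_coeff \<alpha> 0"
    using bt_coeff_nonneg[of 1] by linarith
qed

lemma c_coeff_eq:
  assumes "1 \<le> k" "k \<le> n"
  shows "c_coeff n \<alpha> (n - k) = pt_coeff \<alpha> (n - k) + (if k = 1 then 0 else bt_coeff \<alpha> (n - k + 1))"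
  using assms by (auto simp: c_coeff_def pt_coeff_def)

lemma c_coeff_form_nonneg:
  "0 \<le> (\<Sum>n=1..N. \<Sum>k=1..n. c_coeff n \<alpha> (n - k) * (v k * v n))"
proof -
  \<comment> \<open>Column 0 is added with value zero because the summation by parts starts there.
    Column 1 is exceptional: no earlier cell lends it a slope correction.\<close>
  define A where "A n k = (if k = 0 then 0 else
    pt_coeff \<alpha> (n - k) + (if k = 1 then 0 else bt_coeff \<alpha> (n - k + 1)))" for n k
  have "0 \<le> (\<Sum>n=1..N. \<Sum>k=1..n. A n k * (v k * v n))"
  proof (rule quadratic_form_nonneg)
    show "A n 0 = 0" for n by (simp add: A_def)
  next
    fix n i :: nat assume "i < n"
    moreover from this obtain j where "n = i + Suc j" using less_iff_Suc_add by auto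
    ultimately show "A (Suc n) i \<le> A (Suc n) (Suc i)"
      using pt_coeff_nonneg[of n] pt_coeff_decreasing[of "Suc j"] bt_coeff_nonneg[of "Suc (Suc j)"]
        bt_coeff_decreasing[of "Suc (Suc j)"]
      by (auto simp: A_def Suc_diff_le)
  next
    fix m i :: nat assume "i < m"
    moreover from this obtain j where "m = i + Suc j" using less_iff_Suc_add by auto
    ultimately show "A (Suc (Suc m)) (Suc i) - A (Suc (Suc m)) i \<le> A (Suc m) (Suc i) - A (Suc m) i"
      using pt_coeff_decreasing[of "Suc j"] pt_coeff_convex[of "Suc j"]
        bt_coeff_decreasing[of "Suc (Suc j)"] bt_coeff_convex[of "Suc (Suc j)"]
      by (auto simp: A_def Suc_diff_le)
  next
    fix m :: nat
    \<comment> \<open>Three cases because of the exceptional columns 0 and 1. For m = 0 it is the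
      second part of \<open>pt_coeff_diag\<close>; for m = 1 and for m \<ge> 2 it is the first part,
      with the slack left by the decreasing \<open>bt_coeff\<close>.\<close>
    show "A (Suc (Suc m)) (Suc m) - A (Suc (Suc m)) m + A (Suc m) m \<le> 2 * A (Suc m) (Suc m)"
      using pt_coeff_diag bt_coeff_decreasing[of 1] bt_coeff_decreasing[of 2] bt_coeff_nonneg[of 2] bt_coeff_nonneg[of 1]
        bt_coeff_nonneg[of 3]
      by (auto simp: A_def Suc_diff_le numeral_2_eq_2 numeral_3_eq_3)
  qed
  also have "(\<Sum>n=1..N. \<Sum>k=1..n. A n k * (v k * v n))
      = (\<Sum>n=1..N. \<Sum>k=1..n. c_coeff n \<alpha> (n - k) * (v k * v n))"
    by (intro sum.cong refl) (auto simp: A_def c_coeff_eq)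
  finally show ?thesis .
qed

text \<open>The power is shifted by one so that it makes sense at k = n. The factor 4 comes from i -
  1/2 \<ge> (i + 1) / 4; the cell factors s \<le> 1/2 and 1 - s \<le> 3/2 then contribute 2 and 6 to
  the constant. The upper bound makes the weights comparable with the kernel that controls the
  corrector.\<close>

lemma c_coeff_bounds:
  assumes "1 \<le> k" "k \<le> n"
  shows "0 \<le> c_coeff n \<alpha> (n - k)" "c_coeff n \<alpha> (n - k) \<le> 8 * (real (n - k) + 1) powr (- \<alpha>)"
proof -
  show "0 \<le> c_coeff n \<alpha> (n - k)"
    using c_coeff_eq[OF assms] pt_coeff_nonneg[of "n - k"] bt_coeff_nonneg[of "n - k + 1"] by auto
  define j where "j = n - k"
  have half: "(real i - 1/2) powr (- \<alpha>) \<le> 4 * (real i + 1) powr (- \<alpha>)" if "i \<ge> 1" for i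
  proof -
    have "(real i - 1/2) powr (- \<alpha>) \<le> ((real i + 1) / 4) powr (- \<alpha>)"
      using that \<alpha> by (intro powr_neg_antimono) auto
    also have "\<dots> = 4 powr \<alpha> * (real i + 1) powr (- \<alpha>)"
      by (simp add: powr_divide powr_minus field_simps)
    also have "\<dots> \<le> 4 powr 1 * (real i + 1) powr (- \<alpha>)"
      using \<alpha> by (intro mult_right_mono powr_mono) auto
    finally show ?thesis by simp
  qed
  have const: "((\<lambda>s::real. B) has_integral B) {-1/2..1/2}" for B :: real
    using has_integral_const_real[of B "-1/2" "1/2"] by simp
  have div_le: "x \<le> B" if "x / (1 - \<alpha>) \<le> B" "0 \<le> B" for x B
  proof -
    have "x \<le> B * (1 - \<alpha>)" using that \<alpha> by (simp add: pos_divide_le_eq)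
    also have "\<dots> \<le> B" using that \<alpha> by (simp add: mult_left_le)
    finally show ?thesis .
  qed
  have "bt_coeff \<alpha> (Suc j) \<le> 1/2 * (real (Suc j) - 1/2) powr (- \<alpha>)"
  proof (rule div_le, rule has_integral_le[OF bt_coeff_integral[of "Suc j", OF _ \<alpha>] const])
    fix s :: real assume "s \<in> {-1/2..1/2}"
    then have "(real (Suc j) - s) powr (- \<alpha>) * s \<le> (real (Suc j) - s) powr (- \<alpha>) * (1/2)"
      "(real (Suc j) - s) powr (- \<alpha>) * (1/2) \<le> (real (Suc j) - 1/2) powr (- \<alpha>) * (1/2)"
      using \<alpha> by (intro mult_left_mono mult_right_mono powr_neg_antimono; simp)+
    then show "(real (Suc j) - s) powr (- \<alpha>) * s \<le> 1/2 * (real (Suc j) - 1/2) powr (- \<alpha>)" by simp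
  qed auto
  also have "\<dots> \<le> 1/2 * (4 * (real (Suc j) + 1) powr (- \<alpha>))"
    using half[of "Suc j"] by simp
  also have "\<dots> \<le> 2 * (real j + 1) powr (- \<alpha>)"
    using powr_neg_antimono[of "real j + 1" "real (Suc j) + 1" \<alpha>] \<alpha> by simp
  finally have bt: "bt_coeff \<alpha> (j + 1) \<le> 2 * (real j + 1) powr (- \<alpha>)" by simp
  have pt: "pt_coeff \<alpha> j \<le> 6 * (real j + 1) powr (- \<alpha>)"
  proof (cases "j = 0")
    case True
    have "(1/2) powr (1 - \<alpha>) \<le> (1::real)" using \<alpha> by (intro powr_le1) auto
    then show ?thesis using True by (simp add: pt_coeff_def at_coeff_def)
  next
    case False
    have "pt_coeff \<alpha> j \<le> 3/2 * (real j - 1/2) powr (- \<alpha>)"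
    proof (rule div_le, rule has_integral_le[OF pt_coeff_integral[of j, OF _ \<alpha>] const])
      fix s :: real assume "s \<in> {-1/2..1/2}"
      then have "(real j - s) powr (- \<alpha>) * (1 - s) \<le> (real j - 1/2) powr (- \<alpha>) * (3/2)"
        using \<alpha> False by (intro mult_mono powr_neg_antimono) auto
      then show "(real j - s) powr (- \<alpha>) * (1 - s) \<le> 3/2 * (real j - 1/2) powr (- \<alpha>)" by simp
    qed (use False in auto)
    then show ?thesis using half[of j] False by simp
  qed
  show "c_coeff n \<alpha> (n - k) \<le> 8 * (real (n - k) + 1) powr (- \<alpha>)"
    using c_coeff_eq[OF assms] bt pt powr_ge_zero[of "real j + 1" "- \<alpha>"]
    unfolding j_def[symmetric] by (auto split: if_splits intro: order_trans)
qed

end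

section \<open>The weights of the approximation of order greater than one, and grid functions\<close>

text \<open>The memory sum of the scheme for orders above one, without the initial velocity. The
  kernel is kept general since the weighted sum of the kernels of all orders is used as
  well.\<close>

definition l1_sum :: "(nat \<Rightarrow> real) \<Rightarrow> (nat \<Rightarrow> real) \<Rightarrow> nat \<Rightarrow> real" where
  "l1_sum L V n = L 0 * V n - (\<Sum>k=1..n-1. (L (n - k - 1) - L (n - k)) * V k)"

lemma sum_kernel_telescope:
  fixes L :: "nat \<Rightarrow> real"
  shows "(\<Sum>k=1..m. L (m - k) - L (Suc m - k)) = L 0 - L m"
proof -
  have "(\<Sum>k=1..m. L (m - k) - L (Suc m - k)) = (\<Sum>k=1..m. L (Suc m - Suc k) - L (Suc m - k))"
    by simp
  also have "\<dots> = L (Suc m - Suc m) - L (Suc m - 1)"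
    by (rule sum_Suc_diff) simp
  finally show ?thesis by simp
qed

text \<open>The convolution \<open>Q\<close> of \<open>L\<close> with the squares is a memory
  energy. Its increments are bounded by twice the terms of the form: the mixed products are split by
  2 x y \<le> x^2 + y^2, and the weights of the past add up to \<open>L 0 - L m\<close>.\<close>

lemma l1_sum_form_nonneg:
  assumes dec: "\<And>k. L (Suc k) \<le> L k" and nonneg: "\<And>k. 0 \<le> L k"
  shows "0 \<le> (\<Sum>n=1..N. V n * l1_sum L V n)"
proof -
  define Q where "Q n = (\<Sum>k=1..n. L (n - k) * (V k)\<^sup>2)" for n
  have step: "Q (Suc m) - Q m \<le> 2 * (V (Suc m) * l1_sum L V (Suc m))" for m
  proof -
    define d where "d k = L (m - k) - L (Suc m - k)" for k
    let ?v = "V (Suc m)"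
    have d: "0 \<le> d k" if "k \<in> {1..m}" for k
      using dec[of "m - k"] that by (auto simp: d_def Suc_diff_le)
    have "Q (Suc m) - Q m = L 0 * ?v\<^sup>2 - (\<Sum>k=1..m. d k * (V k)\<^sup>2)"
      by (simp add: Q_def d_def sum_subtractf left_diff_distrib)
    moreover have "l1_sum L V (Suc m) = L 0 * ?v - (\<Sum>k=1..m. d k * V k)"
      unfolding l1_sum_def d_def by (intro arg_cong2[where f = "(-)"] sum.cong) auto
    then have "2 * (?v * l1_sum L V (Suc m)) = 2 * L 0 * ?v\<^sup>2 - (\<Sum>k=1..m. d k * (2 * ?v * V k))"
      by (simp only: right_diff_distrib sum_distrib_left) (simp add: power2_eq_square mult_ac)
    moreover have "(\<Sum>k=1..m. d k * (2 * ?v * V k)) \<le> (\<Sum>k=1..m. d k * (?v\<^sup>2 + (V k)\<^sup>2))"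
      using d by (intro sum_mono mult_left_mono sum_squares_bound)
    moreover have "(\<Sum>k=1..m. d k * (?v\<^sup>2 + (V k)\<^sup>2)) = (L 0 - L m) * ?v\<^sup>2 + (\<Sum>k=1..m. d k * (V k)\<^sup>2)"
      using sum_kernel_telescope[of L m]
      by (simp add: d_def[symmetric] sum.distrib distrib_left sum_distrib_right[symmetric])
    moreover have "0 \<le> L m * ?v\<^sup>2" using nonneg by simp
    ultimately show ?thesis by (simp add: algebra_simps)
  qed
  have "Q N \<le> 2 * (\<Sum>n=1..N. V n * l1_sum L V n)"
  proof (induction N)
    case 0
    then show ?case by (simp add: Q_def)
  next
    case (Suc N)
    then show ?case using step[of N] by simp
  qed
  moreover have "0 \<le> Q N" using nonneg by (auto simp: Q_def intro!: sum_nonneg)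
  ultimately show ?thesis by simp
qed

lemma a_coeff_integral:
  assumes "1 < \<gamma>" "\<gamma> < 2"
  shows "((\<lambda>s. (real k + 1 - s) powr (1 - \<gamma>)) has_integral a_coeff \<gamma> k / (2 - \<gamma>)) {0..1}"
  by (rule has_integral_eq_both[OF powr_kernel_integral[where \<theta> = "2 - \<gamma>"]])
    (use assms in \<open>auto simp: a_coeff_def\<close>)

lemma a_coeff_0 [simp]: "a_coeff \<gamma> 0 = 1"
  by (simp add: a_coeff_def)

lemma a_coeff_lower:
  assumes "1 < \<gamma>" "\<gamma> < 2"
  shows "(2 - \<gamma>) * (real k + 1) powr (1 - \<gamma>) \<le> a_coeff \<gamma> k"
proof -
  have "((\<lambda>s::real. (real k + 1) powr (1 - \<gamma>)) has_integral (real k + 1) powr (1 - \<gamma>)) {0..1}"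
    using has_integral_const_real[of "(real k + 1) powr (1 - \<gamma>)" 0 1] by simp
  \<comment> \<open>The integrals are compared on the open interval: at k = 0, s = 1 the kernel has
    the default value \<open>0 powr (1 - \<gamma>) = 0\<close>, and the pointwise inequality would
    fail. The same happens in \<open>a_coeff_decreasing\<close>.\<close>
  then have "(real k + 1) powr (1 - \<gamma>) \<le> a_coeff \<gamma> k / (2 - \<gamma>)"
    using a_coeff_integral[OF assms, of k] unfolding has_integral_Icc_iff_Ioo
    by (rule has_integral_le) (use assms powr_neg_antimono[of _ _ "\<gamma> - 1"] in auto)
  then show ?thesis using assms by (simp add: field_simps)
qed

lemma a_coeff_nonneg: "\<gamma> < 2 \<Longrightarrow> 0 \<le> a_coeff \<gamma> k"
  by (auto simp: a_coeff_def intro!: powr_mono2)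

lemma a_coeff_decreasing:
  assumes "1 < \<gamma>" "\<gamma> < 2"
  shows "a_coeff \<gamma> (Suc k) \<le> a_coeff \<gamma> k"
proof -
  have "a_coeff \<gamma> (Suc k) / (2 - \<gamma>) \<le> a_coeff \<gamma> k / (2 - \<gamma>)"
    using a_coeff_integral[OF assms, of "Suc k"] a_coeff_integral[OF assms, of k]
    unfolding has_integral_Icc_iff_Ioo
    by (rule has_integral_le) (use assms powr_neg_antimono[of _ _ "\<gamma> - 1"] in auto)
  then show ?thesis using assms by (simp add: divide_le_cancel)
qed

lemma sum_pull_coefficients:
  fixes f :: "'a \<Rightarrow> 'b \<Rightarrow> real"
  shows "(\<Sum>n\<in>I. \<Sum>x\<in>X. f n x * (\<Sum>l\<in>K. A l * g l n x))
    = (\<Sum>l\<in>K. A l * (\<Sum>n\<in>I. \<Sum>x\<in>X. f n x * g l n x))"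
proof -
  have "(\<Sum>x\<in>X. f n x * (\<Sum>l\<in>K. A l * g l n x)) = (\<Sum>l\<in>K. A l * (\<Sum>x\<in>X. f n x * g l n x))" for n
    unfolding sum_distrib_left by (subst sum.swap) (simp add: mult_ac)
  then show ?thesis
    unfolding sum_distrib_left[of "A _" _ I] by (simp add: sum.swap[of _ K I])
qed

text \<open>The scalar inequality is used for each x separately. Here x ranges over grid points, and
  \<open>F\<close> is a difference quotient in time or its discrete gradient.\<close>

lemma sum_product_form_nonneg:
  fixes F :: "'a \<Rightarrow> nat \<Rightarrow> real"
  assumes "\<And>v. 0 \<le> (\<Sum>n=1..N. \<Sum>k=1..n. C n k * (v k * v n))"
  shows "0 \<le> (\<Sum>n=1..N. \<Sum>k=1..n. C n k * (\<Sum>x\<in>X. F x k * F x n))"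
proof -
  have "(\<Sum>n=1..N. \<Sum>k=1..n. C n k * (\<Sum>x\<in>X. F x k * F x n))
      = (\<Sum>x\<in>X. \<Sum>n=1..N. \<Sum>k=1..n. C n k * (F x k * F x n))"
    unfolding sum_distrib_left by (simp only: sum.swap[of _ X])
  also have "\<dots> \<ge> 0" by (rule sum_nonneg) (rule assms)
  finally show ?thesis .
qed

section \<open>Bilinear forms of grid functions and the discrete Green formula\<close>

definition grid_inner :: "nat \<Rightarrow> nat \<Rightarrow> (nat \<Rightarrow> nat \<Rightarrow> real) \<Rightarrow> (nat \<Rightarrow> nat \<Rightarrow> real) \<Rightarrow> real" where
  "grid_inner Mx My v w = (\<Sum>x\<in>{1..Mx-1} \<times> {1..My-1}. v (fst x) (snd x) * w (fst x) (snd x))"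

definition grid_dirichlet ::
  "nat \<Rightarrow> nat \<Rightarrow> real \<Rightarrow> real \<Rightarrow> (nat \<Rightarrow> nat \<Rightarrow> real) \<Rightarrow> (nat \<Rightarrow> nat \<Rightarrow> real) \<Rightarrow> real" where
  "grid_dirichlet Mx My hx hy v w =
    (\<Sum>x\<in>{1..Mx} \<times> {1..My}. nabla_x hx v (fst x) (snd x) * nabla_x hx w (fst x) (snd x))
    + (\<Sum>x\<in>{1..Mx} \<times> {1..My}. nabla_y hy v (fst x) (snd x) * nabla_y hy w (fst x) (snd x))"

lemma norm1_eq:
  assumes "0 \<le> hx" "0 \<le> hy"
  shows "norm1 b2 b3 Mx My hx hy v
    = sqrt (hx * hy * (b2 * grid_inner Mx My v v + b3 * grid_dirichlet Mx My hx hy v v))"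
proof -
  have "(\<Sum>i=1..Mx-1. \<Sum>j=1..My-1. (v i j)\<^sup>2) = grid_inner Mx My v v"
    by (simp add: grid_inner_def sum.cartesian_product power2_eq_square case_prod_beta)
  moreover have "(\<Sum>i=1..Mx. \<Sum>j=1..My. (nabla_x hx v i j)\<^sup>2 + (nabla_y hy v i j)\<^sup>2)
      = grid_dirichlet Mx My hx hy v v"
    by (simp add: grid_dirichlet_def sum.cartesian_product power2_eq_square case_prod_beta sum.distrib)
  moreover have "0 \<le> grid_inner Mx My v v" "0 \<le> grid_dirichlet Mx My hx hy v v"
    by (auto simp: grid_inner_def grid_dirichlet_def intro!: sum_nonneg add_nonneg_nonneg)
  ultimately show ?thesis
    using assms by (simp add: norm1_def norm0_def seminorm1_def algebra_simps)
qed

lemma summation_by_parts: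
  fixes v w :: "nat \<Rightarrow> real"
  assumes "M \<ge> 1" "w 0 = 0" "w M = 0"
  shows "(\<Sum>i=1..M-1. (v (i - 1) - 2 * v i + v (i + 1)) * w i)
    = - (\<Sum>i=1..M. (v i - v (i - 1)) * (w i - w (i - 1)))"
proof -
  have "(\<Sum>i=1..m. (v (i - 1) - 2 * v i + v (i + 1)) * w i)
      + (\<Sum>i=1..m. (v i - v (i - 1)) * (w i - w (i - 1)))
      = (v (m + 1) - v m) * w m - (v 1 - v 0) * w 0" for m
    by (induction m) (simp_all add: algebra_simps)
  from this[of "M - 1"] obtain m where "M = Suc m"
    "(\<Sum>i=1..m. (v (i - 1) - 2 * v i + v (i + 1)) * w i)
      + (\<Sum>i=1..m. (v i - v (i - 1)) * (w i - w (i - 1))) = (v (m + 1) - v m) * w m"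
    using assms by (cases M) auto
  then show ?thesis using assms by (simp add: algebra_simps)
qed

lemma green_laplacian_h:
  assumes w: "in_Vh Mx My w" and M: "Mx \<ge> 1" "My \<ge> 1"
  shows "grid_inner Mx My (laplacian_h hx hy v) w = - grid_dirichlet Mx My hx hy v w"
proof -
  have w0: "w 0 j = 0" "w Mx j = 0" if "j \<le> My" for j using w that by (auto simp: in_Vh_def)
  have w1: "w i 0 = 0" "w i My = 0" if "i \<le> Mx" for i using w that by (auto simp: in_Vh_def)
  have x: "(\<Sum>i=1..Mx-1. (v (i - 1) j - 2 * v i j + v (i + 1) j) / hx\<^sup>2 * w i j)
      = - (\<Sum>i=1..Mx. nabla_x hx v i j * nabla_x hx w i j)" if "j \<le> My" for j
    using summation_by_parts[of Mx "\<lambda>i. w i j" "\<lambda>i. v i j", OF M(1) w0[OF that]]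
    by (simp add: nabla_x_def power2_eq_square sum_divide_distrib[symmetric])
  have y: "(\<Sum>j=1..My-1. (v i (j - 1) - 2 * v i j + v i (j + 1)) / hy\<^sup>2 * w i j)
      = - (\<Sum>j=1..My. nabla_y hy v i j * nabla_y hy w i j)" if "i \<le> Mx" for i
    using summation_by_parts[of My "\<lambda>j. w i j" "\<lambda>j. v i j", OF M(2) w1[OF that]]
    by (simp add: nabla_y_def power2_eq_square sum_divide_distrib[symmetric])
  \<comment> \<open>Green's formula along the rows produces only interior j, whereas
    \<open>grid_dirichlet\<close> also counts j = My. In that row the x-differences of
    \<open>w\<close> vanish with its boundary values; \<open>lasty\<close> is the same for i =
    Mx.\<close>
  have lastx: "(\<Sum>j=1..My. \<Sum>i=1..Mx. nabla_x hx v i j * nabla_x hx w i j)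
      = (\<Sum>j=1..My-1. \<Sum>i=1..Mx. nabla_x hx v i j * nabla_x hx w i j)"
    using M w1 by (cases My) (auto simp: nabla_x_def intro!: sum.neutral)
  have lasty: "(\<Sum>i=1..Mx. \<Sum>j=1..My. nabla_y hy v i j * nabla_y hy w i j)
      = (\<Sum>i=1..Mx-1. \<Sum>j=1..My. nabla_y hy v i j * nabla_y hy w i j)"
    using M w0 by (cases Mx) (auto simp: nabla_y_def intro!: sum.neutral)
  have "grid_inner Mx My (laplacian_h hx hy v) w
      = (\<Sum>i=1..Mx-1. \<Sum>j=1..My-1. (v (i - 1) j - 2 * v i j + v (i + 1) j) / hx\<^sup>2 * w i j)
      + (\<Sum>i=1..Mx-1. \<Sum>j=1..My-1. (v i (j - 1) - 2 * v i j + v i (j + 1)) / hy\<^sup>2 * w i j)"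
    by (simp only: grid_inner_def laplacian_h_def distrib_right sum.distrib sum.cartesian_product case_prod_unfold)
  also have "(\<Sum>i=1..Mx-1. \<Sum>j=1..My-1. (v (i - 1) j - 2 * v i j + v (i + 1) j) / hx\<^sup>2 * w i j)
      = - (\<Sum>j=1..My-1. \<Sum>i=1..Mx. nabla_x hx v i j * nabla_x hx w i j)"
    by (subst sum.swap, subst sum_negf[symmetric], rule sum.cong[OF refl], rule x) auto
  also have "(\<Sum>i=1..Mx-1. \<Sum>j=1..My-1. (v i (j - 1) - 2 * v i j + v i (j + 1)) / hy\<^sup>2 * w i j)
      = - (\<Sum>i=1..Mx-1. \<Sum>j=1..My. nabla_y hy v i j * nabla_y hy w i j)"
    by (subst sum_negf[symmetric], rule sum.cong[OF refl], rule y) auto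
  finally show ?thesis
    unfolding lastx[symmetric] lasty[symmetric]
    by (subst (asm) sum.swap)
      (simp add: grid_dirichlet_def sum.cartesian_product case_prod_beta)
qed

section \<open>Energy estimate\<close>

lemma sum_diff_pred: "(\<Sum>n=1..m. f n - f (n - 1)) = f m - f 0" for f :: "nat \<Rightarrow> real"
  by (induction m) auto

text \<open>Young splits \<rho> V into b1 V^2, which the velocity term cancels exactly, and R^2 / (4
  b1); the factor 2 \<tau> of the telescoped energy makes this 1 / (2 b1). In the terms of order
  \<beta>, Green's formula yields the \<open>c_coeff\<close> form of discrete gradients with the
  favourable sign.\<close>

lemma energy_estimate:
  fixes E \<rho> :: "nat \<Rightarrow> nat \<Rightarrow> nat \<Rightarrow> real"
  assumes A: "\<And>l. l \<in> {1..p} \<Longrightarrow> 0 \<le> A l" and Cc: "\<And>m. m \<in> {1..q} \<Longrightarrow> 0 \<le> Cc m"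
    and Dd: "\<And>r. r \<in> {1..s} \<Longrightarrow> 0 \<le> Dd r"
    and b: "b1 > 0" "b2 \<ge> 0" "b3 \<ge> 0"
    and \<gamma>: "\<And>l. l \<in> {1..p} \<Longrightarrow> 1 < \<gamma> l \<and> \<gamma> l < 2"
    and \<alpha>: "\<And>m. m \<in> {1..q} \<Longrightarrow> 0 < \<alpha> m \<and> \<alpha> m < 1"
    and \<beta>: "\<And>r. r \<in> {1..s} \<Longrightarrow> 0 < \<beta> r \<and> \<beta> r < 1"
    and pos: "\<tau> > 0" "hx > 0" "hy > 0" "Mx \<ge> 1" "My \<ge> 1"
    and E0: "\<And>i j. i \<le> Mx \<Longrightarrow> j \<le> My \<Longrightarrow> E 0 i j = 0"
    and EV: "\<And>n. n \<in> {1..N} \<Longrightarrow> in_Vh Mx My (E n)"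
    and eq: "\<And>n i j. n \<in> {1..N} \<Longrightarrow> i \<in> {1..Mx-1} \<Longrightarrow> j \<in> {1..My-1} \<Longrightarrow>
      (\<Sum>l=1..p. A l * l1_sum (a_coeff (\<gamma> l)) (\<lambda>k. nabla_t \<tau> E k i j) n)
      + b1 * nabla_t \<tau> E n i j
      + (\<Sum>m=1..q. Cc m * (\<Sum>k=1..n. c_coeff n (\<alpha> m) (n - k) * nabla_t \<tau> E k i j))
      + b2 * half_avg E n i j
      = b3 * laplacian_h hx hy (half_avg E n) i j
      + (\<Sum>r=1..s. Dd r * (\<Sum>k=1..n. c_coeff n (\<beta> r) (n - k) *
          nabla_t \<tau> (\<lambda>k'. laplacian_h hx hy (E k')) k i j))
      + \<rho> n i j"
    and \<rho>: "\<And>n i j. n \<in> {1..N} \<Longrightarrow> i \<in> {1..Mx-1} \<Longrightarrow> j \<in> {1..My-1} \<Longrightarrow> \<bar>\<rho> n i j\<bar> \<le> R"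
    and R: "0 \<le> R" and n: "n0 \<le> N"
  shows "(norm1 b2 b3 Mx My hx hy (E n0))\<^sup>2
    \<le> (real N * \<tau>) * (real Mx * hx) * (real My * hy) * R\<^sup>2 / (2 * b1)"
proof -
  define X where "X = {1..Mx-1} \<times> {1..My-1}"
  define V where "V n = nabla_t \<tau> E n" for n
  define v where "v n x = V n (fst x) (snd x)" for n x
  let ?ip = "grid_inner Mx My" and ?dp = "grid_dirichlet Mx My hx hy"
  let ?LV = "(\<Sum>n=1..n0. ?ip (laplacian_h hx hy (half_avg E n)) (V n))"
  let ?HV = "(\<Sum>n=1..n0. ?ip (half_avg E n) (V n))"
  have EVh: "in_Vh Mx My (E n)" if "n \<le> N" for n
    using that EV[of n] E0 by (cases "n = 0") (auto simp: in_Vh_def)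
  have VVh: "in_Vh Mx My (V n)" if "n \<le> N" for n
    using that EVh[of n] EVh[of "n - 1"] by (simp add: in_Vh_def V_def nabla_t_def)
  have sum_eq: "(\<Sum>n=1..n0. \<Sum>x\<in>X. v n x * (\<Sum>l=1..p. A l * l1_sum (a_coeff (\<gamma> l)) (\<lambda>k. v k x) n))
      + b1 * (\<Sum>n=1..n0. ?ip (V n) (V n))
      + (\<Sum>n=1..n0. \<Sum>x\<in>X. v n x * (\<Sum>m=1..q. Cc m * (\<Sum>k=1..n. c_coeff n (\<alpha> m) (n - k) * v k x)))
      + b2 * ?HV
      = b3 * ?LV
      + (\<Sum>n=1..n0. \<Sum>x\<in>X. v n x * (\<Sum>r=1..s. Dd r * (\<Sum>k=1..n. c_coeff n (\<beta> r) (n - k) *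
          laplacian_h hx hy (V k) (fst x) (snd x))))
      + (\<Sum>n=1..n0. ?ip (\<rho> n) (V n))"
    (is "?A + ?B + ?C + ?D = ?F + ?G + ?H")
  proof -
    have lap: "nabla_t \<tau> (\<lambda>k'. laplacian_h hx hy (E k')) k i j = laplacian_h hx hy (V k) i j" for k i j
      by (simp add: nabla_t_def V_def laplacian_h_def diff_divide_distrib add_divide_distrib algebra_simps)
    have "(\<Sum>n=1..n0. \<Sum>x\<in>X. v n x * ((\<Sum>l=1..p. A l * l1_sum (a_coeff (\<gamma> l)) (\<lambda>k. v k x) n)
        + b1 * v n x + (\<Sum>m=1..q. Cc m * (\<Sum>k=1..n. c_coeff n (\<alpha> m) (n - k) * v k x))
        + b2 * half_avg E n (fst x) (snd x)))
      = (\<Sum>n=1..n0. \<Sum>x\<in>X. v n x * (b3 * laplacian_h hx hy (half_avg E n) (fst x) (snd x)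
        + (\<Sum>r=1..s. Dd r * (\<Sum>k=1..n. c_coeff n (\<beta> r) (n - k) *
          laplacian_h hx hy (V k) (fst x) (snd x))) + \<rho> n (fst x) (snd x)))"
    proof (intro sum.cong refl)
      fix n x assume nx: "n \<in> {1..n0}" "x \<in> X"
      then have "n \<in> {1..N}" "fst x \<in> {1..Mx-1}" "snd x \<in> {1..My-1}"
        using n by (auto simp: X_def)
      from eq[OF this] show "v n x * ((\<Sum>l=1..p. A l * l1_sum (a_coeff (\<gamma> l)) (\<lambda>k. v k x) n)
        + b1 * v n x + (\<Sum>m=1..q. Cc m * (\<Sum>k=1..n. c_coeff n (\<alpha> m) (n - k) * v k x))
        + b2 * half_avg E n (fst x) (snd x))
        = v n x * (b3 * laplacian_h hx hy (half_avg E n) (fst x) (snd x)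
        + (\<Sum>r=1..s. Dd r * (\<Sum>k=1..n. c_coeff n (\<beta> r) (n - k) *
          laplacian_h hx hy (V k) (fst x) (snd x))) + \<rho> n (fst x) (snd x))"
        unfolding v_def lap V_def by simp
    qed
    then show ?thesis
      unfolding grid_inner_def X_def[symmetric] v_def[symmetric]
      by (simp add: distrib_left sum.distrib sum_distrib_left mult_ac)
  qed
  have a_nonneg: "0 \<le> ?A"
  proof -
    have "?A = (\<Sum>l=1..p. A l * (\<Sum>n=1..n0. \<Sum>x\<in>X. v n x * l1_sum (a_coeff (\<gamma> l)) (\<lambda>k. v k x) n))"
      by (rule sum_pull_coefficients)
    also have "\<dots> = (\<Sum>l=1..p. A l * (\<Sum>x\<in>X. \<Sum>n=1..n0. v n x * l1_sum (a_coeff (\<gamma> l)) (\<lambda>k. v k x) n))"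
      by (subst sum.swap) simp
    also have "\<dots> \<ge> 0"
      using A \<gamma> by (intro sum_nonneg[of "{1..p}"] mult_nonneg_nonneg sum_nonneg[of X] l1_sum_form_nonneg)
        (auto intro: a_coeff_nonneg a_coeff_decreasing)
    finally show ?thesis .
  qed
  have c_nonneg: "0 \<le> ?C"
  proof -
    have "?C = (\<Sum>m=1..q. Cc m * (\<Sum>n=1..n0. \<Sum>x\<in>X. v n x * (\<Sum>k=1..n. c_coeff n (\<alpha> m) (n - k) * v k x)))"
      by (rule sum_pull_coefficients)
    also have "\<dots> = (\<Sum>m=1..q. Cc m * (\<Sum>n=1..n0. \<Sum>k=1..n. c_coeff n (\<alpha> m) (n - k) * (\<Sum>x\<in>X. v k x * v n x)))"
      unfolding sum_distrib_left by (subst sum.swap[of _ X]) (simp add: mult_ac)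
    also have "\<dots> \<ge> 0"
      using Cc \<alpha> by (intro sum_nonneg[of "{1..q}"] mult_nonneg_nonneg sum_product_form_nonneg c_coeff_form_nonneg) auto
    finally show ?thesis .
  qed
  have g_nonpos: "?G \<le> 0"
  proof -
    have "?G = (\<Sum>r=1..s. Dd r * (\<Sum>n=1..n0. \<Sum>x\<in>X. v n x * (\<Sum>k=1..n. c_coeff n (\<beta> r) (n - k) *
          laplacian_h hx hy (V k) (fst x) (snd x))))"
      by (rule sum_pull_coefficients)
    also have "\<dots> = (\<Sum>r=1..s. Dd r * (\<Sum>n=1..n0. \<Sum>k=1..n. c_coeff n (\<beta> r) (n - k) *
          ?ip (laplacian_h hx hy (V k)) (V n)))"
      unfolding sum_distrib_left grid_inner_def X_def[symmetric] v_def
      by (subst sum.swap[of _ X]) (simp add: mult_ac)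
    also have "\<dots> = (\<Sum>r=1..s. Dd r * (\<Sum>n=1..n0. \<Sum>k=1..n. c_coeff n (\<beta> r) (n - k) * - ?dp (V k) (V n)))"
      using n pos VVh by (intro sum.cong arg_cong2[where f = "(*)"] green_laplacian_h refl) auto
    also have "\<dots> = - (\<Sum>r=1..s. Dd r * (\<Sum>n=1..n0. \<Sum>k=1..n. c_coeff n (\<beta> r) (n - k) * ?dp (V k) (V n)))"
      by (simp add: sum_negf)
    also have "\<dots> \<le> 0"
    proof -
      have "0 \<le> (\<Sum>n=1..n0. \<Sum>k=1..n. c_coeff n (\<beta> r) (n - k) * ?dp (V k) (V n))" if "r \<in> {1..s}" for r
        unfolding grid_dirichlet_def distrib_left sum.distrib
        using \<beta>[OF that] by (intro add_nonneg_nonneg sum_product_form_nonneg c_coeff_form_nonneg) auto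
      then show ?thesis using Dd by (auto intro!: sum_nonneg)
    qed
    finally show ?thesis .
  qed
  \<comment> \<open>The mean times the difference quotient is an exact increment of squares; hence
    the half-index values of U in the scheme. The same identity holds for the discrete gradients
    below.\<close>
  have half: "half_avg E n i j * V n i j = (E n i j * E n i j - E (n-1) i j * E (n-1) i j) / (2 * \<tau>)" for n i j
    using pos by (simp add: half_avg_def V_def nabla_t_def field_simps)
  have d_eq: "2 * \<tau> * ?HV = ?ip (E n0) (E n0)"
  proof -
    have "?ip (half_avg E n) (V n) = (?ip (E n) (E n) - ?ip (E (n-1)) (E (n-1))) / (2 * \<tau>)" for n
      by (simp add: grid_inner_def half sum_subtractf flip: sum_divide_distrib)
    then have "2 * \<tau> * ?HV
        = (\<Sum>n=1..n0. ?ip (E n) (E n) - ?ip (E (n-1)) (E (n-1)))"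
      using pos by (simp add: sum_distrib_left)
    also have "\<dots> = ?ip (E n0) (E n0) - ?ip (E 0) (E 0)"
      by (rule sum_diff_pred[of "\<lambda>n. ?ip (E n) (E n)"])
    also have "?ip (E 0) (E 0) = 0"
      using E0 by (auto simp: grid_inner_def intro!: sum.neutral)
    finally show ?thesis by simp
  qed
  have f_eq: "2 * \<tau> * ?LV = - ?dp (E n0) (E n0)"
  proof -
    have halfx: "nabla_x hx (half_avg E n) i j * nabla_x hx (V n) i j
      = (nabla_x hx (E n) i j * nabla_x hx (E n) i j - nabla_x hx (E (n-1)) i j * nabla_x hx (E (n-1)) i j) / (2 * \<tau>)" for n i j
      using pos by (simp add: half_avg_def V_def nabla_t_def nabla_x_def field_simps)
    have halfy: "nabla_y hy (half_avg E n) i j * nabla_y hy (V n) i j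
      = (nabla_y hy (E n) i j * nabla_y hy (E n) i j - nabla_y hy (E (n-1)) i j * nabla_y hy (E (n-1)) i j) / (2 * \<tau>)" for n i j
      using pos by (simp add: half_avg_def V_def nabla_t_def nabla_y_def field_simps)
    have "?dp (half_avg E n) (V n) = (?dp (E n) (E n) - ?dp (E (n-1)) (E (n-1))) / (2 * \<tau>)" for n
      by (simp add: grid_dirichlet_def halfx halfy sum_subtractf diff_divide_distrib add_divide_distrib
          flip: sum_divide_distrib)
    moreover have "?LV
        = (\<Sum>n=1..n0. - ?dp (half_avg E n) (V n))"
      using n pos VVh by (intro sum.cong green_laplacian_h refl) auto
    ultimately have "2 * \<tau> * ?LV
        = - (\<Sum>n=1..n0. ?dp (E n) (E n) - ?dp (E (n-1)) (E (n-1)))"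
      using pos by (simp add: sum_distrib_left sum_negf)
    also have "\<dots> = - (?dp (E n0) (E n0) - ?dp (E 0) (E 0))"
      by (simp only: sum_diff_pred[of "\<lambda>n. ?dp (E n) (E n)"])
    also have "?dp (E 0) (E 0) = 0"
      unfolding grid_dirichlet_def
      using E0 by (subst (1 2) sum.neutral) (auto simp: nabla_x_def nabla_y_def)
    finally show ?thesis by simp
  qed
  have h_le: "?H \<le> b1 * (\<Sum>n=1..n0. ?ip (V n) (V n)) + real N * real Mx * real My * R\<^sup>2 / (4 * b1)"
  proof -
    have point: "\<rho> n (fst x) (snd x) * v n x \<le> b1 * (v n x * v n x) + R\<^sup>2 / (4 * b1)"
      if "n \<in> {1..n0}" "x \<in> X" for n x
    proof -
      have "\<bar>\<rho> n (fst x) (snd x)\<bar> \<le> R"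
        using that n by (intro \<rho>) (auto simp: X_def)
      then have "(\<rho> n (fst x) (snd x))\<^sup>2 \<le> R\<^sup>2"
        by (metis abs_ge_zero power2_abs power_mono)
      moreover have "0 \<le> (\<rho> n (fst x) (snd x) - 2 * b1 * v n x)\<^sup>2" by simp
      ultimately have "4 * b1 * (\<rho> n (fst x) (snd x) * v n x) \<le> 4 * b1 * (b1 * (v n x * v n x)) + R\<^sup>2"
        by (simp add: power2_eq_square algebra_simps)
      then show ?thesis using b by (simp add: field_simps)
    qed
    have "?H \<le> (\<Sum>n=1..n0. \<Sum>x\<in>X. b1 * (v n x * v n x) + R\<^sup>2 / (4 * b1))"
      unfolding grid_inner_def X_def[symmetric] v_def[symmetric] by (intro sum_mono point)
    also have "\<dots> = b1 * (\<Sum>n=1..n0. ?ip (V n) (V n)) + real n0 * (real (card X) * (R\<^sup>2 / (4 * b1)))"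
      unfolding grid_inner_def X_def[symmetric] v_def[symmetric]
      by (simp add: sum.distrib sum_distrib_left)
    also have "real n0 * (real (card X) * (R\<^sup>2 / (4 * b1))) \<le> real N * ((real Mx * real My) * (R\<^sup>2 / (4 * b1)))"
    proof (intro mult_mono)
      have "card X \<le> Mx * My" by (auto simp: X_def intro!: mult_mono)
      then show "real (card X) \<le> real Mx * real My" by (metis of_nat_le_iff of_nat_mult)
    qed (use n b in auto)
    finally show ?thesis by simp
  qed
  have "b2 * ?HV - b3 * ?LV
      \<le> real N * real Mx * real My * R\<^sup>2 / (4 * b1)"
    using sum_eq a_nonneg c_nonneg g_nonpos h_le by linarith
  then have "2 * \<tau> * (b2 * ?HV
        - b3 * ?LV)
      \<le> 2 * \<tau> * (real N * real Mx * real My * R\<^sup>2 / (4 * b1))"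
    using pos by (intro mult_left_mono) auto
  moreover have "2 * \<tau> * (b2 * ?HV
        - b3 * ?LV)
      = b2 * (2 * \<tau> * ?HV)
        - b3 * (2 * \<tau> * ?LV)"
    by (simp add: algebra_simps)
  ultimately have "b2 * ?ip (E n0) (E n0) + b3 * ?dp (E n0) (E n0)
      \<le> 2 * \<tau> * (real N * real Mx * real My * R\<^sup>2 / (4 * b1))"
    unfolding d_eq f_eq by simp
  then have "hx * hy * (b2 * ?ip (E n0) (E n0) + b3 * ?dp (E n0) (E n0))
      \<le> hx * hy * (2 * \<tau> * (real N * real Mx * real My * R\<^sup>2 / (4 * b1)))"
    using pos by (intro mult_left_mono) auto
  moreover have "0 \<le> ?ip (E n0) (E n0)" "0 \<le> ?dp (E n0) (E n0)"
    by (auto simp: grid_inner_def grid_dirichlet_def intro!: sum_nonneg add_nonneg_nonneg)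
  then have "(norm1 b2 b3 Mx My hx hy (E n0))\<^sup>2 = hx * hy * (b2 * ?ip (E n0) (E n0) + b3 * ?dp (E n0) (E n0))"
    using pos b by (simp add: norm1_eq)
  ultimately show ?thesis using b by (simp add: field_simps)
qed

section \<open>The corrector of the starting error\<close>

lemma powr_le_tangent:
  fixes z \<sigma> :: real
  assumes "0 \<le> z" "0 \<le> \<sigma>" "\<sigma> \<le> 1"
  shows "z powr \<sigma> \<le> 1 + \<sigma> * (z - 1)"
proof (cases "z = 0")
  case False
  then have "z powr \<sigma> * 1 powr (1 - \<sigma>) \<le> \<sigma> * z + (1 - \<sigma>) * 1"
    using assms by (intro Youngs_inequality_0) auto
  then show ?thesis by (simp add: algebra_simps)
qed (use assms in auto)

text \<open>After division by the power of the midpoint, both outer terms lie below the tangent at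
  1, and the two linear parts cancel.\<close>

lemma powr_midpoint_concave:
  fixes x h \<sigma> :: real
  assumes "0 \<le> x" "0 < h" "0 \<le> \<sigma>" "\<sigma> \<le> 1"
  shows "x powr \<sigma> + (x + 2 * h) powr \<sigma> \<le> 2 * (x + h) powr \<sigma>"
proof -
  let ?y = "x + h"
  have y: "?y > 0" using assms by simp
  have "(x / ?y) powr \<sigma> + ((x + 2 * h) / ?y) powr \<sigma>
      \<le> (1 + \<sigma> * (x / ?y - 1)) + (1 + \<sigma> * ((x + 2 * h) / ?y - 1))"
    using assms by (intro add_mono powr_le_tangent) auto
  also have "\<dots> = 2 + \<sigma> * ((x + (x + 2 * h)) / ?y - 2)"
    by (simp add: algebra_simps add_divide_distrib)
  also have "(x + (x + 2 * h)) / ?y = 2"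
    using y by (simp add: field_simps)
  finally have "(x powr \<sigma> + (x + 2 * h) powr \<sigma>) / ?y powr \<sigma> \<le> 2"
    using assms powr_divide[of x ?y \<sigma>] powr_divide[of "x + 2 * h" ?y \<sigma>]
    by (simp only: add_divide_distrib diff_self mult_zero_right add_0_right)
  then show ?thesis using y by (simp add: pos_divide_le_eq)
qed

text \<open>Defect of the first, shortened cell in the scheme for the derivatives of order \<open>\<gamma> = 2 - \<sigma>\<close>.\<close>
definition start_defect :: "real \<Rightarrow> nat \<Rightarrow> real" where
  "start_defect \<sigma> n = (real n - 1/2) powr \<sigma> - (real n powr \<sigma> + (real n - 1) powr \<sigma>) / 2"

lemma start_defect_nonneg:
  assumes "n \<ge> 1" "0 \<le> \<sigma>" "\<sigma> \<le> 1"
  shows "0 \<le> start_defect \<sigma> n"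
  using powr_midpoint_concave[of "real n - 1" "1/2" \<sigma>] assms
  by (simp add: start_defect_def)

lemma sum_start_defect:
  assumes "0 \<le> \<sigma>" "\<sigma> \<le> 1"
  shows "(\<Sum>n=1..m. start_defect \<sigma> n) \<le> 1/2"
proof -
  \<comment> \<open>The bare bound 1/2 is not inductive. The subtracted half-cell increment absorbs
    the next defect, by concavity at m + 1/2, m + 1 and m + 3/2.\<close>
  have "(\<Sum>n=1..m. start_defect \<sigma> n) \<le> 1/2 - ((real m + 1/2) powr \<sigma> - real m powr \<sigma>) / 2"
  proof (induction m)
    case 0
    have "(1/2) powr \<sigma> \<le> (1::real)" using assms by (intro powr_le1) auto
    then show ?case by simp
  next
    case (Suc m)
    have "(real m + 1/2) powr \<sigma> + (real m + 1/2 + 2 * (1/2)) powr \<sigma> \<le> 2 * (real m + 1/2 + 1/2) powr \<sigma>"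
      using assms by (intro powr_midpoint_concave) auto
    moreover have "(\<Sum>n=1..Suc m. start_defect \<sigma> n) = (\<Sum>n=1..m. start_defect \<sigma> n) + start_defect \<sigma> (Suc m)"
      by simp
    moreover have "real m + 1/2 + 1/2 = real (Suc m)" "real m + 1/2 + 2 * (1/2) = real (Suc m) + 1/2"
      "real (Suc m) - 1/2 = real m + 1/2" "real (Suc m) - 1 = real m"
      by simp_all
    ultimately show ?case using Suc unfolding start_defect_def by (simp only:) argo
  qed
  moreover have "real m powr \<sigma> \<le> (real m + 1/2) powr \<sigma>"
    using assms by (intro powr_mono2) auto
  ultimately show ?thesis by argo
qed

section \<open>The discrete Volterra equation of the corrector\<close>

lemma l1_sum_cong:
  assumes "\<And>k. k \<in> {1..n} \<Longrightarrow> V k = W k" "n \<ge> 1"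
  shows "l1_sum L V n = l1_sum L W n"
  unfolding l1_sum_def using assms by (intro arg_cong2[where f = "(-)"] sum.cong) auto

lemma l1_sum_linear_kernel:
  "l1_sum (\<lambda>j. \<Sum>l\<in>K. A l * L l j) V n = (\<Sum>l\<in>K. A l * l1_sum (L l) V n)"
proof -
  have "(\<Sum>k=1..n-1. ((\<Sum>l\<in>K. A l * L l (n - k - 1)) - (\<Sum>l\<in>K. A l * L l (n - k))) * V k)
      = (\<Sum>k=1..n-1. \<Sum>l\<in>K. A l * ((L l (n - k - 1) - L l (n - k)) * V k))"
    by (simp add: left_diff_distrib right_diff_distrib sum_subtractf sum_distrib_right mult.assoc)
  also have "\<dots> = (\<Sum>l\<in>K. A l * (\<Sum>k=1..n-1. (L l (n - k - 1) - L l (n - k)) * V k))"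
    by (subst sum.swap) (simp add: sum_distrib_left)
  finally show ?thesis
    by (simp add: l1_sum_def right_diff_distrib sum_subtractf sum_distrib_right mult.assoc)
qed

text \<open>Forward substitution: the system is triangular with diagonal \<open>L 0 + b\<close>,
  earlier rows do not see a new entry, and the past enters with nonnegative weights, which preserves
  the sign.\<close>

lemma l1_equation_solvable:
  fixes L \<kappa> :: "nat \<Rightarrow> real"
  assumes dec: "\<And>k. L (Suc k) \<le> L k" and nonneg: "\<And>k. 0 \<le> L k" and b: "b > 0"
    and \<kappa>: "\<And>n. n \<ge> 1 \<Longrightarrow> 0 \<le> \<kappa> n"
  shows "\<exists>\<eta>. (\<forall>n. 0 \<le> \<eta> n) \<and> (\<forall>n\<in>{1..N}. l1_sum L \<eta> n + b * \<eta> n = \<kappa> n)"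
proof (induction N)
  case 0
  show ?case by (rule exI[of _ "\<lambda>_. 0"]) auto
next
  case (Suc N)
  then obtain \<eta> where \<eta>: "\<And>n. 0 \<le> \<eta> n" "\<And>n. n \<in> {1..N} \<Longrightarrow> l1_sum L \<eta> n + b * \<eta> n = \<kappa> n" by blast
  define S where "S = (\<Sum>k=1..N. (L (N - k) - L (Suc N - k)) * \<eta> k)"
  define e where "e = (\<kappa> (Suc N) + S) / (L 0 + b)"
  have "0 \<le> S" unfolding S_def
    using dec \<eta>(1) by (intro sum_nonneg mult_nonneg_nonneg) (auto simp: Suc_diff_le)
  then have "0 \<le> e" using \<kappa>[of "Suc N"] nonneg[of 0] b by (simp add: e_def)
  have pos: "L 0 + b > 0" using nonneg[of 0] b by simp
  have "l1_sum L (\<eta>(Suc N := e)) (Suc N) = L 0 * e - S"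
    unfolding l1_sum_def S_def by (intro arg_cong2[where f = "(-)"] sum.cong) auto
  then have "l1_sum L (\<eta>(Suc N := e)) (Suc N) + b * e = (L 0 + b) * e - S"
    by (simp add: algebra_simps)
  also have "\<dots> = \<kappa> (Suc N)" using pos by (simp add: e_def)
  finally have "l1_sum L (\<eta>(Suc N := e)) (Suc N) + b * e = \<kappa> (Suc N)" .
  moreover have "l1_sum L (\<eta>(Suc N := e)) n = l1_sum L \<eta> n" if "n \<in> {1..N}" for n
    using that by (intro l1_sum_cong) auto
  ultimately show ?case
    using \<eta> \<open>0 \<le> e\<close> by (intro exI[of _ "\<eta>(Suc N := e)"]) (auto simp: le_Suc_eq simp flip: fun_upd_def)
qed

text \<open>\<open>l1_sum\<close> is the increment in n of the convolution of \<open>L\<close> with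
  \<eta>, so summing the equation telescopes it.\<close>

lemma l1_equation_sum:
  fixes L \<kappa> :: "nat \<Rightarrow> real"
  assumes "\<And>n. n \<in> {1..N} \<Longrightarrow> l1_sum L \<eta> n + b * \<eta> n = \<kappa> n" "n \<le> N"
  shows "(\<Sum>k=1..n. L (n - k) * \<eta> k) + b * (\<Sum>k=1..n. \<eta> k) = (\<Sum>k=1..n. \<kappa> k)"
  using assms(2)
proof (induction n)
  case (Suc m)
  have "l1_sum L \<eta> (Suc m) = L 0 * \<eta> (Suc m) - (\<Sum>k=1..m. (L (m - k) - L (Suc m - k)) * \<eta> k)"
    unfolding l1_sum_def by (intro arg_cong2[where f = "(-)"] sum.cong) auto
  also have "\<dots> = (\<Sum>k=1..Suc m. L (Suc m - k) * \<eta> k) - (\<Sum>k=1..m. L (m - k) * \<eta> k)"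
    by (simp add: left_diff_distrib sum_subtractf)
  finally show ?case using Suc assms(1)[of "Suc m"] by (simp add: algebra_simps)
qed simp

text \<open>Compares powers of \<tau> when \<tau> may exceed 1. All exponents that occur lie within
  2 of \<omega>, whence the uniform factor \<open>(1 + T)\<^sup>2\<close>.\<close>

lemma powr_le_powr_scaled:
  fixes \<tau> T x \<omega> :: real
  assumes "0 < \<tau>" "\<tau> \<le> T" "\<omega> \<le> x" "x \<le> \<omega> + 2"
  shows "\<tau> powr x \<le> (1 + T)\<^sup>2 * \<tau> powr \<omega>"
proof -
  have "\<tau> powr (x - \<omega>) \<le> (1 + T) powr (x - \<omega>)"
    using assms by (intro powr_mono2) auto
  also have "\<dots> \<le> (1 + T) powr 2"
    using assms by (intro powr_mono) auto
  finally have "\<tau> powr (x - \<omega>) * \<tau> powr \<omega> \<le> (1 + T)\<^sup>2 * \<tau> powr \<omega>"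
    using assms by (intro mult_right_mono) auto
  then show ?thesis using assms by (simp flip: powr_add)
qed

text \<open>The right hand side of the equation is the truncation error caused by the shortened first cell,
  per unit of \<open>u\<^sub>t\<^sub>t(x,y,0)\<close>; \<open>\<gamma>0\<close> is the largest of the orders \<open>\<gamma> l\<close>.\<close>
definition is_corrector ::
  "nat \<Rightarrow> (nat \<Rightarrow> real) \<Rightarrow> (nat \<Rightarrow> real) \<Rightarrow> real \<Rightarrow> real \<Rightarrow> real \<Rightarrow> nat \<Rightarrow> real \<Rightarrow> (nat \<Rightarrow> real) \<Rightarrow> bool" where
  "is_corrector p a \<gamma> b1 \<gamma>0 C N \<tau> \<eta> \<longleftrightarrow> (\<forall>n. 0 \<le> \<eta> n) \<and>
    (\<forall>n\<in>{1..N}. (\<Sum>l=1..p. a l * mu1 \<tau> (\<gamma> l) * l1_sum (a_coeff (\<gamma> l)) \<eta> n) + b1 * \<eta> n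
      = (\<Sum>l=1..p. a l * (\<tau> powr (2 - \<gamma> l) / Gamma (3 - \<gamma> l) * start_defect (2 - \<gamma> l) n))) \<and>
    (\<forall>n\<le>N. \<tau> * (\<Sum>k=1..n. \<eta> k) \<le> C * \<tau> powr (3 - \<gamma>0)) \<and>
    (\<forall>n\<le>N. (\<Sum>k=1..n. (real (n - k) + 1) powr (1 - \<gamma>0) * \<eta> k) \<le> C * \<tau>)"

text \<open>Both bounds come from the one summed equation, whose right side is at most
  \<open>K * \<tau> powr (2 - \<gamma> l0)\<close>. Dropping the convolution bounds the sum of
  \<eta> with constant \<open>K / b1\<close>; dropping the b1 term bounds the convolution itself
  with constant \<open>K / g0\<close>. Both constants are fixed before N.\<close>

lemma corrector_exists:
  fixes a \<gamma> :: "nat \<Rightarrow> real"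
  assumes a: "\<And>l. l \<in> {1..p} \<Longrightarrow> a l > 0" and \<gamma>: "\<And>l. l \<in> {1..p} \<Longrightarrow> 1 < \<gamma> l \<and> \<gamma> l < 2"
    and b1: "b1 > 0" and T: "T > 0" and l0: "l0 \<in> {1..p}" "\<And>l. l \<in> {1..p} \<Longrightarrow> \<gamma> l \<le> \<gamma> l0"
  shows "\<exists>C\<ge>0. \<forall>N\<ge>1. \<exists>\<eta>. is_corrector p a \<gamma> b1 (\<gamma> l0) C N (T / real N) \<eta>"
proof -
  define K where "K = (\<Sum>l=1..p. a l * ((1 + T)\<^sup>2 / Gamma (3 - \<gamma> l)))"
  have G3: "Gamma (3 - \<gamma> l) > 0" if "l \<in> {1..p}" for l using \<gamma>[OF that] by simp
  have K: "K \<ge> 0" unfolding K_def using a G3 T by (intro sum_nonneg) (auto intro!: divide_nonneg_pos less_imp_le)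
  define g0 where "g0 = a l0 / Gamma (3 - \<gamma> l0) * (2 - \<gamma> l0)"
  have g0: "g0 > 0" using a[OF l0(1)] G3[OF l0(1)] \<gamma>[OF l0(1)] by (simp add: g0_def)
  show ?thesis
  proof (intro exI[of _ "K / b1 + K / g0"] conjI allI impI)
    show "0 \<le> K / b1 + K / g0" using K b1 g0 by simp
    fix N :: nat assume N: "1 \<le> N"
    define \<tau> where \<tau>: "\<tau> = T / real N"
    have \<tau>0: "0 < \<tau>" "\<tau> \<le> T" using T N by (auto simp: \<tau> field_simps)
    define A where "A l = a l * mu1 \<tau> (\<gamma> l)" for l
    have A: "A l > 0" if "l \<in> {1..p}" for l
      using a[OF that] G3[OF that] \<tau>0 by (simp add: A_def mu1_def)
    define L where "L j = (\<Sum>l=1..p. A l * a_coeff (\<gamma> l) j)" for j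
    define \<kappa> where "\<kappa> n = (\<Sum>l=1..p. a l * (\<tau> powr (2 - \<gamma> l) / Gamma (3 - \<gamma> l) * start_defect (2 - \<gamma> l) n))" for n
    have Ldec: "L (Suc k) \<le> L k" for k
      unfolding L_def using A \<gamma> by (intro sum_mono mult_left_mono a_coeff_decreasing) (auto simp: less_imp_le)
    have Lnn: "0 \<le> L k" for k
      unfolding L_def using A \<gamma> by (intro sum_nonneg mult_nonneg_nonneg a_coeff_nonneg) (auto simp: less_imp_le)
    have \<kappa>nn: "0 \<le> \<kappa> n" if "n \<ge> 1" for n
      unfolding \<kappa>_def using a \<gamma> G3 that
      by (intro sum_nonneg mult_nonneg_nonneg divide_nonneg_pos start_defect_nonneg) (auto simp: less_imp_le)
    obtain \<eta> where \<eta>: "\<And>n. 0 \<le> \<eta> n" "\<And>n. n \<in> {1..N} \<Longrightarrow> l1_sum L \<eta> n + b1 * \<eta> n = \<kappa> n"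
      using l1_equation_solvable[of L b1 \<kappa> N, OF Ldec Lnn b1 \<kappa>nn] by blast
    have \<kappa>sum: "(\<Sum>k=1..n. \<kappa> k) \<le> K * \<tau> powr (2 - \<gamma> l0)" for n
    proof -
      have "(\<Sum>k=1..n. \<kappa> k) = (\<Sum>l=1..p. a l * (\<tau> powr (2 - \<gamma> l) / Gamma (3 - \<gamma> l) * (\<Sum>k=1..n. start_defect (2 - \<gamma> l) k)))"
        unfolding \<kappa>_def by (subst sum.swap) (simp add: sum_distrib_left)
      also have "\<dots> \<le> (\<Sum>l=1..p. a l * (((1 + T)\<^sup>2 * \<tau> powr (2 - \<gamma> l0)) / Gamma (3 - \<gamma> l) * 1))"
      proof (intro sum_mono mult_left_mono mult_mono divide_right_mono)
        fix l assume l: "l \<in> {1..p}"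
        show "\<tau> powr (2 - \<gamma> l) \<le> (1 + T)\<^sup>2 * \<tau> powr (2 - \<gamma> l0)"
          using \<tau>0 \<gamma>[OF l] \<gamma>[OF l0(1)] l0(2)[OF l] by (intro powr_le_powr_scaled) auto
        show "(\<Sum>k=1..n. start_defect (2 - \<gamma> l) k) \<le> 1"
          using sum_start_defect[of "2 - \<gamma> l" n] \<gamma>[OF l] by simp
        show "0 \<le> (\<Sum>k=1..n. start_defect (2 - \<gamma> l) k)"
          using \<gamma>[OF l] by (intro sum_nonneg start_defect_nonneg) auto
      qed (use a G3 in \<open>auto simp: less_imp_le\<close>)
      also have "\<dots> = K * \<tau> powr (2 - \<gamma> l0)"
        by (simp add: K_def sum_distrib_right mult.assoc)
      finally show ?thesis .
    qed
    have total: "(\<Sum>k=1..n. L (n - k) * \<eta> k) + b1 * (\<Sum>k=1..n. \<eta> k) \<le> K * \<tau> powr (2 - \<gamma> l0)"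
      if "n \<le> N" for n
      using l1_equation_sum[of N L \<eta> b1 \<kappa> n, OF \<eta>(2) that] \<kappa>sum[of n] by simp
    have Lsum: "0 \<le> (\<Sum>k=1..n. L (n - k) * \<eta> k)" for n
      using Lnn \<eta>(1) by (intro sum_nonneg mult_nonneg_nonneg) auto
    have \<eta>sum: "0 \<le> (\<Sum>k=1..n. \<eta> k)" for n using \<eta>(1) by (intro sum_nonneg) auto
    show "\<exists>\<eta>. is_corrector p a \<gamma> b1 (\<gamma> l0) (K / b1 + K / g0) N (T / real N) \<eta>"
      unfolding is_corrector_def \<tau>[symmetric]
    proof (intro exI[of _ \<eta>] conjI allI ballI impI)
      fix n assume "n \<in> {1..N}"
      from \<eta>(2)[OF this] show "(\<Sum>l=1..p. a l * mu1 \<tau> (\<gamma> l) * l1_sum (a_coeff (\<gamma> l)) \<eta> n) + b1 * \<eta> n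
        = (\<Sum>l=1..p. a l * (\<tau> powr (2 - \<gamma> l) / Gamma (3 - \<gamma> l) * start_defect (2 - \<gamma> l) n))"
        unfolding L_def l1_sum_linear_kernel \<kappa>_def A_def .
    next
      fix n assume n: "n \<le> N"
      have "b1 * (\<Sum>k=1..n. \<eta> k) \<le> K * \<tau> powr (2 - \<gamma> l0)"
        using total[OF n] Lsum[of n] by linarith
      then have "(\<Sum>k=1..n. \<eta> k) \<le> K / b1 * \<tau> powr (2 - \<gamma> l0)"
        using b1 by (simp add: field_simps)
      also have "\<dots> \<le> (K / b1 + K / g0) * \<tau> powr (2 - \<gamma> l0)"
        using K g0 by (intro mult_right_mono) auto
      finally have "\<tau> * (\<Sum>k=1..n. \<eta> k) \<le> \<tau> * ((K / b1 + K / g0) * \<tau> powr (2 - \<gamma> l0))"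
        using \<tau>0 by (intro mult_left_mono) auto
      also have "\<dots> = (K / b1 + K / g0) * (\<tau> powr 1 * \<tau> powr (2 - \<gamma> l0))" using \<tau>0 by simp
      also have "\<tau> powr 1 * \<tau> powr (2 - \<gamma> l0) = \<tau> powr (3 - \<gamma> l0)"
        by (simp only: powr_add[symmetric]) simp
      finally show "\<tau> * (\<Sum>k=1..n. \<eta> k) \<le> (K / b1 + K / g0) * \<tau> powr (3 - \<gamma> l0)" .
    next
      fix n assume n: "n \<le> N"
      \<comment> \<open>Only the term of largest order is kept. The power of \<tau> in front of it
        is later cancelled against the right side, and a full factor \<tau> is left.\<close>
      have Llow: "g0 * \<tau> powr (1 - \<gamma> l0) * (real j + 1) powr (1 - \<gamma> l0) \<le> L j" for j
      proof -
        have "g0 * \<tau> powr (1 - \<gamma> l0) * (real j + 1) powr (1 - \<gamma> l0)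
          = A l0 * ((2 - \<gamma> l0) * (real j + 1) powr (1 - \<gamma> l0))"
          by (simp add: g0_def A_def mu1_def)
        also have "\<dots> \<le> A l0 * a_coeff (\<gamma> l0) j"
          using A[OF l0(1)] \<gamma>[OF l0(1)] by (intro mult_left_mono a_coeff_lower) auto
        also have "\<dots> \<le> L j"
          unfolding L_def
          using A \<gamma> l0(1) by (intro member_le_sum mult_nonneg_nonneg a_coeff_nonneg) (auto simp: less_imp_le)
        finally show ?thesis .
      qed
      have "g0 * \<tau> powr (1 - \<gamma> l0) * (\<Sum>k=1..n. (real (n - k) + 1) powr (1 - \<gamma> l0) * \<eta> k)
          = (\<Sum>k=1..n. (g0 * \<tau> powr (1 - \<gamma> l0) * (real (n - k) + 1) powr (1 - \<gamma> l0)) * \<eta> k)"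
        by (simp add: sum_distrib_left mult.assoc)
      also have "\<dots> \<le> (\<Sum>k=1..n. L (n - k) * \<eta> k)"
        using \<eta>(1) by (intro sum_mono mult_right_mono Llow)
      also have "\<dots> \<le> K * \<tau> powr (2 - \<gamma> l0)"
        using total[OF n] mult_nonneg_nonneg[OF less_imp_le[OF b1] \<eta>sum[of n]] by linarith
      also have "\<tau> powr (2 - \<gamma> l0) = \<tau> powr (1 - \<gamma> l0) * \<tau> powr 1"
        by (simp only: powr_add[symmetric]) simp
      finally have "\<tau> powr (1 - \<gamma> l0) * (g0 * (\<Sum>k=1..n. (real (n - k) + 1) powr (1 - \<gamma> l0) * \<eta> k))
          \<le> \<tau> powr (1 - \<gamma> l0) * (K * \<tau>)"
        using \<tau>0 by (simp add: mult_ac)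
      then have "g0 * (\<Sum>k=1..n. (real (n - k) + 1) powr (1 - \<gamma> l0) * \<eta> k) \<le> K * \<tau>"
        using \<tau>0 by simp
      then have "(\<Sum>k=1..n. (real (n - k) + 1) powr (1 - \<gamma> l0) * \<eta> k) \<le> K / g0 * \<tau>"
        using g0 by (simp add: field_simps)
      also have "\<dots> \<le> (K / b1 + K / g0) * \<tau>"
        using K b1 \<tau>0 by (intro mult_right_mono) auto
      finally show "(\<Sum>k=1..n. (real (n - k) + 1) powr (1 - \<gamma> l0) * \<eta> k) \<le> (K / b1 + K / g0) * \<tau>" .
    qed (rule \<eta>(1))
  qed
qed

text \<open>The known convolution has the exponent 1 - \<gamma>, the needed one has - \<alpha>. If
  \<gamma> - 1 \<le> \<alpha>, the needed kernel is the smaller one and the result is of order 2 -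
  \<alpha>. Otherwise it is larger by at most N to the power \<gamma> - 1 - \<alpha>; with N = T /
  \<tau> this costs powers of \<tau> and leaves the order 3 - \<gamma>. \<open>M\<close> covers both
  cases.\<close>

lemma corrector_convolution_bound:
  fixes \<alpha> \<gamma> T B :: real
  assumes \<alpha>: "0 < \<alpha>" "\<alpha> < 1" and \<gamma>: "1 < \<gamma>" "\<gamma> < 2" and T: "T > 0" and N: "N \<ge> 1" "\<tau> = T / real N"
    and n: "n \<le> N" and \<eta>: "\<And>k. 0 \<le> \<eta> k"
    and B: "(\<Sum>k=1..n. (real (n - k) + 1) powr (1 - \<gamma>) * \<eta> k) \<le> B * \<tau>" "0 \<le> B"
    and \<omega>: "\<omega> \<le> 3 - \<gamma>" "\<omega> \<le> 2 - \<alpha>" "0 \<le> \<omega>"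
  shows "\<bar>mu2 \<tau> \<alpha> * (\<Sum>k=1..n. c_coeff n \<alpha> (n - k) * \<eta> k)\<bar>
    \<le> 8 * B * (1 + T) ^ 3 / Gamma (2 - \<alpha>) * \<tau> powr \<omega>"
proof -
  have \<tau>0: "0 < \<tau>" "\<tau> \<le> T"
    using T N by (auto simp: pos_divide_le_eq mult_le_cancel_left1)
  have G: "Gamma (2 - \<alpha>) > 0" using \<alpha> by simp
  have c0: "0 \<le> (\<Sum>k=1..n. c_coeff n \<alpha> (n - k) * \<eta> k)"
    using \<alpha> \<eta> by (intro sum_nonneg mult_nonneg_nonneg c_coeff_bounds) auto
  define M where "M = max 1 (real N powr (\<gamma> - 1 - \<alpha>))"
  have ker: "(real (n - k) + 1) powr (- \<alpha>) \<le> M * (real (n - k) + 1) powr (1 - \<gamma>)" if "k \<in> {1..n}" for k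
  proof -
    let ?x = "real (n - k) + 1"
    have x: "1 \<le> ?x" "?x \<le> real N" using that n by auto
    have "?x powr (\<gamma> - 1 - \<alpha>) \<le> M"
    proof (cases "\<gamma> - 1 - \<alpha> \<le> 0")
      case True
      then have "?x powr (\<gamma> - 1 - \<alpha>) \<le> ?x powr 0" using x by (intro powr_mono) auto
      then show ?thesis using x by (simp add: M_def)
    next
      case False
      then have "?x powr (\<gamma> - 1 - \<alpha>) \<le> real N powr (\<gamma> - 1 - \<alpha>)" using x by (intro powr_mono2) auto
      then show ?thesis by (simp add: M_def)
    qed
    then have "?x powr (\<gamma> - 1 - \<alpha>) * ?x powr (1 - \<gamma>) \<le> M * ?x powr (1 - \<gamma>)"
      by (intro mult_right_mono) auto
    then show ?thesis by (simp flip: powr_add)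
  qed
  have "(\<Sum>k=1..n. c_coeff n \<alpha> (n - k) * \<eta> k) \<le> (\<Sum>k=1..n. (8 * (M * (real (n - k) + 1) powr (1 - \<gamma>))) * \<eta> k)"
  proof (intro sum_mono mult_right_mono)
    fix k assume k: "k \<in> {1..n}"
    then have "c_coeff n \<alpha> (n - k) \<le> 8 * (real (n - k) + 1) powr (- \<alpha>)"
      using \<alpha> by (intro c_coeff_bounds) auto
    with ker[OF k] show "c_coeff n \<alpha> (n - k) \<le> 8 * (M * (real (n - k) + 1) powr (1 - \<gamma>))" by simp
  qed (rule \<eta>)
  also have "\<dots> = 8 * M * (\<Sum>k=1..n. (real (n - k) + 1) powr (1 - \<gamma>) * \<eta> k)"
    by (simp add: sum_distrib_left mult.assoc)
  also have "\<dots> \<le> 8 * M * (B * \<tau>)"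
    using B by (intro mult_left_mono) (auto simp: M_def)
  finally have "mu2 \<tau> \<alpha> * (\<Sum>k=1..n. c_coeff n \<alpha> (n - k) * \<eta> k) \<le> mu2 \<tau> \<alpha> * (8 * M * (B * \<tau>))"
    using G by (intro mult_left_mono) (auto simp: mu2_def)
  also have "\<dots> = 8 * B / Gamma (2 - \<alpha>) * (M * (\<tau> powr (1 - \<alpha>) * \<tau> powr 1))"
    using \<tau>0 by (simp add: mu2_def)
  also have "\<tau> powr (1 - \<alpha>) * \<tau> powr 1 = \<tau> powr (2 - \<alpha>)"
    by (simp only: powr_add[symmetric]) simp
  also have "M * \<tau> powr (2 - \<alpha>) \<le> (1 + T) ^ 3 * \<tau> powr \<omega>"
  proof (cases "M = 1")
    case True
    have "\<tau> powr (2 - \<alpha>) \<le> (1 + T)\<^sup>2 * \<tau> powr \<omega>"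
      using \<tau>0 \<omega> \<alpha> by (intro powr_le_powr_scaled) auto
    also have "\<dots> \<le> (1 + T) ^ 3 * \<tau> powr \<omega>"
      using T by (intro mult_right_mono power_increasing) auto
    finally show ?thesis using True by simp
  next
    case False
    then have M: "M = real N powr (\<gamma> - 1 - \<alpha>)" "1 < real N powr (\<gamma> - 1 - \<alpha>)" by (auto simp: M_def max_def split: if_splits)
    have e: "0 < \<gamma> - 1 - \<alpha>"
    proof (rule ccontr)
      assume "\<not> 0 < \<gamma> - 1 - \<alpha>"
      then have "real N powr (\<gamma> - 1 - \<alpha>) \<le> real N powr 0" using N by (intro powr_mono) auto
      with M N show False by simp
    qed
    have "real N = T / \<tau>" using T N by simp
    then have "M * \<tau> powr (2 - \<alpha>) = T powr (\<gamma> - 1 - \<alpha>) * (\<tau> powr (2 - \<alpha>) / \<tau> powr (\<gamma> - 1 - \<alpha>))"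
      using M \<tau>0 T by (simp add: powr_divide)
    also have "\<tau> powr (2 - \<alpha>) / \<tau> powr (\<gamma> - 1 - \<alpha>) = \<tau> powr (3 - \<gamma>)"
      by (simp flip: powr_diff)
    also have "T powr (\<gamma> - 1 - \<alpha>) * \<tau> powr (3 - \<gamma>) \<le> (1 + T) powr 1 * ((1 + T)\<^sup>2 * \<tau> powr \<omega>)"
    proof (intro mult_mono)
      have "T powr (\<gamma> - 1 - \<alpha>) \<le> (1 + T) powr (\<gamma> - 1 - \<alpha>)" using T e by (intro powr_mono2) auto
      also have "\<dots> \<le> (1 + T) powr 1" using T \<gamma> \<alpha> by (intro powr_mono) auto
      finally show "T powr (\<gamma> - 1 - \<alpha>) \<le> (1 + T) powr 1" .
      show "\<tau> powr (3 - \<gamma>) \<le> (1 + T)\<^sup>2 * \<tau> powr \<omega>"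
        using \<tau>0 \<omega> \<gamma> by (intro powr_le_powr_scaled) auto
    qed auto
    finally show ?thesis using T by (simp add: power2_eq_square power3_eq_cube)
  qed
  finally show ?thesis
    using c0 G B by (simp add: mu2_def divide_right_mono mult_left_mono mult.assoc)
qed

section \<open>Truncation error in time\<close>

lemma powr_kernel_integrable:
  fixes t l r \<theta> :: real
  assumes "l \<le> r" "r \<le> t" "\<theta> > 0" and g: "continuous_on {l..r} g"
  shows "(\<lambda>s. (t - s) powr (\<theta> - 1) * g s) integrable_on {l..r}"
proof -
  have "(\<lambda>s. (t - s) powr (\<theta> - 1)) absolutely_integrable_on {l..r}"
    using powr_kernel_integral[OF assms(1-3)]
    by (intro nonnegative_absolutely_integrable_1) auto
  moreover have "g \<in> borel_measurable (lebesgue_on {l..r})"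
    using g by (intro continuous_imp_measurable_on_sets_lebesgue) auto
  moreover have "bounded (g ` {l..r})"
    using g by (intro compact_imp_bounded compact_continuous_image) auto
  ultimately have "(\<lambda>s. g s * (t - s) powr (\<theta> - 1)) absolutely_integrable_on {l..r}"
    by (intro absolutely_integrable_bounded_measurable_product_real) auto
  then show ?thesis
    using set_lebesgue_integral_eq_integral(1) by (simp add: mult.commute)
qed

lemma powr_kernel_integral_bound:
  fixes t l r \<theta> :: real
  assumes "l \<le> r" "r \<le> t" "\<theta> > 0" and g: "continuous_on {l..r} g" "\<And>s. s \<in> {l..r} \<Longrightarrow> \<bar>g s\<bar> \<le> B"
  shows "\<bar>integral {l..r} (\<lambda>s. (t - s) powr (\<theta> - 1) * g s)\<bar> \<le> B * (((t - l) powr \<theta> - (t - r) powr \<theta>) / \<theta>)"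
proof -
  have K: "((\<lambda>s. B * (t - s) powr (\<theta> - 1)) has_integral B * (((t - l) powr \<theta> - (t - r) powr \<theta>) / \<theta>)) {l..r}"
    by (intro has_integral_mult_right powr_kernel_integral assms(1-3))
  have "norm (integral {l..r} (\<lambda>s. (t - s) powr (\<theta> - 1) * g s)) \<le> integral {l..r} (\<lambda>s. B * (t - s) powr (\<theta> - 1))"
    using powr_kernel_integrable[OF assms(1-3) g(1)] K g(2)
    by (intro integral_norm_bound_integral) (auto simp: abs_mult mult.commute intro!: mult_right_mono)
  then show ?thesis using integral_unique[OF K] by simp
qed

text \<open>If \<open>g\<close> has mean zero, a constant may be subtracted from the kernel.\<close>
lemma powr_kernel_integral_bound_mean_zero:
  fixes t l r \<theta> :: real
  assumes "l \<le> r" "r < t" "0 < \<theta>" "\<theta> < 1" and g: "continuous_on {l..r} g" "\<And>s. s \<in> {l..r} \<Longrightarrow> \<bar>g s\<bar> \<le> B"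
    and mean: "(g has_integral 0) {l..r}"
  shows "\<bar>integral {l..r} (\<lambda>s. (t - s) powr (\<theta> - 1) * g s)\<bar>
    \<le> B * (r - l) * ((t - r) powr (\<theta> - 1) - (t - l) powr (\<theta> - 1))"
proof -
  have mono: "(t - s) powr (\<theta> - 1) \<le> (t - s') powr (\<theta> - 1)" if "s \<le> s'" "s' < t" for s s'
    using that powr_neg_antimono[of "t - s'" "t - s" "1 - \<theta>"] assms by simp
  let ?K = "\<lambda>s. (t - s) powr (\<theta> - 1)"
  have int: "(\<lambda>s. ?K s * g s) integrable_on {l..r}"
    using assms by (intro powr_kernel_integrable) auto
  have int2: "(\<lambda>s. ?K l * g s) integrable_on {l..r}"
    using has_integral_mult_right[OF mean] by blast
  have "integral {l..r} (\<lambda>s. ?K s * g s) = integral {l..r} (\<lambda>s. ?K s * g s) - integral {l..r} (\<lambda>s. ?K l * g s)"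
    using integral_unique[OF has_integral_mult_right[OF mean, of "?K l"]] by simp
  also have "\<dots> = integral {l..r} (\<lambda>s. ?K s * g s - ?K l * g s)"
    using int int2 by (simp add: Henstock_Kurzweil_Integration.integral_diff)
  finally have eq: "integral {l..r} (\<lambda>s. ?K s * g s) = integral {l..r} (\<lambda>s. ?K s * g s - ?K l * g s)" .
  have "norm (integral {l..r} (\<lambda>s. ?K s * g s - ?K l * g s)) \<le> integral {l..r} (\<lambda>s. (?K r - ?K l) * B)"
  proof (rule integral_norm_bound_integral)
    show "(\<lambda>s. ?K s * g s - ?K l * g s) integrable_on {l..r}"
      using int int2 by (rule integrable_diff)
    fix s assume s: "s \<in> {l..r}"
    have "norm (?K s * g s - ?K l * g s) = (?K s - ?K l) * \<bar>g s\<bar>"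
      using mono[of l s] s assms by (simp add: abs_mult flip: left_diff_distrib)
    also have "\<dots> \<le> (?K r - ?K l) * B"
      using mono[of l s] mono[of s r] s assms by (intro mult_mono g(2)) auto
    finally show "norm (?K s * g s - ?K l * g s) \<le> (?K r - ?K l) * B" .
  qed auto
  then show ?thesis using eq assms by (simp add: mult_ac)
qed

lemma integral_split_nodes:
  fixes x :: "nat \<Rightarrow> real" and f :: "real \<Rightarrow> real"
  assumes "\<And>k. k < m \<Longrightarrow> x k \<le> x (Suc k)" "f integrable_on {x 0..x m}"
  shows "integral {x 0..x m} f = (\<Sum>k<m. integral {x k..x (Suc k)} f)"
  using assms
proof (induction m)
  case (Suc m)
  have le: "x 0 \<le> x k" if "k \<le> m" for k
    using that Suc.prems(1) by (induction k) (auto intro: order_trans)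
  have sub: "f integrable_on {x 0..x m}"
    using Suc.prems by (intro integrable_on_subinterval[OF Suc.prems(2)]) auto
  have "integral {x 0..x (Suc m)} f = integral {x 0..x m} f + integral {x m..x (Suc m)} f"
    using Suc.prems le[of m] by (intro Henstock_Kurzweil_Integration.integral_combine[symmetric]) auto
  then show ?case using Suc.IH Suc.prems sub by simp
qed simp

lemma Gamma_plus1_pos: "x > 0 \<Longrightarrow> Gamma (x + 1) = x * Gamma x" for x :: real
  by (intro Gamma_plus1) (auto dest: nonpos_Ints_nonpos)

text \<open>\<open>w i\<close> is the i-th time derivative of a function at a fixed grid point. The
  locale is used for u and for its discrete Laplacian, so that the terms of order \<beta> need no
  separate truncation analysis.\<close>

locale smooth_in_time =
  fixes w :: "nat \<Rightarrow> real \<Rightarrow> real" and T M :: real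
  assumes T_pos: "T > 0"
    and deriv: "\<And>i t. i < 3 \<Longrightarrow> t \<in> {0..T} \<Longrightarrow> (w i has_real_derivative w (Suc i) t) (at t within {0..T})"
    and bound: "\<And>i t. i \<le> 3 \<Longrightarrow> t \<in> {0..T} \<Longrightarrow> \<bar>w i t\<bar> \<le> M"
begin

lemma M_nonneg: "0 \<le> M"
  using bound[of 0 0] T_pos by auto

lemma continuous: "i < 3 \<Longrightarrow> continuous_on {0..T} (w i)"
  using deriv by (intro DERIV_continuous_on) auto

lemma taylor:
  assumes "t \<in> {0..T}" "c \<in> {0..T}" "i + n < 3"
  shows "\<bar>w i t - (\<Sum>k\<le>n. w (i + k) c * (t - c) ^ k / fact k)\<bar> \<le> M * \<bar>t - c\<bar> ^ Suc n / fact n"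
proof -
  have "norm (w (i + 0) t - (\<Sum>k\<le>n. w (i + k) c * (t - c) ^ k / fact k)) \<le> M * norm (t - c) ^ Suc n / fact n"
    by (rule field_Taylor[of "{0..T}" n "\<lambda>k. w (i + k)" M c t]) (use assms deriv bound in auto)
  then show ?thesis by simp
qed

lemma taylor0: "t \<in> {0..T} \<Longrightarrow> c \<in> {0..T} \<Longrightarrow> i < 3 \<Longrightarrow> \<bar>w i t - w i c\<bar> \<le> M * \<bar>t - c\<bar>"
  using taylor[of t c i 0] by simp

lemma taylor1:
  "t \<in> {0..T} \<Longrightarrow> c \<in> {0..T} \<Longrightarrow> i < 2 \<Longrightarrow> \<bar>w i t - w i c - w (Suc i) c * (t - c)\<bar> \<le> M * (t - c)\<^sup>2"
  using taylor[of t c i 1] by (simp add: numeral_2_eq_2 algebra_simps)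

lemma taylor2:
  "t \<in> {0..T} \<Longrightarrow> c \<in> {0..T} \<Longrightarrow> \<bar>w 0 t - w 0 c - w 1 c * (t - c) - w 2 c * (t - c)\<^sup>2 / 2\<bar> \<le> M * \<bar>t - c\<bar> ^ 3 / 2"
  using taylor[of t c 0 2] by (simp add: numeral_2_eq_2 numeral_3_eq_3 algebra_simps)

end

locale time_grid = smooth_in_time +
  fixes N :: nat and \<tau> :: real
  assumes N_pos: "N \<ge> 1" and tau: "\<tau> = T / real N"
begin

lemma tau_pos: "0 < \<tau>" and tau_le: "\<tau> \<le> T" and N_tau: "real N * \<tau> = T"
  using T_pos N_pos by (auto simp: tau pos_divide_le_eq mult_le_cancel_left1)

lemma node_in: "0 \<le> x \<Longrightarrow> x \<le> real N \<Longrightarrow> x * \<tau> \<in> {0..T}"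
  using tau_pos N_tau mult_right_mono[of x "real N" \<tau>] by auto

definition dq :: "nat \<Rightarrow> real" where
  "dq k = (w 0 (real k * \<tau>) - w 0 ((real k - 1) * \<tau>)) / \<tau>"

definition mid :: "nat \<Rightarrow> real" where
  "mid k = (real k - 1/2) * \<tau>"

lemma mid_in: "k \<in> {1..N} \<Longrightarrow> mid k \<in> {0..T}"
  unfolding mid_def by (rule node_in) auto

lemma dq_tau: "dq k * \<tau> = w 0 (real k * \<tau>) - w 0 ((real k - 1) * \<tau>)"
  using tau_pos by (simp add: dq_def)

text \<open>Expanded about the midpoint, the even terms cancel in the difference, so the remainder
  of third order decides.\<close>

lemma dq_mid:
  assumes "k \<in> {1..N}"
  shows "\<bar>dq k - w 1 (mid k)\<bar> \<le> M * \<tau>\<^sup>2"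
proof -
  have t: "real k * \<tau> \<in> {0..T}" "(real k - 1) * \<tau> \<in> {0..T}" using assms by (intro node_in; simp)+
  have d: "real k * \<tau> - mid k = \<tau> / 2" "(real k - 1) * \<tau> - mid k = - (\<tau> / 2)"
    by (simp_all add: mid_def algebra_simps)
  have "\<bar>(w 0 (real k * \<tau>) - w 0 ((real k - 1) * \<tau>)) - w 1 (mid k) * \<tau>\<bar> \<le> 2 * (M * (\<tau> / 2) ^ 3 / 2)"
  proof -
    define r1 where "r1 = w 0 (real k * \<tau>) - w 0 (mid k) - w 1 (mid k) * (\<tau> / 2) - w 2 (mid k) * (\<tau> / 2)\<^sup>2 / 2"
    define r2 where "r2 = w 0 ((real k - 1) * \<tau>) - w 0 (mid k) - w 1 (mid k) * (- (\<tau> / 2))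
      - w 2 (mid k) * (- (\<tau> / 2))\<^sup>2 / 2"
    have "\<bar>r1\<bar> \<le> M * (\<tau> / 2) ^ 3 / 2" "\<bar>r2\<bar> \<le> M * (\<tau> / 2) ^ 3 / 2"
      using taylor2[OF t(1) mid_in[OF assms]] taylor2[OF t(2) mid_in[OF assms]] tau_pos
      unfolding d r1_def r2_def by simp_all
    moreover have "(w 0 (real k * \<tau>) - w 0 ((real k - 1) * \<tau>)) - w 1 (mid k) * \<tau> = r1 - r2"
      by (simp add: r1_def r2_def field_simps)
    ultimately show ?thesis by linarith
  qed
  then have "\<bar>(dq k - w 1 (mid k)) * \<tau>\<bar> \<le> (M * \<tau>\<^sup>2 / 8) * \<tau>"
    unfolding left_diff_distrib[of "dq k"] dq_tau by (simp add: power3_eq_cube power2_eq_square)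
  then have "\<bar>dq k - w 1 (mid k)\<bar> \<le> M * \<tau>\<^sup>2 / 8"
    using tau_pos by (simp add: abs_mult)
  also have "\<dots> \<le> M * \<tau>\<^sup>2" using M_nonneg by simp
  finally show ?thesis .
qed

lemma avg_mid:
  assumes "k \<in> {1..N}"
  shows "\<bar>(w 0 (real k * \<tau>) + w 0 ((real k - 1) * \<tau>)) / 2 - w 0 (mid k)\<bar> \<le> M * \<tau>\<^sup>2"
proof -
  have t: "real k * \<tau> \<in> {0..T}" "(real k - 1) * \<tau> \<in> {0..T}" using assms by (intro node_in; simp)+
  have d: "real k * \<tau> - mid k = \<tau> / 2" "(real k - 1) * \<tau> - mid k = - (\<tau> / 2)"
    by (simp_all add: mid_def algebra_simps)
  have "\<bar>(w 0 (real k * \<tau>) + w 0 ((real k - 1) * \<tau>)) / 2 - w 0 (mid k)\<bar> \<le> M * (\<tau> / 2)\<^sup>2"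
  proof -
    define r1 where "r1 = w 0 (real k * \<tau>) - w 0 (mid k) - w 1 (mid k) * (\<tau> / 2)"
    define r2 where "r2 = w 0 ((real k - 1) * \<tau>) - w 0 (mid k) - w 1 (mid k) * (- (\<tau> / 2))"
    have "\<bar>r1\<bar> \<le> M * (\<tau> / 2)\<^sup>2" "\<bar>r2\<bar> \<le> M * (\<tau> / 2)\<^sup>2"
      using taylor1[OF t(1) mid_in[OF assms], of 0] taylor1[OF t(2) mid_in[OF assms], of 0]
      unfolding d r1_def r2_def by simp_all
    moreover have "(w 0 (real k * \<tau>) + w 0 ((real k - 1) * \<tau>)) / 2 - w 0 (mid k) = (r1 + r2) / 2"
      by (simp add: r1_def r2_def field_simps)
    moreover have "\<bar>(r1 + r2) / 2\<bar> \<le> B" if "\<bar>r1\<bar> \<le> B" "\<bar>r2\<bar> \<le> B" for B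
      using that by (auto simp: abs_le_iff)
    ultimately show ?thesis by (simp only:)
  qed
  also have "\<dots> \<le> M * \<tau>\<^sup>2"
    using M_nonneg tau_pos by (intro mult_left_mono power_mono) auto
  finally show ?thesis .
qed

text \<open>The three nodes are not symmetric about \<open>mid k\<close> (distances 1/2, 1/2 and 3/2
  of a step), hence only first order; the slope is later multiplied by a distance of order \<tau>.
  The third-order remainders add up to 15/8, rounded to 2.\<close>

lemma dq_slope:
  assumes "k \<in> {1..N-1}"
  shows "\<bar>(dq (Suc k) - dq k) / \<tau> - w 2 (mid k)\<bar> \<le> 2 * M * \<tau>"
proof -
  have k: "k \<in> {1..N}" "k < N" using assms by auto
  have t: "real k * \<tau> \<in> {0..T}" "(real k - 1) * \<tau> \<in> {0..T}" "(real k + 1) * \<tau> \<in> {0..T}"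
    using k by (intro node_in; simp)+
  have d: "real k * \<tau> - mid k = \<tau> / 2" "(real k - 1) * \<tau> - mid k = - (\<tau> / 2)"
    "(real k + 1) * \<tau> - mid k = 3 * (\<tau> / 2)"
    by (simp_all add: mid_def algebra_simps)
  let ?c = "mid k"
  let ?X = "w 0 ((real k + 1) * \<tau>) - 2 * w 0 (real k * \<tau>) + w 0 ((real k - 1) * \<tau>)"
  have "\<bar>?X - w 2 ?c * \<tau>\<^sup>2\<bar> \<le> M * (3 * (\<tau> / 2)) ^ 3 / 2 + 2 * (M * (\<tau> / 2) ^ 3 / 2) + M * (\<tau> / 2) ^ 3 / 2"
  proof -
    define r1 where "r1 = w 0 (real k * \<tau>) - w 0 ?c - w 1 ?c * (\<tau> / 2) - w 2 ?c * (\<tau> / 2)\<^sup>2 / 2"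
    define r2 where "r2 = w 0 ((real k - 1) * \<tau>) - w 0 ?c - w 1 ?c * (- (\<tau> / 2)) - w 2 ?c * (- (\<tau> / 2))\<^sup>2 / 2"
    define r3 where "r3 = w 0 ((real k + 1) * \<tau>) - w 0 ?c - w 1 ?c * (3 * (\<tau> / 2)) - w 2 ?c * (3 * (\<tau> / 2))\<^sup>2 / 2"
    have "\<bar>r1\<bar> \<le> M * (\<tau> / 2) ^ 3 / 2" "\<bar>r2\<bar> \<le> M * (\<tau> / 2) ^ 3 / 2" "\<bar>r3\<bar> \<le> M * (3 * (\<tau> / 2)) ^ 3 / 2"
      using taylor2[OF t(1) mid_in[OF k(1)]] taylor2[OF t(2) mid_in[OF k(1)]] taylor2[OF t(3) mid_in[OF k(1)]] tau_pos
      unfolding d r1_def r2_def r3_def by simp_all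
    moreover have "?X - w 2 ?c * \<tau>\<^sup>2 = r3 - 2 * r1 + r2"
      by (simp add: r1_def r2_def r3_def power2_eq_square field_simps)
    ultimately show ?thesis by linarith
  qed
  also have "\<dots> = 15/8 * M * \<tau> * \<tau>\<^sup>2"
    by (simp add: power3_eq_cube power2_eq_square)
  also have "\<dots> \<le> 2 * M * \<tau> * \<tau>\<^sup>2"
    using M_nonneg tau_pos by (intro mult_right_mono) auto
  finally have "\<bar>?X - w 2 ?c * \<tau>\<^sup>2\<bar> \<le> 2 * M * \<tau> * \<tau>\<^sup>2" .
  moreover have "\<bar>((dq (Suc k) - dq k) / \<tau> - w 2 ?c) * \<tau>\<^sup>2\<bar> \<le> 2 * M * \<tau> * \<tau>\<^sup>2"
    if "\<bar>?X - w 2 ?c * \<tau>\<^sup>2\<bar> \<le> 2 * M * \<tau> * \<tau>\<^sup>2"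
  proof -
    have "(dq (Suc k) - dq k) / \<tau> * \<tau>\<^sup>2 = (dq (Suc k) - dq k) * \<tau>"
      using tau_pos by (simp add: power2_eq_square)
    also have "\<dots> = ?X"
      unfolding left_diff_distrib[of _ _ \<tau>] dq_tau by (simp add: algebra_simps)
    finally show ?thesis using that by (simp only: left_diff_distrib)
  qed
  ultimately have "\<bar>((dq (Suc k) - dq k) / \<tau> - w 2 ?c) * \<tau>\<^sup>2\<bar> \<le> 2 * M * \<tau> * \<tau>\<^sup>2" by blast
  then show ?thesis using tau_pos by (simp add: abs_mult)
qed

text \<open>On each full cell the derivative is replaced by the linear function with value
  \<open>dq\<close> at the midpoint and slope towards the next quotient, with error of order
  \<tau>^2. The half cell that ends at \<open>mid n\<close> has no next quotient, so a constant with
  error of order \<tau> is used; there the kernel has mass of order \<tau> to the power 1 -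
  \<alpha>. This cell determines the rate.\<close>

lemma caputo1_truncation:
  assumes \<alpha>: "0 < \<alpha>" "\<alpha> < 1" and n: "n \<in> {1..N}"
  shows "\<bar>1 / Gamma (1 - \<alpha>) * integral {0..mid n} (\<lambda>s. (mid n - s) powr (- \<alpha>) * w 1 s)
    - mu2 \<tau> \<alpha> * (\<Sum>k=1..n. c_coeff n \<alpha> (n - k) * dq k)\<bar>
    \<le> 4 * (1 + T)\<^sup>2 * M / Gamma (2 - \<alpha>) * \<tau> powr (2 - \<alpha>)"
proof -
  let ?S = "(\<Sum>k=1..n. c_coeff n \<alpha> (n - k) * dq k)"
  define \<theta> where "\<theta> = 1 - \<alpha>"
  have \<theta>: "0 < \<theta>" "\<theta> < 1" "- \<alpha> = \<theta> - 1" using \<alpha> by (auto simp: \<theta>_def)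
  define t where "t = mid n"
  define K where "K s = (t - s) powr (\<theta> - 1)" for s
  define x where "x k = real k * \<tau>" for k
  define J where "J k = integral {x k..x (Suc k)} (\<lambda>s. K s * w 1 s)" for k
  define J' where "J' = integral {x (n - 1)..t} (\<lambda>s. K s * w 1 s)"
  have n1: "real (n - 1) = real n - 1" using n by auto
  have tx: "t - x k = (real n - real k - 1/2) * \<tau>" for k by (simp add: t_def mid_def x_def algebra_simps)
  have xt: "x k \<le> t" if "k \<le> n - 1" for k
  proof -
    have "real k \<le> real (n - 1)" using that by simp
    then have "real k \<le> real n - 1/2" using n1 by linarith
    then show ?thesis using tau_pos by (simp add: x_def t_def mid_def)
  qed
  have xmono: "x k \<le> x (Suc k)" "0 \<le> x k" for k using tau_pos by (auto simp: x_def)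
  have tT: "t \<in> {0..T}" unfolding t_def using n by (rule mid_in)
  have cont: "continuous_on {l..r} (w 1)" if "0 \<le> l" "r \<le> t" for l r
    using continuous[of 1] tT that by (auto intro: continuous_on_subset)
  have "integral {0..t} (\<lambda>s. K s * w 1 s) = integral {x 0..x (n - 1)} (\<lambda>s. K s * w 1 s) + J'"
    unfolding J'_def using xt[of "n - 1"] xmono(2)[of "n - 1"] tT \<theta> cont[of 0 t]
    by (subst Henstock_Kurzweil_Integration.integral_combine) (auto simp: x_def K_def intro!: powr_kernel_integrable)
  also have "integral {x 0..x (n - 1)} (\<lambda>s. K s * w 1 s) = (\<Sum>k<n-1. J k)"
    unfolding J_def using xt[of "n - 1"] xmono \<theta> cont[of "x 0" "x (n - 1)"] xmono(2)[of "n - 1"]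
    by (intro integral_split_nodes) (auto simp: K_def x_def intro!: powr_kernel_integrable)
  finally have split: "integral {0..t} (\<lambda>s. K s * w 1 s) = (\<Sum>k<n-1. J k) + J'" .
  have cell: "\<bar>J k - \<tau> powr \<theta> / \<theta> * (at_coeff \<alpha> (n - Suc k) * dq (Suc k)
        + bt_coeff \<alpha> (n - Suc k) * (dq (Suc (Suc k)) - dq (Suc k)))\<bar>
      \<le> 3 * M * \<tau>\<^sup>2 * (((t - x k) powr \<theta> - (t - x (Suc k)) powr \<theta>) / \<theta>)" if k: "k < n - 1" for k
  proof -
    let ?c = "mid (Suc k)" and ?sl = "(dq (Suc (Suc k)) - dq (Suc k)) / \<tau>"
    define m where "m = n - Suc k"
    have m: "m \<ge> 1" "real n = real m + real k + 1" using k by (auto simp: m_def)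
    have lr: "x k \<le> x (Suc k)" "x (Suc k) \<le> t" using xmono xt[of "Suc k"] k by auto
    have kN: "Suc k \<in> {1..N}" "Suc k \<in> {1..N-1}" using k n by auto
    have l: "t - x k = \<tau> * (real m + 1/2)" and r: "t - x (Suc k) = \<tau> * (real m - 1/2)"
      unfolding tx m(2) by (simp_all add: algebra_simps)
    have c: "x k - ?c = - (\<tau> / 2)" "x (Suc k) - ?c = \<tau> / 2" by (simp_all add: x_def mid_def algebra_simps)
    have I0: "(K has_integral \<tau> powr \<theta> / \<theta> * at_coeff \<alpha> m) {x k..x (Suc k)}"
    proof -
      have eq: "((t - x k) powr \<theta> - (t - x (Suc k)) powr \<theta>) / \<theta> = \<tau> powr \<theta> / \<theta> * at_coeff \<alpha> m"
        unfolding l r using m tau_pos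
        by (subst (1 2) powr_mult)
          (simp_all add: at_coeff_def \<theta>_def[symmetric] right_diff_distrib diff_divide_distrib)
      show ?thesis
        using powr_kernel_integral[OF lr \<theta>(1)] unfolding eq K_def .
    qed
    have I1: "((\<lambda>s. K s * (s - ?c)) has_integral \<tau> powr \<theta> / \<theta> * (\<tau> * bt_coeff \<alpha> m)) {x k..x (Suc k)}"
    proof -
      let ?A = "(real m + 1/2) powr \<theta>" and ?B = "(real m - 1/2) powr \<theta>"
        and ?C = "(real m + 1/2) powr (\<theta> + 1)" and ?D = "(real m - 1/2) powr (\<theta> + 1)"
      have pm: "(\<tau> * (real m + 1/2)) powr \<theta> = \<tau> powr \<theta> * ?A" "(\<tau> * (real m - 1/2)) powr \<theta> = \<tau> powr \<theta> * ?B"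
        "(\<tau> * (real m + 1/2)) powr (\<theta> + 1) = \<tau> powr \<theta> * \<tau> * ?C"
        "(\<tau> * (real m - 1/2)) powr (\<theta> + 1) = \<tau> powr \<theta> * \<tau> * ?D"
        using m tau_pos by (simp_all add: powr_mult powr_add)
      have "- (\<tau> / 2) * (\<tau> powr \<theta> * ?A) / \<theta> - \<tau> / 2 * (\<tau> powr \<theta> * ?B) / \<theta>
          + (\<tau> powr \<theta> * \<tau> * ?C - \<tau> powr \<theta> * \<tau> * ?D) / (\<theta> * (\<theta> + 1))
        = \<tau> powr \<theta> / \<theta> * (\<tau> * (1 / (\<theta> + 1) * (?C - ?D) - 1/2 * (?A + ?B)))"
        by (simp add: add_divide_distrib diff_divide_distrib right_diff_distrib distrib_left mult_ac)
      moreover have "1 / (\<theta> + 1) * (?C - ?D) - 1/2 * (?A + ?B) = bt_coeff \<alpha> m"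
        by (simp add: bt_coeff_def \<theta>_def)
      ultimately show ?thesis
        using powr_kernel_moment[OF lr \<theta>(1), of ?c] unfolding K_def c l r pm by simp
    qed
    have IP: "((\<lambda>s. K s * (dq (Suc k) + (s - ?c) * ?sl)) has_integral
        \<tau> powr \<theta> / \<theta> * (at_coeff \<alpha> m * dq (Suc k) + bt_coeff \<alpha> m * (dq (Suc (Suc k)) - dq (Suc k)))) {x k..x (Suc k)}"
      by (rule has_integral_eq_both[OF has_integral_add[OF has_integral_mult_left[OF I0, of "dq (Suc k)"]
            has_integral_mult_left[OF I1, of ?sl]]])
        (use tau_pos in \<open>simp_all add: distrib_left mult_ac\<close>)
    define g where "g s = w 1 s - (dq (Suc k) + (s - ?c) * ?sl)" for s
    have gc: "continuous_on {x k..x (Suc k)} g"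
      unfolding g_def using cont[of "x k" "x (Suc k)"] lr xmono(2)[of k] by (intro continuous_intros) auto
    have gb: "\<bar>g s\<bar> \<le> 3 * M * \<tau>\<^sup>2" if s: "s \<in> {x k..x (Suc k)}" for s
    proof -
      have sT: "s \<in> {0..T}" using s lr tT xmono(2)[of k] by auto
      have sc: "\<bar>s - ?c\<bar> \<le> \<tau> / 2" 
      proof -
        have "x k \<le> s" "s \<le> x (Suc k)" using s by auto
        then show ?thesis using c by linarith
      qed
      have "\<bar>w 1 s - w 1 ?c - w 2 ?c * (s - ?c)\<bar> \<le> M * (s - ?c)\<^sup>2"
        using taylor1[OF sT mid_in[OF kN(1)], of 1] by (simp add: numeral_2_eq_2)
      also have "\<dots> \<le> M * (\<tau> / 2)\<^sup>2"
        using sc M_nonneg by (intro mult_left_mono) (auto simp: abs_le_square_iff[symmetric])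
      finally have e1: "\<bar>w 1 s - w 1 ?c - w 2 ?c * (s - ?c)\<bar> \<le> M * \<tau>\<^sup>2 / 4"
        by (simp add: power2_eq_square)
      have "\<bar>(s - ?c) * (?sl - w 2 ?c)\<bar> \<le> \<tau> / 2 * (2 * M * \<tau>)"
        unfolding abs_mult using sc dq_slope[OF kN(2)] tau_pos by (intro mult_mono) auto
      then have e2: "\<bar>(s - ?c) * (?sl - w 2 ?c)\<bar> \<le> M * \<tau>\<^sup>2"
        by (simp add: power2_eq_square mult_ac)
      have "g s = (w 1 s - w 1 ?c - w 2 ?c * (s - ?c)) - (dq (Suc k) - w 1 ?c) - (s - ?c) * (?sl - w 2 ?c)"
        by (simp add: g_def algebra_simps)
      then have "\<bar>g s\<bar> \<le> M * \<tau>\<^sup>2 / 4 + M * \<tau>\<^sup>2 + M * \<tau>\<^sup>2"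
        using e1 e2 dq_mid[OF kN(1)] by linarith
      also have "\<dots> \<le> 3 * M * \<tau>\<^sup>2" using M_nonneg by simp
      finally show ?thesis .
    qed
    have "integral {x k..x (Suc k)} (\<lambda>s. K s * g s) = J k - \<tau> powr \<theta> / \<theta> * (at_coeff \<alpha> m * dq (Suc k)
        + bt_coeff \<alpha> m * (dq (Suc (Suc k)) - dq (Suc k)))"
    proof -
      have "(\<lambda>s. K s * w 1 s) integrable_on {x k..x (Suc k)}"
        unfolding K_def using lr \<theta> cont[of "x k" "x (Suc k)"] xmono(2)[of k] by (intro powr_kernel_integrable) auto
      from has_integral_diff[OF integrable_integral[OF this] IP] show ?thesis
        unfolding J_def by (intro integral_unique) (simp add: g_def right_diff_distrib)
    qed
    then show ?thesis
      using powr_kernel_integral_bound[OF lr \<theta>(1) gc gb] unfolding K_def m_def by simp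
  qed
  have last: "\<bar>J' - \<tau> powr \<theta> / \<theta> * (at_coeff \<alpha> 0 * dq n)\<bar> \<le> M * (1 + T) * \<tau> * (\<tau> powr \<theta> / \<theta>)"
  proof -
    have lr: "x (n - 1) \<le> t" "t \<le> t" using xt[of "n - 1"] by auto
    have l: "t - x (n - 1) = \<tau> * (1/2)" unfolding tx n1 by (simp add: algebra_simps)
    have I0: "(K has_integral \<tau> powr \<theta> / \<theta> * at_coeff \<alpha> 0) {x (n-1)..t}"
    proof -
      have eq: "((t - x (n-1)) powr \<theta> - (t - t) powr \<theta>) / \<theta> = \<tau> powr \<theta> / \<theta> * at_coeff \<alpha> 0"
        unfolding l using tau_pos by (subst powr_mult) (simp_all add: at_coeff_def \<theta>_def[symmetric])
      show ?thesis using powr_kernel_integral[OF lr \<theta>(1)] unfolding eq K_def .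
    qed
    define g where "g s = w 1 s - dq n" for s
    have gc: "continuous_on {x (n-1)..t} g"
      unfolding g_def using cont[of "x (n-1)" t] lr xmono(2)[of "n-1"] by (intro continuous_intros) auto
    have gb: "\<bar>g s\<bar> \<le> M * (1 + T) * \<tau>" if s: "s \<in> {x (n-1)..t}" for s
    proof -
      have sT: "s \<in> {0..T}" using s lr tT xmono(2)[of "n-1"] by auto
      have "\<bar>s - t\<bar> \<le> \<tau>" using s l tau_pos by auto
      then have "M * \<bar>s - t\<bar> \<le> M * \<tau>" using M_nonneg by (rule mult_left_mono)
      then have "\<bar>w 1 s - w 1 t\<bar> \<le> M * \<tau>" using taylor0[OF sT tT, of 1] by simp
      moreover have "\<bar>dq n - w 1 t\<bar> \<le> M * \<tau>\<^sup>2" unfolding t_def by (rule dq_mid[OF n])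
      moreover have "M * \<tau>\<^sup>2 \<le> M * T * \<tau>"
        unfolding power2_eq_square mult.assoc[of M]
        using M_nonneg tau_le tau_pos by (intro mult_left_mono mult_right_mono) auto
      ultimately show ?thesis by (simp add: g_def algebra_simps abs_le_iff)
    qed
    have "integral {x (n-1)..t} (\<lambda>s. K s * g s) = J' - \<tau> powr \<theta> / \<theta> * at_coeff \<alpha> 0 * dq n"
    proof -
      have "(\<lambda>s. K s * w 1 s) integrable_on {x (n-1)..t}"
        unfolding K_def using lr \<theta> cont[of "x (n-1)" t] xmono(2)[of "n-1"] by (intro powr_kernel_integrable) auto
      from has_integral_diff[OF integrable_integral[OF this] has_integral_mult_left[OF I0, of "dq n"]] show ?thesis
        unfolding J'_def by (intro integral_unique) (simp add: g_def right_diff_distrib)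
    qed
    then have "\<bar>J' - \<tau> powr \<theta> / \<theta> * (at_coeff \<alpha> 0 * dq n)\<bar>
        \<le> M * (1 + T) * \<tau> * (((t - x (n - 1)) powr \<theta> - (t - t) powr \<theta>) / \<theta>)"
      using powr_kernel_integral_bound[OF lr \<theta>(1) gc gb] unfolding K_def by (simp add: mult.assoc)
    also have "((t - x (n - 1)) powr \<theta> - (t - t) powr \<theta>) / \<theta> \<le> \<tau> powr \<theta> / \<theta>"
      unfolding l using tau_pos \<theta> by (intro divide_right_mono) (auto intro!: powr_mono2)
    finally show ?thesis using M_nonneg T_pos tau_pos by (simp add: mult_left_mono)
  qed
  \<comment> \<open>Collects the coefficient of each quotient: the slope term of a cell is shared
    with its successor, which turns \<open>at_coeff\<close> and \<open>bt_coeff\<close> into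
    \<open>c_coeff\<close>.\<close>
  have weights: "(\<Sum>k<n-1. at_coeff \<alpha> (n - Suc k) * dq (Suc k) + bt_coeff \<alpha> (n - Suc k) * (dq (Suc (Suc k)) - dq (Suc k)))
      + at_coeff \<alpha> 0 * dq n = ?S"
  proof -
    obtain m where m: "n = Suc m" using n by (cases n) auto
    have "?S = (\<Sum>k<n. c_coeff n \<alpha> (n - Suc k) * dq (Suc k))"
      by (simp add: sum.atLeast1_atMost_eq)
    also have "\<dots> = (\<Sum>k<n. (pt_coeff \<alpha> (n - Suc k) + (if k = 0 then 0 else bt_coeff \<alpha> (n - k))) * dq (Suc k))"
      by (intro sum.cong refl) (use c_coeff_eq[OF \<alpha>, of "Suc _" n] in \<open>auto simp: Suc_diff_Suc\<close>)
    also have "\<dots> = (\<Sum>k<n. pt_coeff \<alpha> (n - Suc k) * dq (Suc k)) + (\<Sum>k<n. (if k = 0 then 0 else bt_coeff \<alpha> (n - k)) * dq (Suc k))"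
      by (simp add: distrib_right sum.distrib)
    also have "(\<Sum>k<n. pt_coeff \<alpha> (n - Suc k) * dq (Suc k))
        = (\<Sum>k<m. (at_coeff \<alpha> (n - Suc k) - bt_coeff \<alpha> (n - Suc k)) * dq (Suc k)) + at_coeff \<alpha> 0 * dq n"
      by (simp add: m pt_coeff_def)
    also have "(\<Sum>k<n. (if k = 0 then 0 else bt_coeff \<alpha> (n - k)) * dq (Suc k))
        = (\<Sum>k<m. bt_coeff \<alpha> (n - Suc k) * dq (Suc (Suc k)))"
      unfolding m by (subst sum.lessThan_Suc_shift) simp
    finally show ?thesis
      by (simp add: m sum.distrib[symmetric] algebra_simps)
  qed
  have diff_eq: "integral {0..t} (\<lambda>s. K s * w 1 s) - \<tau> powr \<theta> / \<theta> * ?S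
      = (\<Sum>k<n-1. J k - \<tau> powr \<theta> / \<theta> * (at_coeff \<alpha> (n - Suc k) * dq (Suc k)
        + bt_coeff \<alpha> (n - Suc k) * (dq (Suc (Suc k)) - dq (Suc k))))
      + (J' - \<tau> powr \<theta> / \<theta> * (at_coeff \<alpha> 0 * dq n))"
    unfolding weights[symmetric] split
    by (simp add: sum_subtractf distrib_left sum_distrib_left)
  have "\<bar>integral {0..t} (\<lambda>s. K s * w 1 s) - \<tau> powr \<theta> / \<theta> * ?S\<bar>
      \<le> (\<Sum>k<n-1. 3 * M * \<tau>\<^sup>2 * (((t - x k) powr \<theta> - (t - x (Suc k)) powr \<theta>) / \<theta>))
      + M * (1 + T) * \<tau> * (\<tau> powr \<theta> / \<theta>)"
    unfolding diff_eq
    by (intro order_trans[OF abs_triangle_ineq] add_mono order_trans[OF sum_abs] sum_mono last cell) auto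
  \<comment> \<open>The masses of the kernel over the cells telescope, so the number of cells does
    not enter.\<close>
  also have "(\<Sum>k<n-1. 3 * M * \<tau>\<^sup>2 * (((t - x k) powr \<theta> - (t - x (Suc k)) powr \<theta>) / \<theta>))
      = 3 * M * \<tau>\<^sup>2 * ((t powr \<theta> - (t - x (n - 1)) powr \<theta>) / \<theta>)"
    using sum_lessThan_telescope'[of "\<lambda>k. (t - x k) powr \<theta>" "n - 1"]
    by (simp add: sum_distrib_left[symmetric] sum_divide_distrib[symmetric] x_def)
  also have "\<dots> \<le> 3 * M * \<tau>\<^sup>2 * ((1 + T) / \<theta>)"
  proof (intro mult_left_mono divide_right_mono)
    have "t powr \<theta> \<le> (1 + T) powr \<theta>" using tT \<theta> by (intro powr_mono2) auto
    also have "\<dots> \<le> (1 + T) powr 1" using T_pos \<theta> by (intro powr_mono) auto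
    finally show "t powr \<theta> - (t - x (n - 1)) powr \<theta> \<le> 1 + T" using T_pos by (simp add: add_increasing2 diff_le_eq)
  qed (use M_nonneg \<theta> in auto)
  also have "3 * M * \<tau>\<^sup>2 * ((1 + T) / \<theta>) \<le> 3 * M * ((1 + T) * \<tau> powr (2 - \<alpha>)) * ((1 + T) / \<theta>)"
  proof (intro mult_right_mono mult_left_mono)
    have "\<tau>\<^sup>2 = \<tau> powr \<alpha> * \<tau> powr (2 - \<alpha>)" using tau_pos by (simp flip: powr_add)
    also have "\<tau> powr \<alpha> \<le> (1 + T) powr \<alpha>" using tau_pos tau_le \<alpha> by (intro powr_mono2) auto
    also have "\<dots> \<le> (1 + T) powr 1" using T_pos \<alpha> by (intro powr_mono) auto
    finally show "\<tau>\<^sup>2 \<le> (1 + T) * \<tau> powr (2 - \<alpha>)" using T_pos by (simp add: mult_right_mono)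
  qed (use M_nonneg \<theta> T_pos in auto)
  also have "M * (1 + T) * \<tau> * (\<tau> powr \<theta> / \<theta>) \<le> M * (1 + T)\<^sup>2 * (\<tau> powr (2 - \<alpha>) / \<theta>)"
  proof -
    have "\<tau> * \<tau> powr \<theta> = \<tau> powr 1 * \<tau> powr \<theta>" using tau_pos by simp
    also have "\<dots> = \<tau> powr (2 - \<alpha>)" by (simp only: powr_add[symmetric]) (simp add: \<theta>_def)
    finally have "M * (1 + T) * \<tau> * (\<tau> powr \<theta> / \<theta>) = M * (1 + T) * (\<tau> powr (2 - \<alpha>) / \<theta>)"
      by (metis mult.assoc times_divide_eq_right)
    also have "\<dots> \<le> M * (1 + T)\<^sup>2 * (\<tau> powr (2 - \<alpha>) / \<theta>)"
      using M_nonneg T_pos \<theta> by (intro mult_right_mono mult_left_mono) (auto simp: power2_eq_square)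
    finally show ?thesis .
  qed
  also have "3 * M * ((1 + T) * \<tau> powr (2 - \<alpha>)) * ((1 + T) / \<theta>) + M * (1 + T)\<^sup>2 * (\<tau> powr (2 - \<alpha>) / \<theta>)
      = 4 * (1 + T)\<^sup>2 * M * \<tau> powr (2 - \<alpha>) / \<theta>"
  proof -
    have "3 * M * (U * X) * (U / \<theta>) + M * U\<^sup>2 * (X / \<theta>) = 4 * U\<^sup>2 * M * X / \<theta>" for U X
      using \<theta>(1) by (simp add: power2_eq_square field_simps)
    then show ?thesis .
  qed
  finally have main: "\<bar>integral {0..t} (\<lambda>s. K s * w 1 s) - \<tau> powr \<theta> / \<theta> * ?S\<bar>
      \<le> 4 * (1 + T)\<^sup>2 * M * \<tau> powr (2 - \<alpha>) / \<theta>"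
    by simp
  have G: "Gamma (1 - \<alpha>) > 0" "Gamma (2 - \<alpha>) = \<theta> * Gamma (1 - \<alpha>)"
    using Gamma_plus1_pos[of "1 - \<alpha>"] \<alpha> by (auto simp: \<theta>_def)
  have scaled: "1 / Gamma (1 - \<alpha>) * integral {0..t} (\<lambda>s. K s * w 1 s) - mu2 \<tau> \<alpha> * ?S
      = (integral {0..t} (\<lambda>s. K s * w 1 s) - \<tau> powr \<theta> / \<theta> * ?S) / Gamma (1 - \<alpha>)"
    by (simp add: mu2_def G(2) \<theta>_def[symmetric] diff_divide_distrib)
  have "\<bar>1 / Gamma (1 - \<alpha>) * integral {0..t} (\<lambda>s. K s * w 1 s) - mu2 \<tau> \<alpha> * ?S\<bar>
      \<le> (4 * (1 + T)\<^sup>2 * M * \<tau> powr (2 - \<alpha>) / \<theta>) / Gamma (1 - \<alpha>)"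
    unfolding scaled using divide_right_mono[OF main, of "Gamma (1 - \<alpha>)"] G(1)
    by (simp only: abs_divide abs_of_pos less_imp_le)
  also have "\<dots> = 4 * (1 + T)\<^sup>2 * M / Gamma (2 - \<alpha>) * \<tau> powr (2 - \<alpha>)"
    by (simp add: G(2))
  finally show ?thesis unfolding K_def t_def \<theta>(3) .
qed

end

section \<open>Truncation for the orders greater than one\<close>

lemma l1_sum_add: "l1_sum L (\<lambda>k. V k + W k) n = l1_sum L V n + l1_sum L W n"
  by (simp add: l1_sum_def distrib_left sum.distrib)

text \<open>Summation by parts back to the form of a quadrature rule: kernel weights times
  increments of the velocity, with \<phi> as the velocity before \<open>V 1\<close>.\<close>

lemma l1_sum_differences:
  assumes "n \<ge> 1"
  shows "l1_sum L V n - L (n - 1) * \<phi>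
    = (\<Sum>k\<in>{2..n}. L (n - k) * (V k - V (k - 1))) + L (n - 1) * (V 1 - \<phi>)"
proof -
  obtain m where m: "n = Suc m" using assms by (cases n) auto
  have "(\<Sum>k=1..m. L (Suc m - Suc k) * V (Suc k) - L (Suc m - k) * V k)
      = L (Suc m - Suc m) * V (Suc m) - L (Suc m - 1) * V 1"
    using sum_Suc_diff[of 1 m "\<lambda>k. L (Suc m - k) * V k"] by simp
  moreover have "(\<Sum>k\<in>{2..n}. L (n - k) * (V k - V (k - 1))) = (\<Sum>k=1..m. L (m - k) * (V (Suc k) - V k))"
    unfolding m numeral_2_eq_2 sum.shift_bounds_cl_Suc_ivl by simp
  moreover have "(\<Sum>k=1..m. L (Suc m - Suc k) * V (Suc k) - L (Suc m - k) * V k)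
      = (\<Sum>k=1..m. L (m - k) * (V (Suc k) - V k)) + (\<Sum>k=1..m. (L (m - k) - L (Suc m - k)) * V k)"
    unfolding sum.distrib[symmetric] by (intro sum.cong) (auto simp: algebra_simps)
  moreover have "l1_sum L V n = L 0 * V n - (\<Sum>k=1..m. (L (m - k) - L (Suc m - k)) * V k)"
    unfolding l1_sum_def m by (intro arg_cong2[where f = "(-)"] sum.cong) auto
  ultimately show ?thesis by (simp add: m algebra_simps)
qed

text \<open>The weights of the past telescope to at most \<open>L 0\<close>, so the error of
  replacing quotients by midpoint velocities does not accumulate with n.\<close>

lemma l1_sum_bound:
  assumes dec: "\<And>k. L (Suc k) \<le> L k" and nonneg: "\<And>k. 0 \<le> L k"
    and V: "\<And>k. k \<in> {1..n} \<Longrightarrow> \<bar>V k\<bar> \<le> B" and n: "n \<ge> 1"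
  shows "\<bar>l1_sum L V n\<bar> \<le> 2 * L 0 * B"
proof -
  obtain m where m: "n = Suc m" using n by (cases n) auto
  have B: "0 \<le> B" using V[of 1] n by auto
  have "l1_sum L V n = L 0 * V n - (\<Sum>k=1..m. (L (m - k) - L (Suc m - k)) * V k)"
    unfolding l1_sum_def m by (intro arg_cong2[where f = "(-)"] sum.cong) auto
  moreover have "\<bar>\<Sum>k=1..m. (L (m - k) - L (Suc m - k)) * V k\<bar> \<le> (\<Sum>k=1..m. (L (m - k) - L (Suc m - k)) * B)"
  proof (intro order_trans[OF sum_abs] sum_mono)
    fix k assume k: "k \<in> {1..m}"
    then have "0 \<le> L (m - k) - L (Suc m - k)" using dec[of "m - k"] by (auto simp: Suc_diff_le)
    then show "\<bar>(L (m - k) - L (Suc m - k)) * V k\<bar> \<le> (L (m - k) - L (Suc m - k)) * B"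
      unfolding abs_mult using V[of k] k m by (intro mult_mono) auto
  qed
  moreover have "(\<Sum>k=1..m. (L (m - k) - L (Suc m - k)) * B) = (L 0 - L m) * B"
    by (simp only: sum_distrib_right[symmetric] sum_kernel_telescope)
  moreover have "(L 0 - L m) * B \<le> L 0 * B" using B nonneg by (intro mult_right_mono) auto
  moreover have "\<bar>L 0 * V n\<bar> \<le> L 0 * B"
    unfolding abs_mult using nonneg[of 0] V[of n] n by (intro mult_mono) auto
  ultimately show ?thesis by linarith
qed

lemma a_coeff_le_1: "1 < \<gamma> \<Longrightarrow> \<gamma> < 2 \<Longrightarrow> a_coeff \<gamma> k \<le> 1"
  by (induction k) (auto intro: order_trans a_coeff_decreasing)

context time_grid
begin

text \<open>The nodes are the midpoints, so [0, \<open>mid n\<close>] consists of a half cell at 0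
  and full cells between midpoints. On full cells u_tt is replaced by the difference quotient of
  \<open>Y\<close>, the velocities at midpoints; on the half cell it is frozen at 0. The constant is
  8 = 1 + 4 + 3: half cell, full cells, and passage from \<open>Y\<close> to \<open>dq\<close>
  together with the Taylor error of \<open>Y 1\<close>.\<close>

lemma caputo2_truncation:
  assumes \<gamma>: "1 < \<gamma>" "\<gamma> < 2" and n: "n \<in> {1..N}"
  shows "\<bar>1 / Gamma (2 - \<gamma>) * integral {0..mid n} (\<lambda>s. (mid n - s) powr (1 - \<gamma>) * w 2 s)
    - mu1 \<tau> \<gamma> * (l1_sum (a_coeff \<gamma>) dq n - a_coeff \<gamma> (n - 1) * w 1 0)
    - \<tau> powr (2 - \<gamma>) / Gamma (3 - \<gamma>) * start_defect (2 - \<gamma>) n * w 2 0\<bar>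
    \<le> 8 * M / Gamma (3 - \<gamma>) * \<tau> powr (3 - \<gamma>)"
proof -
  define \<theta> where "\<theta> = 2 - \<gamma>"
  have \<theta>: "0 < \<theta>" "\<theta> < 1" "1 - \<gamma> = \<theta> - 1" using \<gamma> by (auto simp: \<theta>_def)
  define t where "t = mid n"
  define K where "K s = (t - s) powr (\<theta> - 1)" for s
  define Y where "Y k = w 1 (mid k)" for k
  let ?a = "a_coeff \<gamma>"
  have n1: "real (n - 1) = real n - 1" "n \<ge> 1" "n \<le> N" using n by auto
  have tT: "t \<in> {0..T}" unfolding t_def using n by (rule mid_in)
  have tmid: "t - mid k = (real n - real k) * \<tau>" for k by (simp add: t_def mid_def algebra_simps)
  have midmono: "mid k \<le> mid (Suc k)" "mid (Suc k) - mid k = \<tau>" for k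
    using tau_pos by (simp_all add: mid_def algebra_simps)
  have mid0: "0 \<le> mid k" if "k \<ge> 1" for k using tau_pos that by (simp add: mid_def)
  have midt: "mid k \<le> t" if "k \<le> n" for k
    using that tau_pos by (simp add: mid_def t_def)
  have cont2: "continuous_on {l..r} (w 2)" if "0 \<le> l" "r \<le> t" for l r
    using continuous[of 2] tT that by (auto intro: continuous_on_subset)
  have Kint: "(\<lambda>s. K s * w 2 s) integrable_on {l..r}" if "0 \<le> l" "l \<le> r" "r \<le> t" for l r
    unfolding K_def using that \<theta> cont2[of l r] by (intro powr_kernel_integrable) auto
  have intw: "(w 2 has_integral w 1 r - w 1 l) {l..r}" if "0 \<le> l" "l \<le> r" "r \<le> t" for l r
  proof (rule fundamental_theorem_of_calculus)
    fix s assume "s \<in> {l..r}"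
    then have "s \<in> {0..T}" using that tT by auto
    then have "(w 1 has_real_derivative w 2 s) (at s within {0..T})"
      using deriv[of 1 s] by (simp add: numeral_2_eq_2)
    moreover have "{l..r} \<subseteq> {0..T}" using that tT by auto
    ultimately have "(w 1 has_real_derivative w 2 s) (at s within {l..r})"
      by (rule DERIV_subset)
    then show "(w 1 has_vector_derivative w 2 s) (at s within {l..r})"
      by (simp add: has_real_derivative_iff_has_vector_derivative)
  qed (use that in auto)
  have split: "integral {0..t} (\<lambda>s. K s * w 2 s)
      = integral {0..mid 1} (\<lambda>s. K s * w 2 s) + (\<Sum>k\<in>{2..n}. integral {mid (k - 1)..mid k} (\<lambda>s. K s * w 2 s))"
  proof -
    have "integral {0..t} (\<lambda>s. K s * w 2 s) = integral {0..mid 1} (\<lambda>s. K s * w 2 s) + integral {mid 1..t} (\<lambda>s. K s * w 2 s)"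
      using mid0[of 1] midt[of 1] n1 tT Kint[of 0 t]
      by (intro Henstock_Kurzweil_Integration.integral_combine[symmetric]) auto
    also have "integral {mid 1..t} (\<lambda>s. K s * w 2 s) = (\<Sum>k<n-1. integral {mid (Suc k)..mid (Suc (Suc k))} (\<lambda>s. K s * w 2 s))"
    proof -
      have "Suc (n - 1) = n" using n1 by simp
      then have "integral {mid (Suc 0)..mid (Suc (n - 1))} (\<lambda>s. K s * w 2 s)
        = (\<Sum>k<n-1. integral {mid (Suc k)..mid (Suc (Suc k))} (\<lambda>s. K s * w 2 s))"
        using midmono(1) mid0[of 1] midt[of 1] n1 Kint[of "mid 1" t]
        by (intro integral_split_nodes[of "n - 1" "\<lambda>k. mid (Suc k)"]) (auto simp: t_def)
      then show ?thesis using \<open>Suc (n - 1) = n\<close> by (simp add: t_def)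
    qed
    also have "\<dots> = (\<Sum>k\<in>{2..n}. integral {mid (k - 1)..mid k} (\<lambda>s. K s * w 2 s))"
      by (rule sum.reindex_bij_witness[of _ "\<lambda>k. k - 2" "\<lambda>k. k + 2"]) (use n1 in auto)
    finally show ?thesis .
  qed
  have kint: "((t - mid (k - 1)) powr \<theta> - (t - mid k) powr \<theta>) / \<theta> = \<tau> powr \<theta> / \<theta> * ?a (n - k)"
    if "k \<in> {2..n}" for k
  proof -
    have "t - mid (k - 1) = \<tau> * (real (n - k) + 1)" "t - mid k = \<tau> * real (n - k)"
      unfolding tmid using that by (auto simp: algebra_simps)
    then show ?thesis using tau_pos
      by (simp add: powr_mult a_coeff_def \<theta>_def[symmetric] right_diff_distrib diff_divide_distrib)
  qed
  define D where "D k = integral {mid (k - 1)..mid k} (\<lambda>s. K s * (w 2 s - (Y k - Y (k - 1)) / \<tau>))" for k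
  have D: "integral {mid (k - 1)..mid k} (\<lambda>s. K s * w 2 s) = \<tau> powr (\<theta> - 1) / \<theta> * (?a (n - k) * (Y k - Y (k - 1))) + D k"
    if k: "k \<in> {2..n}" for k
  proof -
    have lr: "0 \<le> mid (k - 1)" "mid (k - 1) \<le> mid k" "mid k \<le> t"
      using k mid0[of "k - 1"] midmono(1)[of "k - 1"] midt[of k] by auto
    have "(K has_integral \<tau> powr \<theta> / \<theta> * ?a (n - k)) {mid (k - 1)..mid k}"
      using powr_kernel_integral[OF lr(2,3) \<theta>(1)] unfolding kint[OF k] K_def .
    from has_integral_diff[OF integrable_integral[OF Kint[OF lr]] has_integral_mult_left[OF this, of "(Y k - Y (k - 1)) / \<tau>"]]
    have "D k = integral {mid (k - 1)..mid k} (\<lambda>s. K s * w 2 s) - \<tau> powr \<theta> / \<theta> * ?a (n - k) * ((Y k - Y (k - 1)) / \<tau>)"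
      unfolding D_def by (intro integral_unique) (simp add: right_diff_distrib)
    moreover have "\<tau> powr (\<theta> - 1) = \<tau> powr \<theta> / \<tau>"
      using tau_pos by (simp add: powr_diff)
    ultimately show ?thesis by simp
  qed
  have gb: "\<bar>w 2 s - (Y k - Y (k - 1)) / \<tau>\<bar> \<le> 2 * M * \<tau>" if k: "k \<in> {2..n}" and s: "s \<in> {mid (k - 1)..mid k}" for k s
  proof -
    have kN: "k \<in> {1..N}" "k - 1 \<in> {1..N}" using k n1 by auto
    have d: "mid k - mid (k - 1) = \<tau>" using midmono(2)[of "k - 1"] k by simp
    have sT: "s \<in> {0..T}" using s mid_in[OF kN(1)] mid_in[OF kN(2)] by auto
    have "\<bar>Y k - Y (k - 1) - w 2 (mid (k - 1)) * \<tau>\<bar> \<le> M * \<tau>\<^sup>2"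
      using taylor1[OF mid_in[OF kN(1)] mid_in[OF kN(2)], of 1] unfolding d by (simp add: Y_def numeral_2_eq_2)
    moreover have "Y k - Y (k - 1) - w 2 (mid (k - 1)) * \<tau> = ((Y k - Y (k - 1)) / \<tau> - w 2 (mid (k - 1))) * \<tau>"
      using tau_pos by (subst left_diff_distrib) simp
    ultimately have "\<bar>(Y k - Y (k - 1)) / \<tau> - w 2 (mid (k - 1))\<bar> * \<tau> \<le> (M * \<tau>) * \<tau>"
      using tau_pos by (simp only: abs_mult) (simp add: power2_eq_square mult.assoc)
    then have "\<bar>(Y k - Y (k - 1)) / \<tau> - w 2 (mid (k - 1))\<bar> \<le> M * \<tau>"
      using tau_pos by simp
    moreover have "\<bar>w 2 s - w 2 (mid (k - 1))\<bar> \<le> M * \<bar>s - mid (k - 1)\<bar>"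
      by (rule taylor0[OF sT mid_in[OF kN(2)]]) simp
    moreover have "M * \<bar>s - mid (k - 1)\<bar> \<le> M * \<tau>"
      using s d M_nonneg by (intro mult_left_mono) auto
    ultimately show ?thesis by linarith
  qed
  have gc: "continuous_on {mid (k - 1)..mid k} (\<lambda>s. w 2 s - (Y k - Y (k - 1)) / \<tau>)" if k: "k \<in> {2..n}" for k
    using k mid0[of "k - 1"] midt[of k] by (intro continuous_intros cont2) auto
  \<comment> \<open>The error has mean zero because the quotient of \<open>Y\<close> is the exact
    mean of \<open>w 2\<close>. The bound contains an increment of the kernel instead of its
    integral, and these increments telescope to at most
    \<open>\<tau> powr (\<theta> - 1)\<close>.\<close>
  have Dinner: "\<bar>D k\<bar> \<le> 2 * M * \<tau> * \<tau> * ((t - mid k) powr (\<theta> - 1) - (t - mid (k - 1)) powr (\<theta> - 1))"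
    if k: "k \<in> {2..n-1}" for k
  proof -
    have k': "k \<in> {2..n}" using k by auto
    have lr: "0 \<le> mid (k - 1)" "mid (k - 1) \<le> mid k" "mid k < t"
      using k mid0[of "k - 1"] midmono(1)[of "k - 1"] tau_pos by (auto simp: t_def mid_def)
    have d: "mid k - mid (k - 1) = \<tau>" using midmono(2)[of "k - 1"] k by simp
    have "((\<lambda>s. (Y k - Y (k - 1)) / \<tau>) has_integral (Y k - Y (k - 1))) {mid (k - 1)..mid k}"
      using has_integral_const_real[of "(Y k - Y (k - 1)) / \<tau>" "mid (k - 1)" "mid k"] lr d tau_pos by simp
    from has_integral_diff[OF intw[OF lr(1,2) less_imp_le[OF lr(3)]] this]
    have "((\<lambda>s. w 2 s - (Y k - Y (k - 1)) / \<tau>) has_integral 0) {mid (k - 1)..mid k}"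
      by (simp add: Y_def)
    from powr_kernel_integral_bound_mean_zero[OF lr(2,3) \<theta>(1,2) gc[OF k'] gb[OF k'] this]
    show ?thesis unfolding D_def K_def d .
  qed
  \<comment> \<open>The cell ending at the singularity admits no such increment; a direct estimate
    suffices, since the kernel has mass of order \<open>\<tau> powr \<theta>\<close> there.\<close>
  have Dlast: "\<bar>D n\<bar> \<le> 2 * M * \<tau> * (\<tau> powr \<theta> / \<theta>)" if n2: "n \<ge> 2"
  proof -
    have k: "n \<in> {2..n}" using n2 by auto
    have lr: "mid (n - 1) \<le> mid n" "mid n \<le> t" using midmono(1)[of "n - 1"] n2 by (auto simp: t_def)
    have "\<bar>D n\<bar> \<le> 2 * M * \<tau> * (((t - mid (n - 1)) powr \<theta> - (t - mid n) powr \<theta>) / \<theta>)"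
      unfolding D_def K_def using powr_kernel_integral_bound[OF lr \<theta>(1) gc[OF k] gb[OF k]] .
    also have "((t - mid (n - 1)) powr \<theta> - (t - mid n) powr \<theta>) / \<theta> = \<tau> powr \<theta> / \<theta>"
      unfolding kint[OF k] by simp
    finally show ?thesis .
  qed
  have Dsum: "\<bar>\<Sum>k\<in>{2..n}. D k\<bar> \<le> 4 * M * \<tau> powr (\<theta> + 1) / \<theta>"
  proof (cases "n \<ge> 2")
    case False
    then have "{2..n} = {}" by auto
    then show ?thesis using M_nonneg \<theta> by simp
  next
    case True
    then obtain m where m: "n = Suc (Suc m)" by (metis numeral_2_eq_2 Suc_le_D Suc_le_mono)
    have sn: "(\<Sum>k\<in>{2..n}. D k) = (\<Sum>k\<in>{2..n-1}. D k) + D n"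
      using True by (simp add: m)
    have "\<bar>\<Sum>k\<in>{2..n-1}. D k\<bar> \<le> (\<Sum>k\<in>{2..n-1}. 2 * M * \<tau> * \<tau> * ((t - mid k) powr (\<theta> - 1) - (t - mid (k - 1)) powr (\<theta> - 1)))"
      by (intro order_trans[OF sum_abs] sum_mono Dinner)
    also have "\<dots> = 2 * M * \<tau> * \<tau> * (\<Sum>k\<in>{2..n-1}. (t - mid k) powr (\<theta> - 1) - (t - mid (k - 1)) powr (\<theta> - 1))"
      by (simp only: sum_distrib_left)
    also have "(\<Sum>k\<in>{2..n-1}. (t - mid k) powr (\<theta> - 1) - (t - mid (k - 1)) powr (\<theta> - 1))
        = (t - mid (n - 1)) powr (\<theta> - 1) - (t - mid 1) powr (\<theta> - 1)"
      using sum_Suc_diff[of 1 m "\<lambda>k. (t - mid k) powr (\<theta> - 1)"]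
      unfolding m numeral_2_eq_2 diff_Suc_1 sum.shift_bounds_cl_Suc_ivl by simp
    also have "2 * M * \<tau> * \<tau> * ((t - mid (n - 1)) powr (\<theta> - 1) - (t - mid 1) powr (\<theta> - 1)) \<le> 2 * M * \<tau> * \<tau> * \<tau> powr (\<theta> - 1)"
    proof (intro mult_left_mono)
      have "t - mid (n - 1) = \<tau>" unfolding tmid using n1 by simp
      then show "(t - mid (n - 1)) powr (\<theta> - 1) - (t - mid 1) powr (\<theta> - 1) \<le> \<tau> powr (\<theta> - 1)" by simp
    qed (use M_nonneg tau_pos in auto)
    also have "2 * M * \<tau> * \<tau> * \<tau> powr (\<theta> - 1) = 2 * M * \<tau> powr (\<theta> + 1)"
      using tau_pos by (simp add: powr_diff powr_add)
    also have "\<dots> \<le> 2 * M * \<tau> powr (\<theta> + 1) / \<theta>"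
      using M_nonneg \<theta> by (simp add: pos_le_divide_eq mult_left_le)
    finally have "\<bar>\<Sum>k\<in>{2..n-1}. D k\<bar> \<le> 2 * M * \<tau> powr (\<theta> + 1) / \<theta>" .
    moreover have "\<bar>D n\<bar> \<le> 2 * M * \<tau> powr (\<theta> + 1) / \<theta>"
      using Dlast[OF True] tau_pos by (simp add: powr_add mult_ac)
    moreover have "2 * M * \<tau> powr (\<theta> + 1) / \<theta> + 2 * M * \<tau> powr (\<theta> + 1) / \<theta> = 4 * M * \<tau> powr (\<theta> + 1) / \<theta>"
      by simp
    ultimately show ?thesis unfolding sn by linarith
  qed
  define R where "R = integral {0..mid 1} (\<lambda>s. K s * (w 2 s - w 2 0))"
  define h where "h = (real n - 1/2) powr \<theta> - (real n - 1) powr \<theta>"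
  have h: "0 \<le> h" "h \<le> 1"
  proof -
    show "0 \<le> h" unfolding h_def using n1 \<theta> by (auto intro!: powr_mono2)
    have "(real n - 1/2) powr \<theta> \<le> (real (n - 1) + 1) powr \<theta>"
      using n1 \<theta> by (intro powr_mono2) auto
    then have "h \<le> ?a (n - 1)" unfolding h_def a_coeff_def \<theta>_def[symmetric] n1(1) by linarith
    then show "h \<le> 1" using a_coeff_le_1[OF \<gamma>, of "n - 1"] by linarith
  qed
  have a1: "0 \<le> ?a (n - 1)" "?a (n - 1) \<le> 1"
    using a_coeff_nonneg[OF \<gamma>(2)] a_coeff_le_1[OF \<gamma>] by auto
  have first_cell: "integral {0..mid 1} (\<lambda>s. K s * w 2 s) = w 2 0 * (\<tau> powr \<theta> / \<theta> * h) + R \<and> \<bar>R\<bar> \<le> M * \<tau> powr (\<theta> + 1) / \<theta>"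
  proof -
    have lr: "0 \<le> mid 1" "mid 1 \<le> t" using mid0[of 1] midt[of 1] n1 by auto
    have eq: "((t - 0) powr \<theta> - (t - mid 1) powr \<theta>) / \<theta> = \<tau> powr \<theta> / \<theta> * h"
    proof -
      have "t - 0 = \<tau> * (real n - 1/2)" "t - mid 1 = \<tau> * (real n - 1)"
        unfolding tmid by (simp_all add: t_def mid_def)
      moreover have "(\<tau> * (real n - 1/2)) powr \<theta> = \<tau> powr \<theta> * (real n - 1/2) powr \<theta>"
        "(\<tau> * (real n - 1)) powr \<theta> = \<tau> powr \<theta> * (real n - 1) powr \<theta>"
        using tau_pos n1 by (intro powr_mult; simp)+
      ultimately show ?thesis
        by (simp only: h_def right_diff_distrib diff_divide_distrib times_divide_eq_left)
    qed
    have I0: "(K has_integral \<tau> powr \<theta> / \<theta> * h) {0..mid 1}"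
      using powr_kernel_integral[OF lr \<theta>(1)] unfolding eq K_def .
    have "R = integral {0..mid 1} (\<lambda>s. K s * w 2 s) - \<tau> powr \<theta> / \<theta> * h * w 2 0"
      using has_integral_diff[OF integrable_integral[OF Kint[OF order_refl lr]] has_integral_mult_left[OF I0, of "w 2 0"]]
      unfolding R_def by (intro integral_unique) (simp add: right_diff_distrib)
    moreover have "\<bar>R\<bar> \<le> (M * \<tau>) * (((t - 0) powr \<theta> - (t - mid 1) powr \<theta>) / \<theta>)"
      unfolding R_def K_def
    proof (rule powr_kernel_integral_bound[OF lr \<theta>(1)])
      show "continuous_on {0..mid 1} (\<lambda>s. w 2 s - w 2 0)"
        using lr by (intro continuous_intros cont2) auto
      fix s assume s: "s \<in> {0..mid 1}"
      have "\<bar>w 2 s - w 2 0\<bar> \<le> M * \<bar>s - 0\<bar>"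
        by (rule taylor0) (use s lr tT T_pos in auto)
      also have "\<dots> \<le> M * \<tau>" using s M_nonneg tau_pos by (intro mult_left_mono) (auto simp: mid_def)
      finally show "\<bar>w 2 s - w 2 0\<bar> \<le> M * \<tau>" .
    qed
    moreover have "(M * \<tau>) * (\<tau> powr \<theta> / \<theta> * h) \<le> (M * \<tau>) * (\<tau> powr \<theta> / \<theta> * 1)"
      using h M_nonneg tau_pos \<theta> by (intro mult_left_mono) auto
    moreover have "(M * \<tau>) * (\<tau> powr \<theta> / \<theta> * 1) = M * \<tau> powr (\<theta> + 1) / \<theta>"
      using tau_pos by (simp add: powr_add mult_ac)
    moreover have "w 2 0 * (\<tau> powr \<theta> / \<theta> * h) = \<tau> powr \<theta> / \<theta> * h * w 2 0" by (rule mult.commute)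
    ultimately show ?thesis unfolding eq by (intro conjI) linarith+
  qed
  define r where "r = Y 1 - w 1 0 - w 2 0 * (\<tau> / 2)"
  have r: "\<bar>r\<bar> \<le> M * \<tau>\<^sup>2"
  proof -
    have "mid 1 - 0 = \<tau> / 2" by (simp add: mid_def)
    moreover have "\<bar>w 1 (mid 1) - w 1 0 - w 2 0 * (mid 1 - 0)\<bar> \<le> M * (mid 1 - 0)\<^sup>2"
      using taylor1[of "mid 1" 0 1] mid_in[of 1] N_pos T_pos by (simp add: numeral_2_eq_2)
    ultimately have "\<bar>r\<bar> \<le> M * (\<tau> / 2)\<^sup>2" by (simp only: r_def Y_def)
    also have "\<dots> \<le> M * \<tau>\<^sup>2" using M_nonneg tau_pos by (intro mult_left_mono power_mono) auto
    finally show ?thesis .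
  qed
  define e where "e k = dq k - Y k" for k
  have "\<bar>l1_sum ?a e n\<bar> \<le> 2 * ?a 0 * (M * \<tau>\<^sup>2)"
    using a_coeff_decreasing[OF \<gamma>] a_coeff_nonneg[of \<gamma>] \<gamma> n1 dq_mid
    by (intro l1_sum_bound) (auto simp: e_def Y_def)
  then have e: "\<bar>l1_sum ?a e n\<bar> \<le> 2 * M * \<tau>\<^sup>2" by simp
  let ?S = "\<Sum>k\<in>{2..n}. ?a (n - k) * (Y k - Y (k - 1))"
  have "l1_sum ?a dq n = l1_sum ?a Y n + l1_sum ?a e n"
    using l1_sum_add[of ?a Y e n] by (simp add: e_def)
  moreover have "l1_sum ?a Y n - ?a (n - 1) * w 1 0 = ?S + ?a (n - 1) * (Y 1 - w 1 0)"
    using n1 by (intro l1_sum_differences) auto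
  ultimately have disc: "l1_sum ?a dq n - ?a (n - 1) * w 1 0
      = ?S + ?a (n - 1) * (w 2 0 * (\<tau> / 2)) + (?a (n - 1) * r + l1_sum ?a e n)"
    by (simp add: r_def algebra_simps)
  have cont_int: "integral {0..t} (\<lambda>s. K s * w 2 s)
      = w 2 0 * (\<tau> powr \<theta> / \<theta> * h) + R + (\<tau> powr (\<theta> - 1) / \<theta> * ?S + (\<Sum>k\<in>{2..n}. D k))"
  proof -
    have "(\<Sum>k\<in>{2..n}. integral {mid (k - 1)..mid k} (\<lambda>s. K s * w 2 s))
        = (\<Sum>k\<in>{2..n}. \<tau> powr (\<theta> - 1) / \<theta> * (?a (n - k) * (Y k - Y (k - 1))) + D k)"
      by (intro sum.cong refl D)
    also have "\<dots> = \<tau> powr (\<theta> - 1) / \<theta> * ?S + (\<Sum>k\<in>{2..n}. D k)"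
      by (simp only: sum.distrib sum_distrib_left)
    finally show ?thesis using split first_cell by simp
  qed
  \<comment> \<open>\<open>h\<close> is the exact kernel weight of the half cell and
    \<open>?a (n - 1) / 2\<close> what the scheme gives it. The difference is the part that the
    corrector has to remove.\<close>
  have sd: "h - ?a (n - 1) / 2 = start_defect \<theta> n"
    unfolding h_def a_coeff_def start_defect_def \<theta>_def[symmetric] n1 by (simp add: field_simps)
  have pw: "\<tau> powr \<theta> = \<tau> powr (\<theta> - 1) * \<tau>" "\<tau> powr (\<theta> + 1) = \<tau> powr (\<theta> - 1) * \<tau>\<^sup>2"
    using tau_pos by (simp_all add: powr_diff powr_add power2_eq_square)
  have diff_eq: "integral {0..t} (\<lambda>s. K s * w 2 s) - \<tau> powr (\<theta> - 1) / \<theta> * (l1_sum ?a dq n - ?a (n - 1) * w 1 0)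
      - \<tau> powr \<theta> / \<theta> * start_defect \<theta> n * w 2 0
      = R + (\<Sum>k\<in>{2..n}. D k) - \<tau> powr (\<theta> - 1) / \<theta> * (?a (n - 1) * r + l1_sum ?a e n)"
    unfolding disc cont_int sd[symmetric] pw(1) by (simp add: algebra_simps diff_divide_distrib add_divide_distrib)
  have "\<bar>?a (n - 1) * r + l1_sum ?a e n\<bar> \<le> 3 * M * \<tau>\<^sup>2"
  proof -
    have "\<bar>?a (n - 1) * r\<bar> \<le> 1 * (M * \<tau>\<^sup>2)"
      unfolding abs_mult using a1 r by (intro mult_mono) auto
    then show ?thesis using e by linarith
  qed
  then have "\<tau> powr (\<theta> - 1) / \<theta> * \<bar>?a (n - 1) * r + l1_sum ?a e n\<bar> \<le> \<tau> powr (\<theta> - 1) / \<theta> * (3 * M * \<tau>\<^sup>2)"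
    using \<theta> by (intro mult_left_mono) auto
  then have Q: "\<bar>\<tau> powr (\<theta> - 1) / \<theta> * (?a (n - 1) * r + l1_sum ?a e n)\<bar> \<le> 3 * M * \<tau> powr (\<theta> + 1) / \<theta>"
    unfolding abs_mult using \<theta> by (simp add: pw(2) mult_ac)
  define B where "B = M * \<tau> powr (\<theta> + 1) / \<theta>"
  have "\<bar>x + y - z\<bar> \<le> 8 * B" if "\<bar>x\<bar> \<le> B" "\<bar>y\<bar> \<le> 4 * B" "\<bar>z\<bar> \<le> 3 * B" for x y z
    using that by linarith
  moreover have "8 * M * \<tau> powr (\<theta> + 1) / \<theta> = 8 * B" "4 * M * \<tau> powr (\<theta> + 1) / \<theta> = 4 * B"
    "3 * M * \<tau> powr (\<theta> + 1) / \<theta> = 3 * B"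
    by (simp_all add: B_def)
  ultimately have main: "\<bar>integral {0..t} (\<lambda>s. K s * w 2 s) - \<tau> powr (\<theta> - 1) / \<theta> * (l1_sum ?a dq n - ?a (n - 1) * w 1 0)
      - \<tau> powr \<theta> / \<theta> * start_defect \<theta> n * w 2 0\<bar> \<le> 8 * M * \<tau> powr (\<theta> + 1) / \<theta>"
    unfolding diff_eq using Dsum conjunct2[OF first_cell] Q by (simp only: B_def[symmetric])
  have G: "Gamma \<theta> > 0" "Gamma (3 - \<gamma>) = \<theta> * Gamma \<theta>"
    using Gamma_plus1_pos[OF \<theta>(1)] Gamma_real_pos[OF \<theta>(1)] by (simp_all add: \<theta>_def)
  have scaled: "1 / Gamma (2 - \<gamma>) * integral {0..t} (\<lambda>s. K s * w 2 s)
    - mu1 \<tau> \<gamma> * (l1_sum ?a dq n - ?a (n - 1) * w 1 0)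
    - \<tau> powr (2 - \<gamma>) / Gamma (3 - \<gamma>) * start_defect (2 - \<gamma>) n * w 2 0
    = (integral {0..t} (\<lambda>s. K s * w 2 s) - \<tau> powr (\<theta> - 1) / \<theta> * (l1_sum ?a dq n - ?a (n - 1) * w 1 0)
      - \<tau> powr \<theta> / \<theta> * start_defect \<theta> n * w 2 0) / Gamma \<theta>"
    unfolding mu1_def G(2) \<theta>(3) \<theta>_def[symmetric] diff_divide_distrib by simp
  have "\<bar>1 / Gamma (2 - \<gamma>) * integral {0..t} (\<lambda>s. K s * w 2 s)
    - mu1 \<tau> \<gamma> * (l1_sum ?a dq n - ?a (n - 1) * w 1 0)
    - \<tau> powr (2 - \<gamma>) / Gamma (3 - \<gamma>) * start_defect (2 - \<gamma>) n * w 2 0\<bar>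
    \<le> (8 * M * \<tau> powr (\<theta> + 1) / \<theta>) / Gamma \<theta>"
    unfolding scaled using divide_right_mono[OF main, of "Gamma \<theta>"] G(1)
    by (simp only: abs_divide abs_of_pos less_imp_le)
  also have "\<dots> = 8 * M / Gamma (3 - \<gamma>) * \<tau> powr (3 - \<gamma>)"
    unfolding G(2) by (simp add: \<theta>_def)
  finally show ?thesis unfolding K_def t_def \<theta>(3) .
qed

end

section \<open>Consistency of the corrected solution\<close>

lemma l1_sum_scale: "l1_sum L (\<lambda>k. V k * r) n = l1_sum L V n * r"
  by (simp add: l1_sum_def left_diff_distrib sum_distrib_right mult.assoc)

text \<open>The first summand is the truncation constant with its power of \<tau> rescaled to
  \<omega>; the second is the convolution of the corrector times the bound of u_tt.\<close>

definition caputo1_constant :: "real \<Rightarrow> real \<Rightarrow> real \<Rightarrow> real \<Rightarrow> real" where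
  "caputo1_constant T M B \<alpha> = (4 * (1 + T) ^ 4 * M + 8 * B * M * (1 + T) ^ 3) / Gamma (2 - \<alpha>)"

text \<open>Only the sign and the two bounds of \<eta> are assumed; its equation enters in
  \<open>corrected_caputo2_sum\<close> alone. The values of u and of its discrete Laplacian can thus
  share one corrector.\<close>

locale corrected_grid = time_grid +
  fixes \<eta> :: "nat \<Rightarrow> real" and \<gamma>0 \<omega> B :: real
  assumes gamma0: "1 < \<gamma>0" "\<gamma>0 < 2" and omega: "0 \<le> \<omega>" "\<omega> \<le> 3 - \<gamma>0"
    and eta_nonneg: "0 \<le> \<eta> k" and B_nonneg: "0 \<le> B"
    and eta_sum: "n \<le> N \<Longrightarrow> \<tau> * (\<Sum>k=1..n. \<eta> k) \<le> B * \<tau> powr (3 - \<gamma>0)"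
    and eta_conv: "n \<le> N \<Longrightarrow> (\<Sum>k=1..n. (real (n - k) + 1) powr (1 - \<gamma>0) * \<eta> k) \<le> B * \<tau>"
begin

definition zeta :: "nat \<Rightarrow> real" where "zeta n = \<tau> * (\<Sum>k=1..n. \<eta> k)"

lemma powr_omega: "\<omega> \<le> x \<Longrightarrow> x \<le> 2 \<Longrightarrow> \<tau> powr x \<le> (1 + T)\<^sup>2 * \<tau> powr \<omega>"
  using omega tau_pos tau_le by (intro powr_le_powr_scaled) auto

lemma tau_sq_omega: "\<tau>\<^sup>2 \<le> (1 + T)\<^sup>2 * \<tau> powr \<omega>"
  using powr_omega[of 2] gamma0 omega tau_pos by simp

lemma zeta_bounds:
  assumes "n \<le> N"
  shows "0 \<le> zeta n" "zeta n \<le> B * (1 + T)\<^sup>2 * \<tau> powr \<omega>"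
proof -
  show "0 \<le> zeta n" unfolding zeta_def
    using tau_pos eta_nonneg by (intro mult_nonneg_nonneg sum_nonneg) auto
  have "zeta n \<le> B * \<tau> powr (3 - \<gamma>0)" unfolding zeta_def by (rule eta_sum[OF assms])
  also have "\<dots> \<le> B * ((1 + T)\<^sup>2 * \<tau> powr \<omega>)"
    using B_nonneg gamma0 omega by (intro mult_left_mono powr_omega) auto
  finally show "zeta n \<le> B * (1 + T)\<^sup>2 * \<tau> powr \<omega>" by (simp add: mult.assoc)
qed

text \<open>\<eta> is absent on purpose: the term b1 \<eta> belongs to the equation of the corrector
  and cancels there.\<close>

lemma corrected_dq:
  assumes "n \<in> {1..N}"
  shows "\<bar>dq n - w 1 (mid n)\<bar> \<le> M * (1 + T)\<^sup>2 * \<tau> powr \<omega>"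
  using dq_mid[OF assms] mult_left_mono[OF tau_sq_omega M_nonneg] by (simp add: mult.assoc)

lemma corrected_avg:
  assumes n: "n \<in> {1..N}"
  shows "\<bar>(w 0 (real n * \<tau>) + w 0 ((real n - 1) * \<tau>)) / 2 + (zeta n + zeta (n - 1)) / 2 * w 2 0 - w 0 (mid n)\<bar>
    \<le> M * (1 + T)\<^sup>2 * (1 + B) * \<tau> powr \<omega>"
proof -
  define X where "X = (1 + T)\<^sup>2 * \<tau> powr \<omega>"
  have "\<bar>(w 0 (real n * \<tau>) + w 0 ((real n - 1) * \<tau>)) / 2 - w 0 (mid n)\<bar> \<le> M * X"
    using avg_mid[OF n] mult_left_mono[OF tau_sq_omega M_nonneg] by (simp add: X_def)
  moreover have "\<bar>(zeta n + zeta (n - 1)) / 2 * w 2 0\<bar> \<le> (B * X) * M"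
    unfolding abs_mult
  proof (intro mult_mono)
    show "\<bar>(zeta n + zeta (n - 1)) / 2\<bar> \<le> B * X"
    proof -
      have "n \<le> N" "n - 1 \<le> N" using n by auto
      note z = this[THEN zeta_bounds(1)] this[THEN zeta_bounds(2), unfolded mult.assoc, folded X_def]
      have "\<bar>(x + y) / 2\<bar> \<le> Y" if "0 \<le> x" "0 \<le> y" "x \<le> Y" "y \<le> Y" for x y Y :: real
        using that by (auto simp: abs_le_iff)
      from this[OF z] show ?thesis .
    qed
    show "\<bar>w 2 0\<bar> \<le> M" using bound[of 2 0] T_pos by simp
    show "0 \<le> B * X" using B_nonneg by (simp add: X_def)
  qed auto
  moreover have "M * X + (B * X) * M = M * (1 + T)\<^sup>2 * (1 + B) * \<tau> powr \<omega>"
    by (simp add: X_def algebra_simps)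
  ultimately show ?thesis by linarith
qed

lemma corrected_caputo1:
  assumes \<alpha>: "0 < \<alpha>" "\<alpha> < 1" "\<omega> \<le> 2 - \<alpha>" and n: "n \<in> {1..N}"
  shows "\<bar>1 / Gamma (1 - \<alpha>) * integral {0..mid n} (\<lambda>s. (mid n - s) powr (- \<alpha>) * w 1 s)
    - mu2 \<tau> \<alpha> * (\<Sum>k=1..n. c_coeff n \<alpha> (n - k) * (dq k + \<eta> k * w 2 0))\<bar>
    \<le> caputo1_constant T M B \<alpha> * \<tau> powr \<omega>"
proof -
  let ?S = "mu2 \<tau> \<alpha> * (\<Sum>k=1..n. c_coeff n \<alpha> (n - k) * \<eta> k)"
  have G: "Gamma (2 - \<alpha>) > 0" using \<alpha> by simp
  have "mu2 \<tau> \<alpha> * (\<Sum>k=1..n. c_coeff n \<alpha> (n - k) * (dq k + \<eta> k * w 2 0))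
      = mu2 \<tau> \<alpha> * (\<Sum>k=1..n. c_coeff n \<alpha> (n - k) * dq k) + ?S * w 2 0"
    by (simp add: distrib_left sum.distrib sum_distrib_left sum_distrib_right mult.assoc)
  moreover have "\<bar>?S * w 2 0\<bar> \<le> (8 * B * (1 + T) ^ 3 / Gamma (2 - \<alpha>) * \<tau> powr \<omega>) * M"
    unfolding abs_mult
  proof (rule mult_mono)
    show "\<bar>mu2 \<tau> \<alpha>\<bar> * \<bar>\<Sum>k=1..n. c_coeff n \<alpha> (n - k) * \<eta> k\<bar> \<le> 8 * B * (1 + T) ^ 3 / Gamma (2 - \<alpha>) * \<tau> powr \<omega>"
      unfolding abs_mult[symmetric]
      by (rule corrector_convolution_bound[where N = N and \<gamma> = \<gamma>0])
        (use \<alpha> gamma0 T_pos N_pos tau n eta_nonneg eta_conv[of n] B_nonneg omega in auto)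
    show "\<bar>w 2 0\<bar> \<le> M" using bound[of 2 0] T_pos by simp
  qed (use G B_nonneg T_pos in auto)
  moreover have "\<bar>1 / Gamma (1 - \<alpha>) * integral {0..mid n} (\<lambda>s. (mid n - s) powr (- \<alpha>) * w 1 s)
      - mu2 \<tau> \<alpha> * (\<Sum>k=1..n. c_coeff n \<alpha> (n - k) * dq k)\<bar>
    \<le> 4 * (1 + T)\<^sup>2 * M / Gamma (2 - \<alpha>) * ((1 + T)\<^sup>2 * \<tau> powr \<omega>)"
    by (rule order_trans[OF caputo1_truncation[OF \<alpha>(1,2) n] mult_left_mono[OF powr_omega]])
      (use \<alpha> M_nonneg G in auto)
  moreover have "4 * (1 + T)\<^sup>2 * M / Gamma (2 - \<alpha>) * ((1 + T)\<^sup>2 * \<tau> powr \<omega>)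
      + (8 * B * (1 + T) ^ 3 / Gamma (2 - \<alpha>) * \<tau> powr \<omega>) * M
      = caputo1_constant T M B \<alpha> * \<tau> powr \<omega>"
  proof -
    have P4: "(1 + T) ^ 4 = (1 + T)\<^sup>2 * (1 + T)\<^sup>2" by (simp add: power2_eq_square power4_eq_xxxx mult.assoc)
    have "4 * P * M / g * (P * Q) + (8 * B * R / g * Q) * M = (4 * (P * P) * M + 8 * B * M * R) / g * Q"
      if "g > 0" for P Q R g
      using that by (simp add: field_simps)
    from this[OF G] show ?thesis unfolding P4 caputo1_constant_def .
  qed
  ultimately show ?thesis by linarith
qed

text \<open>All orders are taken together with the b1 term because the corrector solves the combined
  equation: that equation times \<open>w 2 0\<close> cancels all starting defects at once, leaving
  the remainders \<open>E l\<close> and the error of \<open>dq n\<close>.\<close>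

lemma corrected_caputo2_sum:
  fixes a \<gamma> :: "nat \<Rightarrow> real"
  assumes a: "\<And>l. l \<in> {1..p} \<Longrightarrow> 0 < a l" and \<gamma>: "\<And>l. l \<in> {1..p} \<Longrightarrow> 1 < \<gamma> l \<and> \<gamma> l < 2 \<and> \<omega> \<le> 3 - \<gamma> l"
    and b1: "0 < b1" and n: "n \<in> {1..N}"
    and corr: "(\<Sum>l=1..p. a l * mu1 \<tau> (\<gamma> l) * l1_sum (a_coeff (\<gamma> l)) \<eta> n) + b1 * \<eta> n
      = (\<Sum>l=1..p. a l * (\<tau> powr (2 - \<gamma> l) / Gamma (3 - \<gamma> l) * start_defect (2 - \<gamma> l) n))"
  shows "\<bar>(\<Sum>l=1..p. a l * (1 / Gamma (2 - \<gamma> l) * integral {0..mid n} (\<lambda>s. (mid n - s) powr (1 - \<gamma> l) * w 2 s)))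
      + b1 * w 1 (mid n)
      - ((\<Sum>l=1..p. a l * mu1 \<tau> (\<gamma> l) * (l1_sum (a_coeff (\<gamma> l)) (\<lambda>k. dq k + \<eta> k * w 2 0) n - a_coeff (\<gamma> l) (n - 1) * w 1 0))
      + b1 * (dq n + \<eta> n * w 2 0))\<bar>
    \<le> ((\<Sum>l=1..p. a l * (8 * M * (1 + T)\<^sup>2 / Gamma (3 - \<gamma> l))) + b1 * (M * (1 + T)\<^sup>2)) * \<tau> powr \<omega>"
proof -
  let ?A = "(\<Sum>l=1..p. a l * mu1 \<tau> (\<gamma> l) * (l1_sum (a_coeff (\<gamma> l)) (\<lambda>k. dq k + \<eta> k * w 2 0) n - a_coeff (\<gamma> l) (n - 1) * w 1 0))"
  define I where "I l = 1 / Gamma (2 - \<gamma> l) * integral {0..mid n} (\<lambda>s. (mid n - s) powr (1 - \<gamma> l) * w 2 s)" for l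
  define E where "E l = I l - mu1 \<tau> (\<gamma> l) * (l1_sum (a_coeff (\<gamma> l)) dq n - a_coeff (\<gamma> l) (n - 1) * w 1 0)
    - \<tau> powr (2 - \<gamma> l) / Gamma (3 - \<gamma> l) * start_defect (2 - \<gamma> l) n * w 2 0" for l
  have E: "\<bar>a l * E l\<bar> \<le> a l * (8 * M * (1 + T)\<^sup>2 / Gamma (3 - \<gamma> l)) * \<tau> powr \<omega>" if l: "l \<in> {1..p}" for l
  proof -
    have G: "Gamma (3 - \<gamma> l) > 0" using \<gamma>[OF l] by simp
    have "\<bar>E l\<bar> \<le> 8 * M / Gamma (3 - \<gamma> l) * \<tau> powr (3 - \<gamma> l)"
      unfolding E_def I_def by (rule caputo2_truncation) (use \<gamma>[OF l] n in auto)
    also have "\<dots> \<le> 8 * M / Gamma (3 - \<gamma> l) * ((1 + T)\<^sup>2 * \<tau> powr \<omega>)"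
      using \<gamma>[OF l] M_nonneg G by (intro mult_left_mono powr_omega) auto
    finally have "a l * \<bar>E l\<bar> \<le> a l * (8 * M / Gamma (3 - \<gamma> l) * ((1 + T)\<^sup>2 * \<tau> powr \<omega>))"
      using a[OF l] by (intro mult_left_mono) auto
    then show ?thesis using a[OF l] by (simp add: abs_mult mult_ac)
  qed
  have "?A
      = (\<Sum>l=1..p. a l * (mu1 \<tau> (\<gamma> l) * (l1_sum (a_coeff (\<gamma> l)) dq n - a_coeff (\<gamma> l) (n - 1) * w 1 0)))
      + (\<Sum>l=1..p. a l * mu1 \<tau> (\<gamma> l) * l1_sum (a_coeff (\<gamma> l)) \<eta> n) * w 2 0"
    unfolding l1_sum_add l1_sum_scale sum_distrib_right sum.distrib[symmetric]
    by (intro sum.cong refl) (simp add: algebra_simps)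
  moreover have "(\<Sum>l=1..p. a l * E l) = (\<Sum>l=1..p. a l * I l)
      - (\<Sum>l=1..p. a l * (mu1 \<tau> (\<gamma> l) * (l1_sum (a_coeff (\<gamma> l)) dq n - a_coeff (\<gamma> l) (n - 1) * w 1 0)))
      - (\<Sum>l=1..p. a l * (\<tau> powr (2 - \<gamma> l) / Gamma (3 - \<gamma> l) * start_defect (2 - \<gamma> l) n)) * w 2 0"
    unfolding E_def right_diff_distrib[of "a _"] sum_subtractf sum_distrib_right by (simp add: mult_ac)
  moreover note corr[symmetric]
  ultimately have "(\<Sum>l=1..p. a l * I l) + b1 * w 1 (mid n)
      - (?A
      + b1 * (dq n + \<eta> n * w 2 0))
      = (\<Sum>l=1..p. a l * E l) - b1 * (dq n - w 1 (mid n))"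
    by (simp only:) (simp add: algebra_simps)
  moreover have "\<bar>\<Sum>l=1..p. a l * E l\<bar> \<le> (\<Sum>l=1..p. a l * (8 * M * (1 + T)\<^sup>2 / Gamma (3 - \<gamma> l))) * \<tau> powr \<omega>"
    unfolding sum_distrib_right by (intro order_trans[OF sum_abs] sum_mono E)
  moreover have "\<bar>b1 * (dq n - w 1 (mid n))\<bar> \<le> b1 * (M * (1 + T)\<^sup>2) * \<tau> powr \<omega>"
    using mult_left_mono[OF corrected_dq[OF n], of b1] b1 by (simp add: abs_mult mult_ac)
  ultimately show ?thesis unfolding I_def distrib_right by linarith
qed

end

lemma abs_weighted_sum_le:
  fixes a E k :: "nat \<Rightarrow> real"
  assumes "\<And>l. l \<in> I \<Longrightarrow> 0 \<le> a l" "\<And>l. l \<in> I \<Longrightarrow> \<bar>E l\<bar> \<le> k l * X"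
  shows "\<bar>\<Sum>l\<in>I. a l * E l\<bar> \<le> (\<Sum>l\<in>I. a l * k l) * X"
  unfolding sum_distrib_right mult.assoc
  by (intro order_trans[OF sum_abs] sum_mono)
    (auto simp: abs_mult assms intro!: mult_left_mono)

definition consistency_constant ::
  "nat \<Rightarrow> nat \<Rightarrow> nat \<Rightarrow> (nat \<Rightarrow> real) \<Rightarrow> real \<Rightarrow> real \<Rightarrow> real \<Rightarrow> (nat \<Rightarrow> real) \<Rightarrow> (nat \<Rightarrow> real) \<Rightarrow>
   (nat \<Rightarrow> real) \<Rightarrow> (nat \<Rightarrow> real) \<Rightarrow> (nat \<Rightarrow> real) \<Rightarrow> real \<Rightarrow> real \<Rightarrow> real \<Rightarrow> real" where
  "consistency_constant p q s a b1 b2 b3 c d \<gamma> \<alpha> \<beta> T M B =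
    ((\<Sum>l=1..p. a l * (8 * M * (1 + T)\<^sup>2 / Gamma (3 - \<gamma> l))) + b1 * (M * (1 + T)\<^sup>2))
    + (\<Sum>m=1..q. c m * (caputo1_constant T M B (\<alpha> m)))
    + b2 * (M * (1 + T)\<^sup>2 * (1 + B))
    + b3 * (M * (1 + T)\<^sup>2 * (1 + B) + 1)
    + (\<Sum>r=1..s. d r * (caputo1_constant T M B (\<beta> r) + (1 + T) / Gamma (2 - \<beta> r)))"

text \<open>At a fixed grid point, \<open>wU i\<close> is the \<open>i\<close>-th time derivative of \<open>u\<close> and \<open>wL i\<close> that of its discrete
  Laplacian; \<open>\<Lambda>0\<close> and \<open>\<Lambda>1\<close> are the Laplacian and its time derivative. The difference quotients \<open>v\<close>, \<open>z\<close>
  and the means \<open>hU\<close>, \<open>hL\<close> are those of the corrected solution.\<close>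
lemma consistency:
  assumes U: "corrected_grid wU T M N \<tau> \<eta> \<gamma>0 \<omega> B" and L: "corrected_grid wL T M N \<tau> \<eta> \<gamma>0 \<omega> B"
    and a: "\<And>l. l \<in> {1..p} \<Longrightarrow> 0 < a l" and \<gamma>: "\<And>l. l \<in> {1..p} \<Longrightarrow> 1 < \<gamma> l \<and> \<gamma> l < 2 \<and> \<omega> \<le> 3 - \<gamma> l"
    and c: "\<And>m. m \<in> {1..q} \<Longrightarrow> 0 < c m" and \<alpha>: "\<And>m. m \<in> {1..q} \<Longrightarrow> 0 < \<alpha> m \<and> \<alpha> m < 1 \<and> \<omega> \<le> 2 - \<alpha> m"
    and d: "\<And>r. r \<in> {1..s} \<Longrightarrow> 0 < d r" and \<beta>: "\<And>r. r \<in> {1..s} \<Longrightarrow> 0 < \<beta> r \<and> \<beta> r < 1 \<and> \<omega> \<le> 2 - \<beta> r"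
    and b: "0 < b1" "0 < b2" "0 < b3" and n: "n \<in> {1..N}"
    and corr: "(\<Sum>l=1..p. a l * mu1 \<tau> (\<gamma> l) * l1_sum (a_coeff (\<gamma> l)) \<eta> n) + b1 * \<eta> n
      = (\<Sum>l=1..p. a l * (\<tau> powr (2 - \<gamma> l) / Gamma (3 - \<gamma> l) * start_defect (2 - \<gamma> l) n))"
    and t: "t = (real n - 1/2) * \<tau>"
    and \<Lambda>: "continuous_on {0..T} \<Lambda>1" "\<And>s. s \<in> {0..T} \<Longrightarrow> \<bar>wL 0 s - \<Lambda>0 s\<bar> \<le> \<delta>" "\<And>s. s \<in> {0..T} \<Longrightarrow> \<bar>wL 1 s - \<Lambda>1 s\<bar> \<le> \<delta>"
    and exact: "(\<Sum>l=1..p. a l * (1 / Gamma (2 - \<gamma> l) * integral {0..t} (\<lambda>s. (t - s) powr (1 - \<gamma> l) * wU 2 s)))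
      + b1 * wU 1 t
      + (\<Sum>m=1..q. c m * (1 / Gamma (1 - \<alpha> m) * integral {0..t} (\<lambda>s. (t - s) powr (- \<alpha> m) * wU 1 s)))
      + b2 * wU 0 t
      = b3 * \<Lambda>0 t
      + (\<Sum>r=1..s. d r * (1 / Gamma (1 - \<beta> r) * integral {0..t} (\<lambda>s. (t - s) powr (- \<beta> r) * \<Lambda>1 s))) + F"
    and v: "\<And>k. k \<in> {1..n} \<Longrightarrow> v k = (wU 0 (real k * \<tau>) - wU 0 ((real k - 1) * \<tau>)) / \<tau> + \<eta> k * wU 2 0"
    and z: "\<And>k. k \<in> {1..n} \<Longrightarrow> z k = (wL 0 (real k * \<tau>) - wL 0 ((real k - 1) * \<tau>)) / \<tau> + \<eta> k * wL 2 0"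
    and hU: "hU = (wU 0 (real n * \<tau>) + wU 0 ((real n - 1) * \<tau>)) / 2
      + (\<tau> * (\<Sum>k=1..n. \<eta> k) + \<tau> * (\<Sum>k=1..n-1. \<eta> k)) / 2 * wU 2 0"
    and hL: "hL = (wL 0 (real n * \<tau>) + wL 0 ((real n - 1) * \<tau>)) / 2
      + (\<tau> * (\<Sum>k=1..n. \<eta> k) + \<tau> * (\<Sum>k=1..n-1. \<eta> k)) / 2 * wL 2 0"
  shows "\<bar>((\<Sum>l=1..p. a l * mu1 \<tau> (\<gamma> l) * (l1_sum (a_coeff (\<gamma> l)) v n - a_coeff (\<gamma> l) (n - 1) * wU 1 0)) + b1 * v n
      + (\<Sum>m=1..q. c m * mu2 \<tau> (\<alpha> m) * (\<Sum>k=1..n. c_coeff n (\<alpha> m) (n - k) * v k)) + b2 * hU)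
      - (b3 * hL + (\<Sum>r=1..s. d r * mu2 \<tau> (\<beta> r) * (\<Sum>k=1..n. c_coeff n (\<beta> r) (n - k) * z k)) + F)\<bar>
    \<le> consistency_constant p q s a b1 b2 b3 c d \<gamma> \<alpha> \<beta> T M B * (\<tau> powr \<omega> + \<delta>)"
proof -
  interpret U: corrected_grid wU T M N \<tau> \<eta> \<gamma>0 \<omega> B by (rule U)
  interpret L: corrected_grid wL T M N \<tau> \<eta> \<gamma>0 \<omega> B by (rule L)
  have tmid: "U.mid n = t" "L.mid n = t" by (simp_all add: U.mid_def L.mid_def t)
  have tT: "t \<in> {0..T}" using U.mid_in[OF n] tmid by simp
  define X where "X = \<tau> powr \<omega> + \<delta>"
  have \<delta>: "0 \<le> \<delta>" using \<Lambda>(2)[OF tT] by linarith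
  have X: "\<tau> powr \<omega> \<le> X" "\<delta> \<le> X" using \<delta> by (auto simp: X_def)
  have vU: "v k = U.dq k + \<eta> k * wU 2 0" if "k \<in> {1..n}" for k using v[OF that] by (simp add: U.dq_def)
  have zL: "z k = L.dq k + \<eta> k * wL 2 0" if "k \<in> {1..n}" for k using z[OF that] by (simp add: L.dq_def)
  have hU': "hU = (wU 0 (real n * \<tau>) + wU 0 ((real n - 1) * \<tau>)) / 2 + (U.zeta n + U.zeta (n - 1)) / 2 * wU 2 0"
    by (simp add: hU U.zeta_def)
  have hL': "hL = (wL 0 (real n * \<tau>) + wL 0 ((real n - 1) * \<tau>)) / 2 + (L.zeta n + L.zeta (n - 1)) / 2 * wL 2 0"
    by (simp add: hL L.zeta_def)
  define ia where "ia l = 1 / Gamma (2 - \<gamma> l) * integral {0..t} (\<lambda>s. (t - s) powr (1 - \<gamma> l) * wU 2 s)" for l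
  define ic where "ic m = 1 / Gamma (1 - \<alpha> m) * integral {0..t} (\<lambda>s. (t - s) powr (- \<alpha> m) * wU 1 s)" for m
  define id where "id r = 1 / Gamma (1 - \<beta> r) * integral {0..t} (\<lambda>s. (t - s) powr (- \<beta> r) * \<Lambda>1 s)" for r
  define da where "da = (\<Sum>l=1..p. a l * mu1 \<tau> (\<gamma> l) * (l1_sum (a_coeff (\<gamma> l)) v n - a_coeff (\<gamma> l) (n - 1) * wU 1 0)) + b1 * v n"
  define dc where "dc m = mu2 \<tau> (\<alpha> m) * (\<Sum>k=1..n. c_coeff n (\<alpha> m) (n - k) * v k)" for m
  define dd where "dd r = mu2 \<tau> (\<beta> r) * (\<Sum>k=1..n. c_coeff n (\<beta> r) (n - k) * z k)" for r
  have lsum: "l1_sum (a_coeff (\<gamma> l)) v n = l1_sum (a_coeff (\<gamma> l)) (\<lambda>k. U.dq k + \<eta> k * wU 2 0) n" for l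
    using n by (intro l1_sum_cong vU) auto
  have Ka: "0 \<le> (\<Sum>l=1..p. a l * (8 * M * (1 + T)\<^sup>2 / Gamma (3 - \<gamma> l))) + b1 * (M * (1 + T)\<^sup>2)"
  proof (intro add_nonneg_nonneg sum_nonneg mult_nonneg_nonneg divide_nonneg_pos)
    fix l assume l: "l \<in> {1..p}"
    show "0 < Gamma (3 - \<gamma> l)" using \<gamma>[OF l] by (intro Gamma_real_pos) auto
    show "0 \<le> a l" using a[OF l] by simp
  qed (use b U.M_nonneg in auto)
  have A: "\<bar>(\<Sum>l=1..p. a l * ia l) + b1 * wU 1 t - da\<bar>
      \<le> ((\<Sum>l=1..p. a l * (8 * M * (1 + T)\<^sup>2 / Gamma (3 - \<gamma> l))) + b1 * (M * (1 + T)\<^sup>2)) * X"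
  proof -
    have "v n = U.dq n + \<eta> n * wU 2 0" using n by (intro vU) auto
    then show ?thesis
      using order_trans[OF U.corrected_caputo2_sum[OF a \<gamma> b(1) n corr] mult_left_mono[OF X(1) Ka]]
      unfolding da_def ia_def lsum tmid by simp
  qed
  have k1: "0 \<le> caputo1_constant T M B x" if "0 < x \<and> x < 1" for x
    unfolding caputo1_constant_def
    using that U.M_nonneg U.B_nonneg U.T_pos by (intro divide_nonneg_pos add_nonneg_nonneg mult_nonneg_nonneg) auto
  have Cm: "\<bar>\<Sum>m=1..q. c m * (ic m - dc m)\<bar>
      \<le> (\<Sum>m=1..q. c m * (caputo1_constant T M B (\<alpha> m))) * X"
  proof (rule abs_weighted_sum_le)
    fix m assume m: "m \<in> {1..q}"
    have "dc m = mu2 \<tau> (\<alpha> m) * (\<Sum>k=1..n. c_coeff n (\<alpha> m) (n - k) * (U.dq k + \<eta> k * wU 2 0))"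
      unfolding dc_def by (intro arg_cong2[where f = "(*)"] sum.cong refl) (simp add: vU)
    then have "\<bar>ic m - dc m\<bar> \<le> caputo1_constant T M B (\<alpha> m) * \<tau> powr \<omega>"
      using U.corrected_caputo1[of "\<alpha> m" n] \<alpha>[OF m] n unfolding ic_def tmid by simp
    also have "\<dots> \<le> caputo1_constant T M B (\<alpha> m) * X"
      using X k1[of "\<alpha> m"] \<alpha>[OF m] by (intro mult_left_mono) auto
    finally show "\<bar>ic m - dc m\<bar> \<le> caputo1_constant T M B (\<alpha> m) * X" .
  qed (use c in \<open>auto simp: less_imp_le\<close>)
  have Dr: "\<bar>\<Sum>r=1..s. d r * (id r - dd r)\<bar>
      \<le> (\<Sum>r=1..s. d r * (caputo1_constant T M B (\<beta> r) + (1 + T) / Gamma (2 - \<beta> r))) * X"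
  proof (rule abs_weighted_sum_le)
    fix r assume r: "r \<in> {1..s}"
    note \<beta>r = \<beta>[OF r]
    \<comment> \<open>\<open>iL\<close> is the Caputo derivative of the discrete Laplacian. The
      truncation result compares it with the scheme, and its distance to that of the true Laplacian
      is at most \<delta> times the mass of the kernel.\<close>
    define iL where "iL = 1 / Gamma (1 - \<beta> r) * integral {0..t} (\<lambda>s. (t - s) powr (- \<beta> r) * wL 1 s)"
    have "dd r = mu2 \<tau> (\<beta> r) * (\<Sum>k=1..n. c_coeff n (\<beta> r) (n - k) * (L.dq k + \<eta> k * wL 2 0))"
      unfolding dd_def by (intro arg_cong2[where f = "(*)"] sum.cong refl) (simp add: zL)
    then have "\<bar>iL - dd r\<bar> \<le> caputo1_constant T M B (\<beta> r) * \<tau> powr \<omega>"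
      using L.corrected_caputo1[of "\<beta> r" n] \<beta>r n unfolding iL_def tmid by simp
    also have "\<dots> \<le> caputo1_constant T M B (\<beta> r) * X"
      using X k1[of "\<beta> r"] \<beta>r by (intro mult_left_mono) auto
    finally have e1: "\<bar>iL - dd r\<bar> \<le> caputo1_constant T M B (\<beta> r) * X" .
    have G: "Gamma (1 - \<beta> r) > 0" "Gamma (2 - \<beta> r) = (1 - \<beta> r) * Gamma (1 - \<beta> r)"
      using Gamma_plus1_pos[of "1 - \<beta> r"] Gamma_real_pos[of "1 - \<beta> r"] \<beta>r by simp_all
    have cL: "continuous_on {0..t} (wL 1)" "continuous_on {0..t} \<Lambda>1"
      using L.continuous[of 1] \<Lambda>(1) tT by (auto intro: continuous_on_subset)
    have pw: "(t - s) powr (- \<beta> r) = (t - s) powr ((1 - \<beta> r) - 1)" for s by simp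
    have "\<bar>integral {0..t} (\<lambda>s. (t - s) powr ((1 - \<beta> r) - 1) * (\<Lambda>1 s - wL 1 s))\<bar>
        \<le> \<delta> * (((t - 0) powr (1 - \<beta> r) - (t - t) powr (1 - \<beta> r)) / (1 - \<beta> r))"
      using tT \<beta>r cL \<Lambda>(3) by (intro powr_kernel_integral_bound continuous_intros) (auto simp: abs_minus_commute)
    also have "\<dots> \<le> X * ((1 + T) / (1 - \<beta> r))"
    proof (intro mult_mono divide_right_mono)
      have "t powr (1 - \<beta> r) \<le> (1 + T) powr (1 - \<beta> r)" using tT \<beta>r by (intro powr_mono2) auto
      also have "\<dots> \<le> (1 + T) powr 1" using U.T_pos \<beta>r by (intro powr_mono) auto
      finally show "(t - 0) powr (1 - \<beta> r) - (t - t) powr (1 - \<beta> r) \<le> 1 + T" using U.T_pos by simp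
    qed (use X \<beta>r \<delta> tT in auto)
    finally have "\<bar>integral {0..t} (\<lambda>s. (t - s) powr ((1 - \<beta> r) - 1) * (\<Lambda>1 s - wL 1 s))\<bar> \<le> X * ((1 + T) / (1 - \<beta> r))" .
    moreover have "integral {0..t} (\<lambda>s. (t - s) powr ((1 - \<beta> r) - 1) * (\<Lambda>1 s - wL 1 s))
        = integral {0..t} (\<lambda>s. (t - s) powr ((1 - \<beta> r) - 1) * \<Lambda>1 s) - integral {0..t} (\<lambda>s. (t - s) powr ((1 - \<beta> r) - 1) * wL 1 s)"
      unfolding right_diff_distrib
      using tT \<beta>r cL by (intro Henstock_Kurzweil_Integration.integral_diff powr_kernel_integrable) auto
    ultimately have "\<bar>integral {0..t} (\<lambda>s. (t - s) powr (- \<beta> r) * \<Lambda>1 s) - integral {0..t} (\<lambda>s. (t - s) powr (- \<beta> r) * wL 1 s)\<bar>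
        \<le> X * ((1 + T) / (1 - \<beta> r))"
      unfolding pw by simp
    from divide_right_mono[OF this, of "Gamma (1 - \<beta> r)"]
    have "\<bar>id r - iL\<bar> \<le> X * ((1 + T) / (1 - \<beta> r)) / Gamma (1 - \<beta> r)"
      using G(1) unfolding id_def iL_def by (simp add: abs_divide flip: diff_divide_distrib)
    also have "\<dots> = (1 + T) / Gamma (2 - \<beta> r) * X"
      by (simp add: G(2))
    finally have "\<bar>id r - iL\<bar> \<le> (1 + T) / Gamma (2 - \<beta> r) * X" .
    with e1 show "\<bar>id r - dd r\<bar> \<le> (caputo1_constant T M B (\<beta> r) + (1 + T) / Gamma (2 - \<beta> r)) * X"
      unfolding distrib_right by linarith
  qed (use d in \<open>auto simp: less_imp_le\<close>)
  have Kavg: "0 \<le> M * (1 + T)\<^sup>2 * (1 + B)" using U.M_nonneg U.B_nonneg by simp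
  have "\<bar>hU - wU 0 t\<bar> \<le> M * (1 + T)\<^sup>2 * (1 + B) * X"
    using order_trans[OF U.corrected_avg[OF n] mult_left_mono[OF X(1) Kavg]] unfolding hU' tmid .
  from mult_left_mono[OF this, of b2] have Hu: "\<bar>b2 * (hU - wU 0 t)\<bar> \<le> b2 * (M * (1 + T)\<^sup>2 * (1 + B)) * X"
    using b by (simp add: abs_mult mult.assoc)
  have "\<bar>hL - wL 0 t\<bar> \<le> M * (1 + T)\<^sup>2 * (1 + B) * X"
    using order_trans[OF L.corrected_avg[OF n] mult_left_mono[OF X(1) Kavg]] unfolding hL' tmid .
  then have "\<bar>hL - \<Lambda>0 t\<bar> \<le> (M * (1 + T)\<^sup>2 * (1 + B) + 1) * X"
    using \<Lambda>(2)[OF tT] X(2) unfolding distrib_right by linarith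
  from mult_left_mono[OF this, of b3] have Hl: "\<bar>b3 * (hL - \<Lambda>0 t)\<bar> \<le> b3 * (M * (1 + T)\<^sup>2 * (1 + B) + 1) * X"
    using b by (simp add: abs_mult mult.assoc)
  have ex: "(\<Sum>l=1..p. a l * ia l) + b1 * wU 1 t + (\<Sum>m=1..q. c m * ic m) + b2 * wU 0 t
      = b3 * \<Lambda>0 t + (\<Sum>r=1..s. d r * id r) + F"
    using exact unfolding ia_def ic_def id_def .
  have "(da + (\<Sum>m=1..q. c m * dc m) + b2 * hU) - (b3 * hL + (\<Sum>r=1..s. d r * dd r) + F)
      = - ((\<Sum>l=1..p. a l * ia l) + b1 * wU 1 t - da) - (\<Sum>m=1..q. c m * (ic m - dc m))
        + b2 * (hU - wU 0 t) - b3 * (hL - \<Lambda>0 t) + (\<Sum>r=1..s. d r * (id r - dd r))"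
    using ex by (simp add: right_diff_distrib sum_subtractf)
  moreover have "consistency_constant p q s a b1 b2 b3 c d \<gamma> \<alpha> \<beta> T M B * X
      = ((\<Sum>l=1..p. a l * (8 * M * (1 + T)\<^sup>2 / Gamma (3 - \<gamma> l))) + b1 * (M * (1 + T)\<^sup>2)) * X
      + (\<Sum>m=1..q. c m * (caputo1_constant T M B (\<alpha> m))) * X
      + b2 * (M * (1 + T)\<^sup>2 * (1 + B)) * X
      + b3 * (M * (1 + T)\<^sup>2 * (1 + B) + 1) * X
      + (\<Sum>r=1..s. d r * (caputo1_constant T M B (\<beta> r) + (1 + T) / Gamma (2 - \<beta> r))) * X"
    unfolding consistency_constant_def distrib_right[of _ _ X] ..
  moreover have "\<bar>- x1 - x2 + x3 - x4 + x5\<bar> \<le> y1 + y2 + y3 + y4 + y5"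
    if "\<bar>x1\<bar> \<le> y1" "\<bar>x2\<bar> \<le> y2" "\<bar>x3\<bar> \<le> y3" "\<bar>x4\<bar> \<le> y4" "\<bar>x5\<bar> \<le> y5" for x1 x2 x3 x4 x5 y1 y2 y3 y4 y5 :: real
    using that by linarith
  note this[OF A Cm Hu Hl Dr]
  ultimately have "\<bar>(da + (\<Sum>m=1..q. c m * dc m) + b2 * hU) - (b3 * hL + (\<Sum>r=1..s. d r * dd r) + F)\<bar>
      \<le> consistency_constant p q s a b1 b2 b3 c d \<gamma> \<alpha> \<beta> T M B * X"
    by (simp only:)
  then show ?thesis
    unfolding da_def dc_def dd_def X_def by (simp add: mult.assoc)
qed

section \<open>Functions on the cylinder\<close>

text \<open>The second bound makes the time derivatives of the discrete Laplacian bounded uniformly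
  in the mesh, so that it can instantiate \<open>smooth_in_time\<close>.\<close>

lemma second_difference_estimates:
  fixes g :: "nat \<Rightarrow> real \<Rightarrow> real"
  assumes deriv: "\<And>i x. i < 4 \<Longrightarrow> x \<in> {0..L} \<Longrightarrow> (g i has_real_derivative g (Suc i) x) (at x within {0..L})"
    and bound: "\<And>i x. i \<le> 4 \<Longrightarrow> x \<in> {0..L} \<Longrightarrow> \<bar>g i x\<bar> \<le> M"
    and x: "x - h \<in> {0..L}" "x + h \<in> {0..L}" and h: "h > 0"
  shows "\<bar>(g 0 (x - h) - 2 * g 0 x + g 0 (x + h)) / h\<^sup>2 - g 2 x\<bar> \<le> M * h\<^sup>2"
    and "\<bar>(g 0 (x - h) - 2 * g 0 x + g 0 (x + h)) / h\<^sup>2\<bar> \<le> 2 * M"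
proof -
  have x0: "x \<in> {0..L}" using x h by auto
  have M: "0 \<le> M" using bound[of 0 x] x0 by auto
  let ?S = "g 0 (x - h) - 2 * g 0 x + g 0 (x + h)"
  have T: "\<bar>g 0 z - (\<Sum>k\<le>n. g k x * (z - x) ^ k / fact k)\<bar> \<le> M * \<bar>z - x\<bar> ^ Suc n / fact n"
    if "z \<in> {0..L}" "n < 4" for z n
    using field_Taylor[of "{0..L}" n g M x z] that x0 deriv bound by simp
  define r1 where "r1 = g 0 (x - h) - (g 0 x - g 1 x * h + g 2 x * h\<^sup>2 / 2 - g 3 x * h ^ 3 / 6)"
  define r2 where "r2 = g 0 (x + h) - (g 0 x + g 1 x * h + g 2 x * h\<^sup>2 / 2 + g 3 x * h ^ 3 / 6)"
  have "\<bar>r1\<bar> \<le> M * h ^ 4 / 6" "\<bar>r2\<bar> \<le> M * h ^ 4 / 6"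
    using T[OF x(1), of 3] T[OF x(2), of 3] h
    by (simp_all add: r1_def r2_def numeral_3_eq_3 numeral_2_eq_2 fact_numeral eval_nat_numeral)
  moreover have "?S - g 2 x * h\<^sup>2 = r1 + r2"
    by (simp add: r1_def r2_def)
  ultimately have "\<bar>?S - g 2 x * h\<^sup>2\<bar> \<le> M * h ^ 4 / 3" by linarith
  also have "\<dots> \<le> M * h\<^sup>2 * h\<^sup>2" using M h by (simp add: power4_eq_xxxx power2_eq_square mult.assoc)
  finally have "\<bar>(?S / h\<^sup>2 - g 2 x) * h\<^sup>2\<bar> \<le> M * h\<^sup>2 * h\<^sup>2"
    using h by (simp add: left_diff_distrib)
  then show "\<bar>?S / h\<^sup>2 - g 2 x\<bar> \<le> M * h\<^sup>2" using h by (simp add: abs_mult)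
  define q1 where "q1 = g 0 (x - h) - (g 0 x - g 1 x * h)"
  define q2 where "q2 = g 0 (x + h) - (g 0 x + g 1 x * h)"
  have "\<bar>q1\<bar> \<le> M * h\<^sup>2" "\<bar>q2\<bar> \<le> M * h\<^sup>2"
    using T[OF x(1), of 1] T[OF x(2), of 1] h by (simp_all add: q1_def q2_def numeral_2_eq_2)
  moreover have "?S = q1 + q2" by (simp add: q1_def q2_def)
  ultimately have "\<bar>?S\<bar> \<le> 2 * M * h\<^sup>2" by linarith
  then show "\<bar>?S / h\<^sup>2\<bar> \<le> 2 * M" using h by (simp add: abs_divide pos_divide_le_eq)
qed

text \<open>Agreement on the closed interval determines the derivative, also at the end points. This
  identifies the derivatives in the problem with the functions \<open>D\<close>.\<close>

lemma vector_derivative_within_interval_eq: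
  fixes f F :: "real \<Rightarrow> real"
  assumes "L > 0" "x \<in> {0..L}" "\<And>z. z \<in> {0..L} \<Longrightarrow> f z = F z"
    and "(F has_real_derivative F') (at x within {0..L})"
  shows "vector_derivative f (at x within {0..L}) = F'"
proof (rule vector_derivative_within_closed_interval)
  have "(F has_vector_derivative F') (at x within {0..L})"
    using assms(4) by (simp add: has_real_derivative_iff_has_vector_derivative)
  then show "(f has_vector_derivative F') (at x within {0..L})"
    using assms(2,3) by (rule has_vector_derivative_transform[rotated 2])
qed (use assms in auto)

lemma frontier_Omega:
  assumes "0 < Lx" "0 < Ly" "x \<in> {0..Lx}" "y \<in> {0..Ly}" "x = 0 \<or> x = Lx \<or> y = 0 \<or> y = Ly"
  shows "(x, y) \<in> frontier (Omega Lx Ly)"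
proof -
  have "open (Omega Lx Ly)" unfolding Omega_def by (intro open_Times) auto
  moreover have "closure (Omega Lx Ly) = {0..Lx} \<times> {0..Ly}"
    unfolding Omega_def closure_Times using assms by simp
  ultimately show ?thesis
    using assms by (auto simp: frontier_def interior_open Omega_def)
qed

locale cylinder_function =
  fixes Lx Ly T M :: real and D :: "nat \<Rightarrow> nat \<Rightarrow> nat \<Rightarrow> real \<Rightarrow> real \<Rightarrow> real \<Rightarrow> real"
  assumes L_pos: "Lx > 0" "Ly > 0" "T > 0"
    and D_x: "\<lbrakk>a < 4; b \<le> 4; c \<le> 3; x \<in> {0..Lx}; y \<in> {0..Ly}; t \<in> {0..T}\<rbrakk> \<Longrightarrow>
      ((\<lambda>x'. D a b c x' y t) has_real_derivative D (Suc a) b c x y t) (at x within {0..Lx})"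
    and D_y: "\<lbrakk>a \<le> 4; b < 4; c \<le> 3; x \<in> {0..Lx}; y \<in> {0..Ly}; t \<in> {0..T}\<rbrakk> \<Longrightarrow>
      ((\<lambda>y'. D a b c x y' t) has_real_derivative D a (Suc b) c x y t) (at y within {0..Ly})"
    and D_t: "\<lbrakk>a \<le> 4; b \<le> 4; c < 3; x \<in> {0..Lx}; y \<in> {0..Ly}; t \<in> {0..T}\<rbrakk> \<Longrightarrow>
      ((\<lambda>t'. D a b c x y t') has_real_derivative D a b (Suc c) x y t) (at t within {0..T})"
    and D_bound: "\<lbrakk>a \<le> 4; b \<le> 4; c \<le> 3; x \<in> {0..Lx}; y \<in> {0..Ly}; t \<in> {0..T}\<rbrakk> \<Longrightarrow> \<bar>D a b c x y t\<bar> \<le> M"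
begin

lemma M_nonneg: "0 \<le> M"
  using D_bound[of 0 0 0 0 0 0] L_pos by auto

text \<open>The bound is 4 M so that it is shared with the discrete Laplacian, whose time
  derivatives are bounded by 2 M for each direction.\<close>

lemma time_slice:
  assumes "x \<in> {0..Lx}" "y \<in> {0..Ly}"
  shows "smooth_in_time (\<lambda>c t. D 0 0 c x y t) T (4 * M)"
proof
  show "\<bar>D 0 0 c x y t\<bar> \<le> 4 * M" if "c \<le> 3" "t \<in> {0..T}" for c t
    using D_bound[of 0 0 c x y t] that assms M_nonneg by simp
qed (use L_pos assms in \<open>auto intro!: D_t\<close>)

definition lapl :: "real \<Rightarrow> real \<Rightarrow> nat \<Rightarrow> real \<Rightarrow> real \<Rightarrow> real \<Rightarrow> real" where
  "lapl hx hy c x y t =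
    (D 0 0 c (x - hx) y t - 2 * D 0 0 c x y t + D 0 0 c (x + hx) y t) / hx\<^sup>2
    + (D 0 0 c x (y - hy) t - 2 * D 0 0 c x y t + D 0 0 c x (y + hy) t) / hy\<^sup>2"

context
  fixes hx hy x y :: real
  assumes h: "hx > 0" "hy > 0" and x: "x - hx \<in> {0..Lx}" "x + hx \<in> {0..Lx}"
    and y: "y - hy \<in> {0..Ly}" "y + hy \<in> {0..Ly}"
begin

lemma xy_in: "x \<in> {0..Lx}" "y \<in> {0..Ly}"
  using h x y by auto

lemma lapl_estimates:
  assumes "c \<le> 3" "t \<in> {0..T}"
  shows "\<bar>lapl hx hy c x y t - (D 2 0 c x y t + D 0 2 c x y t)\<bar> \<le> M * (hx\<^sup>2 + hy\<^sup>2)"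
    and "\<bar>lapl hx hy c x y t\<bar> \<le> 4 * M"
proof -
  have X: "\<bar>(D 0 0 c (x - hx) y t - 2 * D 0 0 c x y t + D 0 0 c (x + hx) y t) / hx\<^sup>2 - D 2 0 c x y t\<bar> \<le> M * hx\<^sup>2"
    "\<bar>(D 0 0 c (x - hx) y t - 2 * D 0 0 c x y t + D 0 0 c (x + hx) y t) / hx\<^sup>2\<bar> \<le> 2 * M"
    by (rule second_difference_estimates[where g = "\<lambda>a x'. D a 0 c x' y t" and L = Lx];
        use assms xy_in x h in \<open>auto intro!: D_x D_bound\<close>)+
  have Y: "\<bar>(D 0 0 c x (y - hy) t - 2 * D 0 0 c x y t + D 0 0 c x (y + hy) t) / hy\<^sup>2 - D 0 2 c x y t\<bar> \<le> M * hy\<^sup>2"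
    "\<bar>(D 0 0 c x (y - hy) t - 2 * D 0 0 c x y t + D 0 0 c x (y + hy) t) / hy\<^sup>2\<bar> \<le> 2 * M"
    by (rule second_difference_estimates[where g = "\<lambda>b y'. D 0 b c x y' t" and L = Ly];
        use assms xy_in y h in \<open>auto intro!: D_y D_bound\<close>)+
  show "\<bar>lapl hx hy c x y t - (D 2 0 c x y t + D 0 2 c x y t)\<bar> \<le> M * (hx\<^sup>2 + hy\<^sup>2)"
    using X(1) Y(1) unfolding lapl_def distrib_left by linarith
  show "\<bar>lapl hx hy c x y t\<bar> \<le> 4 * M"
    using X(2) Y(2) unfolding lapl_def by linarith
qed

lemma lapl_time_slice: "smooth_in_time (\<lambda>c t. lapl hx hy c x y t) T (4 * M)"
proof
  fix c :: nat and t assume ct: "c < 3" "t \<in> {0..T}"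
  show "((\<lambda>t. lapl hx hy c x y t) has_real_derivative lapl hx hy (Suc c) x y t) (at t within {0..T})"
    unfolding lapl_def using ct x y xy_in h
    by (intro DERIV_add DERIV_cdivide DERIV_diff DERIV_cmult D_t) auto
qed (use L_pos in \<open>auto intro!: lapl_estimates(2)\<close>)

end

end

section \<open>Estimates of the discrete energy norm\<close>

lemma norm1_sq:
  assumes "0 \<le> hx" "0 \<le> hy" "0 \<le> b2" "0 \<le> b3"
  shows "(norm1 b2 b3 Mx My hx hy v)\<^sup>2
    = hx * hy * (b2 * grid_inner Mx My v v + b3 * grid_dirichlet Mx My hx hy v v)"
proof -
  have "0 \<le> grid_inner Mx My v v" "0 \<le> grid_dirichlet Mx My hx hy v v"
    by (auto simp: grid_inner_def grid_dirichlet_def intro!: sum_nonneg add_nonneg_nonneg)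
  then show ?thesis using assms by (simp add: norm1_eq)
qed

text \<open>Takes the place of the triangle inequality when the corrector is split off again; it
  follows termwise from (a - b)^2 \<le> 2 a^2 + 2 b^2.\<close>

lemma norm1_sq_diff_le:
  assumes "0 \<le> hx" "0 \<le> hy" "0 \<le> b2" "0 \<le> b3"
  shows "(norm1 b2 b3 Mx My hx hy (\<lambda>i j. v i j - w i j))\<^sup>2
    \<le> 2 * (norm1 b2 b3 Mx My hx hy v)\<^sup>2 + 2 * (norm1 b2 b3 Mx My hx hy w)\<^sup>2"
proof -
  have sq: "(a - b) * (a - b) \<le> 2 * (a * a) + 2 * (b * b)" for a b :: real
    using zero_le_power2[of "a + b"] by (simp add: power2_eq_square algebra_simps)
  let ?z = "\<lambda>i j. v i j - w i j"
  have nx: "nabla_x hx ?z i j = nabla_x hx v i j - nabla_x hx w i j"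
    and ny: "nabla_y hy ?z i j = nabla_y hy v i j - nabla_y hy w i j" for i j
    by (simp_all add: nabla_x_def nabla_y_def diff_divide_distrib)
  have "grid_inner Mx My ?z ?z \<le> 2 * grid_inner Mx My v v + 2 * grid_inner Mx My w w"
    unfolding grid_inner_def sum_distrib_left sum.distrib[symmetric] by (intro sum_mono sq)
  moreover have "grid_dirichlet Mx My hx hy ?z ?z
      \<le> 2 * grid_dirichlet Mx My hx hy v v + 2 * grid_dirichlet Mx My hx hy w w"
  proof -
    have "(\<Sum>x\<in>X. (f x - g x) * (f x - g x)) \<le> 2 * (\<Sum>x\<in>X. f x * f x) + 2 * (\<Sum>x\<in>X. g x * g x)"
      for X :: "(nat \<times> nat) set" and f g :: "nat \<times> nat \<Rightarrow> real"
      unfolding sum_distrib_left sum.distrib[symmetric] by (intro sum_mono sq)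
    note this[of "\<lambda>x. nabla_x hx v (fst x) (snd x)" "\<lambda>x. nabla_x hx w (fst x) (snd x)" "{1..Mx} \<times> {1..My}"]
      this[of "\<lambda>x. nabla_y hy v (fst x) (snd x)" "\<lambda>x. nabla_y hy w (fst x) (snd x)" "{1..Mx} \<times> {1..My}"]
    then show ?thesis unfolding grid_dirichlet_def nx ny distrib_left by linarith
  qed
  ultimately have "b2 * grid_inner Mx My ?z ?z + b3 * grid_dirichlet Mx My hx hy ?z ?z
      \<le> b2 * (2 * grid_inner Mx My v v + 2 * grid_inner Mx My w w)
        + b3 * (2 * grid_dirichlet Mx My hx hy v v + 2 * grid_dirichlet Mx My hx hy w w)"
    using assms by (intro add_mono mult_left_mono) auto
  then have "hx * hy * (b2 * grid_inner Mx My ?z ?z + b3 * grid_dirichlet Mx My hx hy ?z ?z)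
      \<le> hx * hy * (b2 * (2 * grid_inner Mx My v v + 2 * grid_inner Mx My w w)
        + b3 * (2 * grid_dirichlet Mx My hx hy v v + 2 * grid_dirichlet Mx My hx hy w w))"
    using assms by (intro mult_left_mono) auto
  also have "\<dots> = 2 * (hx * hy * (b2 * grid_inner Mx My v v + b3 * grid_dirichlet Mx My hx hy v v))
      + 2 * (hx * hy * (b2 * grid_inner Mx My w w + b3 * grid_dirichlet Mx My hx hy w w))"
    by (simp only: distrib_left mult.left_commute[of _ 2])
  finally show ?thesis unfolding norm1_sq[OF assms] .
qed

lemma norm1_sq_le:
  assumes h: "0 \<le> hx" "0 \<le> hy" "0 \<le> b2" "0 \<le> b3" and G: "0 \<le> G"
    and v: "\<And>i j. i \<in> {1..Mx} \<Longrightarrow> j \<in> {1..My} \<Longrightarrow> \<bar>v i j\<bar> \<le> G"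
      "\<And>i j. i \<in> {1..Mx} \<Longrightarrow> j \<in> {1..My} \<Longrightarrow> \<bar>nabla_x hx v i j\<bar> \<le> G"
      "\<And>i j. i \<in> {1..Mx} \<Longrightarrow> j \<in> {1..My} \<Longrightarrow> \<bar>nabla_y hy v i j\<bar> \<le> G"
  shows "(norm1 b2 b3 Mx My hx hy v)\<^sup>2 \<le> (real Mx * hx) * (real My * hy) * ((b2 + 2 * b3) * G\<^sup>2)"
proof -
  have sq: "a * a \<le> G\<^sup>2" if "\<bar>a\<bar> \<le> G" for a
    using power_mono[OF that, of 2] by (simp add: power2_eq_square)
  have card: "real (card ({1..Mx-1} \<times> {1..My-1})) \<le> real Mx * real My"
    unfolding card_cartesian_product of_nat_mult by (intro mult_mono) auto
  have "grid_inner Mx My v v \<le> (\<Sum>x\<in>{1..Mx-1} \<times> {1..My-1}. G\<^sup>2)"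
    unfolding grid_inner_def by (intro sum_mono sq v) auto
  also have "\<dots> \<le> real Mx * real My * G\<^sup>2"
    using card by (simp add: mult_right_mono)
  finally have ip: "grid_inner Mx My v v \<le> real Mx * real My * G\<^sup>2" .
  have "grid_dirichlet Mx My hx hy v v \<le> (\<Sum>x\<in>{1..Mx} \<times> {1..My}. G\<^sup>2) + (\<Sum>x\<in>{1..Mx} \<times> {1..My}. G\<^sup>2)"
    unfolding grid_dirichlet_def by (intro add_mono sum_mono sq v) auto
  then have dp: "grid_dirichlet Mx My hx hy v v \<le> 2 * (real Mx * real My * G\<^sup>2)" by simp
  have "hx * hy * (b2 * grid_inner Mx My v v + b3 * grid_dirichlet Mx My hx hy v v)
      \<le> hx * hy * (b2 * (real Mx * real My * G\<^sup>2) + b3 * (2 * (real Mx * real My * G\<^sup>2)))"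
    using h ip dp by (intro mult_left_mono add_mono) auto
  then show ?thesis unfolding norm1_sq[OF h] by (simp add: algebra_simps)
qed

text \<open>Finitely many derivatives, each continuous on the compact cylinder, have a common bound
  \<open>M\<close>.\<close>

lemma C443_cylinder_function:
  assumes "C443 Lx Ly T u" "Lx > 0" "Ly > 0" "T > 0"
  obtains D M where "cylinder_function Lx Ly T M D"
    "\<And>x y t. x \<in> {0..Lx} \<Longrightarrow> y \<in> {0..Ly} \<Longrightarrow> t \<in> {0..T} \<Longrightarrow> D 0 0 0 x y t = u x y t"
proof -
  obtain D where D0: "\<forall>x\<in>{0..Lx}. \<forall>y\<in>{0..Ly}. \<forall>t\<in>{0..T}. D 0 0 0 x y t = u x y t"
    and D: "\<forall>a\<le>4. \<forall>b\<le>4. \<forall>c\<le>3.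
        continuous_on ({0..Lx} \<times> {0..Ly} \<times> {0..T}) (\<lambda>(x, y, t). D a b c x y t) \<and>
        (\<forall>x\<in>{0..Lx}. \<forall>y\<in>{0..Ly}. \<forall>t\<in>{0..T}.
          (a < 4 \<longrightarrow>
            ((\<lambda>x'. D a b c x' y t) has_real_derivative D (Suc a) b c x y t) (at x within {0..Lx})) \<and>
          (b < 4 \<longrightarrow>
            ((\<lambda>y'. D a b c x y' t) has_real_derivative D a (Suc b) c x y t) (at y within {0..Ly})) \<and>
          (c < 3 \<longrightarrow>
            ((\<lambda>t'. D a b c x y t') has_real_derivative D a b (Suc c) x y t) (at t within {0..T})))"
    using assms(1) unfolding C443_def by (elim exE conjE) blast
  let ?box = "{0..Lx} \<times> {0..Ly} \<times> {0..T}"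
  let ?I = "{..4::nat} \<times> {..4::nat} \<times> {..3::nat}"
  let ?S = "\<Union>(a, b, c)\<in>?I. (\<lambda>(x, y, t). D a b c x y t) ` ?box"
  have "bounded ?S"
  proof (intro bounded_UN ballI)
    fix p assume "p \<in> ?I"
    then obtain a b c where p: "p = (a, b, c)" "a \<le> 4" "b \<le> 4" "c \<le> 3" by auto
    have "compact ?box" by (intro compact_Times compact_Icc)
    moreover have "continuous_on ?box (\<lambda>(x, y, t). D a b c x y t)" using D p by blast
    ultimately have "compact ((\<lambda>(x, y, t). D a b c x y t) ` ?box)"
      by (intro compact_continuous_image)
    then show "bounded (case p of (a, b, c) \<Rightarrow> (\<lambda>(x, y, t). D a b c x y t) ` ?box)"
      using p by (simp add: compact_imp_bounded)
  qed auto
  then obtain M where M: "\<forall>z\<in>?S. norm z \<le> M" unfolding bounded_iff ..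
  have "cylinder_function Lx Ly T M D"
  proof
    fix a b c :: nat and x y t :: real
    assume abc: "a \<le> 4" "b \<le> 4" "c \<le> 3" "x \<in> {0..Lx}" "y \<in> {0..Ly}" "t \<in> {0..T}"
    have "D a b c x y t \<in> ?S"
      using abc by (intro UN_I[of "(a, b, c)"]) (auto intro!: image_eqI[of _ _ "(x, y, t)"])
    from bspec[OF M this] show "\<bar>D a b c x y t\<bar> \<le> M" by simp
  qed (use assms D in auto)
  then show ?thesis using that D0 by blast
qed

section \<open>The error estimate\<close>

context cylinder_function
begin

context
  fixes u :: "real \<Rightarrow> real \<Rightarrow> real \<Rightarrow> real"
  assumes u: "\<And>x y t. x \<in> {0..Lx} \<Longrightarrow> y \<in> {0..Ly} \<Longrightarrow> t \<in> {0..T} \<Longrightarrow> D 0 0 0 x y t = u x y t"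
begin

context
  fixes x y :: real
  assumes xy: "x \<in> {0..Lx}" "y \<in> {0..Ly}"
begin

lemma Dt_u: "t \<in> {0..T} \<Longrightarrow> Dt T u x y t = D 0 0 1 x y t"
  unfolding Dt_def
  by (rule vector_derivative_within_interval_eq[where F = "D 0 0 0 x y"])
    (use L_pos xy u D_t[of 0 0 0] in auto)

lemma Dtt_u: "t \<in> {0..T} \<Longrightarrow> Dt T (Dt T u) x y t = D 0 0 2 x y t"
  unfolding Dt_def[of T "Dt T u"]
  by (rule vector_derivative_within_interval_eq[where F = "D 0 0 1 x y"])
    (use L_pos xy Dt_u D_t[of 0 0 1] in \<open>auto simp: numeral_2_eq_2\<close>)

end

lemma Dx_u: "x \<in> {0..Lx} \<Longrightarrow> y \<in> {0..Ly} \<Longrightarrow> t \<in> {0..T} \<Longrightarrow> Dx Lx u x y t = D 1 0 0 x y t"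
  unfolding Dx_def
  by (rule vector_derivative_within_interval_eq[where F = "\<lambda>x. D 0 0 0 x y t"])
    (use L_pos u D_x[of 0 0 0] in auto)

lemma Dy_u: "x \<in> {0..Lx} \<Longrightarrow> y \<in> {0..Ly} \<Longrightarrow> t \<in> {0..T} \<Longrightarrow> Dy Ly u x y t = D 0 1 0 x y t"
  unfolding Dy_def
  by (rule vector_derivative_within_interval_eq[where F = "\<lambda>y. D 0 0 0 x y t"])
    (use L_pos u D_y[of 0 0 0] in auto)

lemma laplacian_u:
  assumes "x \<in> {0..Lx}" "y \<in> {0..Ly}" "t \<in> {0..T}"
  shows "laplacian Lx Ly u x y t = D 2 0 0 x y t + D 0 2 0 x y t"
proof -
  have "Dx Lx (Dx Lx u) x y t = D 2 0 0 x y t"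
    unfolding Dx_def[of Lx "Dx Lx u"]
    by (rule vector_derivative_within_interval_eq[where F = "\<lambda>x. D 1 0 0 x y t"])
      (use L_pos assms Dx_u D_x[of 1 0 0] in \<open>auto simp: numeral_2_eq_2\<close>)
  moreover have "Dy Ly (Dy Ly u) x y t = D 0 2 0 x y t"
    unfolding Dy_def[of Ly "Dy Ly u"]
    by (rule vector_derivative_within_interval_eq[where F = "\<lambda>y. D 0 1 0 x y t"])
      (use L_pos assms Dy_u D_y[of 0 1 0] in \<open>auto simp: numeral_2_eq_2\<close>)
  ultimately show ?thesis by (simp add: laplacian_def)
qed

lemma Dt_laplacian_u:
  assumes "x \<in> {0..Lx}" "y \<in> {0..Ly}" "t \<in> {0..T}"
  shows "Dt T (laplacian Lx Ly u) x y t = D 2 0 1 x y t + D 0 2 1 x y t"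
  unfolding Dt_def
proof (rule vector_derivative_within_interval_eq[where F = "\<lambda>t. D 2 0 0 x y t + D 0 2 0 x y t"])
  show "((\<lambda>t. D 2 0 0 x y t + D 0 2 0 x y t) has_real_derivative D 2 0 1 x y t + D 0 2 1 x y t) (at t within {0..T})"
    using D_t[of 2 0 0 x y t] D_t[of 0 2 0 x y t] assms by (intro DERIV_add) auto
qed (use L_pos assms laplacian_u in auto)

lemma exact_equation:
  assumes P: "solves_P p q s a b1 b2 b3 c d \<gamma> \<alpha> \<beta> T Lx Ly f \<phi>0 \<phi>1 u"
    and xy: "x \<in> {0<..<Lx}" "y \<in> {0<..<Ly}" and t: "t \<in> {0<..T}"
  shows "(\<Sum>l=1..p. a l * (1 / Gamma (2 - \<gamma> l) * integral {0..t} (\<lambda>s. (t - s) powr (1 - \<gamma> l) * D 0 0 2 x y s)))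
      + b1 * D 0 0 1 x y t
      + (\<Sum>m=1..q. c m * (1 / Gamma (1 - \<alpha> m) * integral {0..t} (\<lambda>s. (t - s) powr (- \<alpha> m) * D 0 0 1 x y s)))
      + b2 * D 0 0 0 x y t
      = b3 * (D 2 0 0 x y t + D 0 2 0 x y t)
      + (\<Sum>r=1..s. d r * (1 / Gamma (1 - \<beta> r) *
          integral {0..t} (\<lambda>s. (t - s) powr (- \<beta> r) * (D 2 0 1 x y s + D 0 2 1 x y s)))) + f x y t"
proof -
  have cl: "x \<in> {0..Lx}" "y \<in> {0..Ly}" "t \<in> {0..T}" using xy t by auto
  have sub: "s \<in> {0..T}" if "s \<in> {0..t}" for s using that t by auto
  have "(x, y) \<in> Omega Lx Ly" using xy by (simp add: Omega_def)
  then have "(\<Sum>l=1..p. a l * caputo2 T (\<gamma> l) u x y t) + b1 * Dt T u x y t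
        + (\<Sum>m=1..q. c m * caputo1 T (\<alpha> m) u x y t) + b2 * u x y t
      = b3 * laplacian Lx Ly u x y t
        + (\<Sum>r=1..s. d r * caputo1 T (\<beta> r) (laplacian Lx Ly u) x y t) + f x y t"
    using P t unfolding solves_P_def by blast
  moreover have "caputo2 T g u x y t = 1 / Gamma (2 - g) * integral {0..t} (\<lambda>s. (t - s) powr (1 - g) * D 0 0 2 x y s)" for g
    unfolding caputo2_def using Dtt_u[OF cl(1,2) sub]
    by (intro arg_cong2[where f = "(*)"] refl Henstock_Kurzweil_Integration.integral_cong) auto
  moreover have "caputo1 T g u x y t = 1 / Gamma (1 - g) * integral {0..t} (\<lambda>s. (t - s) powr (- g) * D 0 0 1 x y s)" for g
    unfolding caputo1_def using Dt_u[OF cl(1,2) sub]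
    by (intro arg_cong2[where f = "(*)"] refl Henstock_Kurzweil_Integration.integral_cong) auto
  moreover have "caputo1 T g (laplacian Lx Ly u) x y t
      = 1 / Gamma (1 - g) * integral {0..t} (\<lambda>s. (t - s) powr (- g) * (D 2 0 1 x y s + D 0 2 1 x y s))" for g
    unfolding caputo1_def using Dt_laplacian_u[OF cl(1,2) sub]
    by (intro arg_cong2[where f = "(*)"] refl Henstock_Kurzweil_Integration.integral_cong) auto
  ultimately show ?thesis
    using laplacian_u[OF cl] Dt_u[OF cl] u[OF cl] by simp
qed

text \<open>Ensures that the added multiple of u_tt(x,y,0) vanishes on the boundary, so that the
  corrected solution has zero boundary values on the grid.\<close>

lemma boundary_zero:
  assumes xy: "x \<in> {0..Lx}" "y \<in> {0..Ly}" and zero: "\<And>t. t \<in> {0..T} \<Longrightarrow> u x y t = 0"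
  shows "D 0 0 2 x y 0 = 0"
proof -
  have 1: "D 0 0 1 x y t = 0" if t: "t \<in> {0..T}" for t
  proof -
    have "vector_derivative (D 0 0 0 x y) (at t within {0..T}) = 0"
      by (rule vector_derivative_within_interval_eq[where F = "\<lambda>_. 0"]) (use L_pos xy t u zero in auto)
    moreover have "vector_derivative (D 0 0 0 x y) (at t within {0..T}) = D 0 0 1 x y t"
      by (rule vector_derivative_within_interval_eq[where F = "D 0 0 0 x y"])
        (use L_pos xy t D_t[of 0 0 0 x y t] in auto)
    ultimately show ?thesis by simp
  qed
  have "vector_derivative (D 0 0 1 x y) (at 0 within {0..T}) = 0"
    by (rule vector_derivative_within_interval_eq[where F = "\<lambda>_. 0"]) (use L_pos 1 in auto)
  moreover have "vector_derivative (D 0 0 1 x y) (at 0 within {0..T}) = D 0 0 2 x y 0"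
    by (rule vector_derivative_within_interval_eq[where F = "D 0 0 1 x y"])
      (use L_pos xy D_t[of 0 0 1 x y 0] in \<open>auto simp: numeral_2_eq_2\<close>)
  ultimately show ?thesis by simp
qed

end

text \<open>Used with c = 2: it bounds the discrete gradient of u_tt(x,y,0), hence the energy norm
  of the correction.\<close>

lemma space_lipschitz:
  assumes "x \<in> {0..Lx}" "x' \<in> {0..Lx}" "y \<in> {0..Ly}" "y' \<in> {0..Ly}" "t \<in> {0..T}" "c \<le> 3"
  shows "\<bar>D 0 0 c x y t - D 0 0 c x' y t\<bar> \<le> M * \<bar>x - x'\<bar>"
    and "\<bar>D 0 0 c x y t - D 0 0 c x y' t\<bar> \<le> M * \<bar>y - y'\<bar>"
proof -
  have "norm (D 0 0 c x y t - D 0 0 c x' y t) \<le> M * norm (x - x')"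
    by (rule field_differentiable_bound[of "{0..Lx}" "\<lambda>x. D 0 0 c x y t" "\<lambda>x. D 1 0 c x y t"])
      (use assms D_x[of 0 0 c _ y t] D_bound[of 1 0 c _ y t] in auto)
  then show "\<bar>D 0 0 c x y t - D 0 0 c x' y t\<bar> \<le> M * \<bar>x - x'\<bar>" by simp
  have "norm (D 0 0 c x y t - D 0 0 c x y' t) \<le> M * norm (y - y')"
    by (rule field_differentiable_bound[of "{0..Ly}" "\<lambda>y. D 0 0 c x y t" "\<lambda>y. D 0 1 c x y t"])
      (use assms D_y[of 0 0 c x _ t] D_bound[of 0 1 c x _ t] in auto)
  then show "\<bar>D 0 0 c x y t - D 0 0 c x y' t\<bar> \<le> M * \<bar>y - y'\<bar>" by simp
qed

end

lemma l1_sum_diff: "l1_sum L (\<lambda>k. V k - W k) n = l1_sum L V n - l1_sum L W n"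
  by (simp add: l1_sum_def right_diff_distrib sum_subtractf)

text \<open>One grid, with the corrector \<open>\<eta>\<close> given: \<open>U\<close> is compared with the solution corrected by
  \<open>\<zeta>\<^sub>n u\<^sub>t\<^sub>t(\<cdot>, 0)\<close>, where \<open>\<zeta>\<^sub>n = \<tau> (\<eta>\<^sub>1 + \<dots> + \<eta>\<^sub>n)\<close>.\<close>
lemma grid_error:
  fixes u f :: "real \<Rightarrow> real \<Rightarrow> real \<Rightarrow> real"
  assumes cyl: "cylinder_function Lx Ly T M D"
    and u: "\<And>x y t. x \<in> {0..Lx} \<Longrightarrow> y \<in> {0..Ly} \<Longrightarrow> t \<in> {0..T} \<Longrightarrow> D 0 0 0 x y t = u x y t"
    and P: "solves_P p q s a b1 b2 b3 c d \<gamma> \<alpha> \<beta> T Lx Ly f \<phi>0 \<phi>1 u"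
    and \<phi>0: "\<And>x y. (x, y) \<in> frontier (Omega Lx Ly) \<Longrightarrow> \<phi>0 x y = 0"
    and a: "\<And>l. l \<in> {1..p} \<Longrightarrow> 0 < a l" and \<gamma>: "\<And>l. l \<in> {1..p} \<Longrightarrow> 1 < \<gamma> l \<and> \<gamma> l < 2 \<and> \<omega> \<le> 3 - \<gamma> l"
    and c: "\<And>m. m \<in> {1..q} \<Longrightarrow> 0 < c m" and \<alpha>: "\<And>m. m \<in> {1..q} \<Longrightarrow> 0 < \<alpha> m \<and> \<alpha> m < 1 \<and> \<omega> \<le> 2 - \<alpha> m"
    and d: "\<And>r. r \<in> {1..s} \<Longrightarrow> 0 < d r" and \<beta>: "\<And>r. r \<in> {1..s} \<Longrightarrow> 0 < \<beta> r \<and> \<beta> r < 1 \<and> \<omega> \<le> 2 - \<beta> r"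
    and b: "0 < b1" "0 < b2" "0 < b3"
    and grid: "Mx \<ge> 2" "My \<ge> 2" "N \<ge> 1" "hx = Lx / real Mx" "hy = Ly / real My" "\<tau> = T / real N"
    and S: "solves_S p q s a b1 b2 b3 c d \<gamma> \<alpha> \<beta> T Lx Ly f \<phi>0 \<phi>1 Mx My N U"
    and gamma0: "1 < \<gamma>0" "\<gamma>0 < 2" and omega: "0 \<le> \<omega>" "\<omega> \<le> 3 - \<gamma>0"
    and B: "0 \<le> B" and corrector: "is_corrector p a \<gamma> b1 \<gamma>0 B N \<tau> \<eta>"
    and K: "K = \<bar>consistency_constant p q s a b1 b2 b3 c d \<gamma> \<alpha> \<beta> T (4 * M) B\<bar> * (1 + M)"
    and Y: "Y = \<tau> powr \<omega> + hx\<^sup>2 + hy\<^sup>2"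
    and n: "n \<in> {1..N}"
  shows "(norm1 b2 b3 Mx My hx hy (\<lambda>i j. u (real i * hx) (real j * hy) (real n * \<tau>) - U n i j))\<^sup>2
    \<le> (T * Lx * Ly * K\<^sup>2 / b1 + 2 * (b2 + 2 * b3) * (B * (1 + T)\<^sup>2 * M)\<^sup>2 * Lx * Ly) * Y\<^sup>2"
proof -
  interpret cylinder_function Lx Ly T M D by (rule cyl)
  have \<eta>: "\<And>k. 0 \<le> \<eta> k"
    and \<eta>_sum: "\<And>n. n \<le> N \<Longrightarrow> \<tau> * (\<Sum>k=1..n. \<eta> k) \<le> B * \<tau> powr (3 - \<gamma>0)"
    and \<eta>_conv: "\<And>n. n \<le> N \<Longrightarrow> (\<Sum>k=1..n. (real (n - k) + 1) powr (1 - \<gamma>0) * \<eta> k) \<le> B * \<tau>"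
    and corr: "\<And>n. n \<in> {1..N} \<Longrightarrow> (\<Sum>l=1..p. a l * mu1 \<tau> (\<gamma> l) * l1_sum (a_coeff (\<gamma> l)) \<eta> n) + b1 * \<eta> n
      = (\<Sum>l=1..p. a l * (\<tau> powr (2 - \<gamma> l) / Gamma (3 - \<gamma> l) * start_defect (2 - \<gamma> l) n))"
    using corrector unfolding is_corrector_def by blast+
  have h: "hx > 0" "hy > 0" "\<tau> > 0" "real Mx * hx = Lx" "real My * hy = Ly" "real N * \<tau> = T"
    using grid L_pos by auto
  define X where "X i = real i * hx" for i
  define Z where "Z j = real j * hy" for j
  define g where "g x y = D 0 0 2 x y 0" for x y
  define \<zeta> where "\<zeta> n = \<tau> * (\<Sum>k=1..n. \<eta> k)" for n
  define W where "W n i j = u (X i) (Z j) (real n * \<tau>) + \<zeta> n * g (X i) (Z j)" for n i j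
  define E where "E n i j = W n i j - U n i j" for n i j
  define \<delta> where "\<delta> = M * (hx\<^sup>2 + hy\<^sup>2)"
  define R where "R = K * Y"
  have Xin: "X i \<in> {0..Lx}" if "i \<le> Mx" for i
    using that h mult_right_mono[of "real i" "real Mx" hx] by (simp add: X_def)
  have Zin: "Z j \<in> {0..Ly}" if "j \<le> My" for j
    using that h mult_right_mono[of "real j" "real My" hy] by (simp add: Z_def)
  have Tin: "real k * \<tau> \<in> {0..T}" if "k \<le> N" for k
    using that h mult_right_mono[of "real k" "real N" \<tau>] by simp
  have Xint: "X i \<in> {0<..<Lx}" "X i - hx = X (i - 1)" "X i + hx = X (i + 1)" if "i \<in> {1..Mx-1}" for i
  proof -
    have "real i < real Mx" using that by auto
    then show "X i \<in> {0<..<Lx}" using that h mult_strict_right_mono[of "real i" "real Mx" hx] by (simp add: X_def)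
  qed (use that in \<open>auto simp: X_def algebra_simps of_nat_diff\<close>)
  have Zint: "Z j \<in> {0<..<Ly}" "Z j - hy = Z (j - 1)" "Z j + hy = Z (j + 1)" if "j \<in> {1..My-1}" for j
  proof -
    have "real j < real My" using that by auto
    then show "Z j \<in> {0<..<Ly}" using that h mult_strict_right_mono[of "real j" "real My" hy] by (simp add: Z_def)
  qed (use that in \<open>auto simp: Z_def algebra_simps of_nat_diff\<close>)
  have bdry: "(X i, Z j) \<in> frontier (Omega Lx Ly)"
    if "i \<le> Mx" "j \<le> My" "i = 0 \<or> i = Mx \<or> j = 0 \<or> j = My" for i j
    using that h L_pos Xin[OF that(1)] Zin[OF that(2)] by (intro frontier_Omega) (auto simp: X_def Z_def)
  have u_bdry: "u x y t = 0" if "(x, y) \<in> frontier (Omega Lx Ly)" "t \<in> {0..T}" for x y t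
    using P that unfolding solves_P_def by blast
  have g_bdry: "g (X i) (Z j) = 0" if "i \<le> Mx" "j \<le> My" "i = 0 \<or> i = Mx \<or> j = 0 \<or> j = My" for i j
    unfolding g_def using u_bdry[OF bdry[OF that]] Xin[OF that(1)] Zin[OF that(2)]
    by (intro boundary_zero[OF u]) auto
  have \<zeta>0: "\<zeta> 0 = 0" by (simp add: \<zeta>_def)
  have U0: "U 0 i j = \<phi>0 (X i) (Z j)" if "i \<le> Mx" "j \<le> My" for i j
    using S that unfolding solves_S_def Let_def X_def Z_def grid by blast
  have UV: "in_Vh Mx My (U n)" if "n \<in> {1..N}" for n
    using S that unfolding solves_S_def Let_def by blast
  have E0: "E 0 i j = 0" if "i \<le> Mx" "j \<le> My" for i j
  proof (cases "i = 0 \<or> i = Mx \<or> j = 0 \<or> j = My")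
    case True
    note fr = bdry[OF that True]
    show ?thesis using u_bdry[OF fr, of 0] \<phi>0[OF fr] L_pos by (simp add: E_def W_def \<zeta>0 U0[OF that])
  next
    case False
    then have "(X i, Z j) \<in> Omega Lx Ly"
      using Xint(1)[of i] Zint(1)[of j] that by (auto simp: Omega_def)
    then have "u (X i) (Z j) 0 = \<phi>0 (X i) (Z j)" using P unfolding solves_P_def by blast
    then show ?thesis by (simp add: E_def W_def \<zeta>0 U0[OF that])
  qed
  have EV: "in_Vh Mx My (E n)" if n: "n \<in> {1..N}" for n
  proof -
    have "W n i j = 0" if "i \<le> Mx" "j \<le> My" "i = 0 \<or> i = Mx \<or> j = 0 \<or> j = My" for i j
      using u_bdry[OF bdry[OF that] Tin[of n]] g_bdry[OF that] n by (simp add: W_def)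
    then show ?thesis using UV[OF n] by (simp add: in_Vh_def E_def)
  qed
  have K0: "0 \<le> K" using M_nonneg by (simp add: K)
  have Y0: "0 \<le> Y" by (simp add: Y)
  have \<zeta>_le: "0 \<le> \<zeta> n" "\<zeta> n \<le> B * (1 + T)\<^sup>2 * Y" if "n \<le> N" for n
  proof -
    \<comment> \<open>The bounds of \<zeta> do not involve the function in the locale; any grid
      point, here (0, 0), gives access to them.\<close>
    interpret time: corrected_grid "\<lambda>c t. D 0 0 c 0 0 t" T "4 * M" N \<tau> \<eta> \<gamma>0 \<omega> B
      unfolding corrected_grid_def time_grid_def time_grid_axioms_def corrected_grid_axioms_def
      using time_slice[of 0 0] L_pos grid gamma0 omega \<eta> B \<eta>_sum \<eta>_conv by auto
    show "0 \<le> \<zeta> n" using time.zeta_bounds(1)[OF that] by (simp add: \<zeta>_def time.zeta_def)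
    have "\<zeta> n \<le> B * (1 + T)\<^sup>2 * \<tau> powr \<omega>"
      using time.zeta_bounds(2)[OF that] by (simp add: \<zeta>_def time.zeta_def)
    also have "\<dots> \<le> B * (1 + T)\<^sup>2 * Y" using B by (intro mult_left_mono) (auto simp: Y)
    finally show "\<zeta> n \<le> B * (1 + T)\<^sup>2 * Y" .
  qed
  \<comment> \<open>Residual of the scheme at the corrected solution \<open>W\<close>. The initial
    velocity stays that of u, so it cancels when the scheme for \<open>U\<close> is
    subtracted.\<close>
  define FW where "FW n i j = ((\<Sum>l=1..p. a l * mu1 \<tau> (\<gamma> l) *
        (l1_sum (a_coeff (\<gamma> l)) (\<lambda>k. nabla_t \<tau> W k i j) n - a_coeff (\<gamma> l) (n - 1) * D 0 0 1 (X i) (Z j) 0))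
      + b1 * nabla_t \<tau> W n i j
      + (\<Sum>m=1..q. c m * mu2 \<tau> (\<alpha> m) * (\<Sum>k=1..n. c_coeff n (\<alpha> m) (n - k) * nabla_t \<tau> W k i j))
      + b2 * half_avg W n i j)
      - (b3 * laplacian_h hx hy (half_avg W n) i j
      + (\<Sum>r=1..s. d r * mu2 \<tau> (\<beta> r) * (\<Sum>k=1..n. c_coeff n (\<beta> r) (n - k) *
          nabla_t \<tau> (\<lambda>k'. laplacian_h hx hy (W k')) k i j))
      + f (X i) (Z j) ((real n - 1/2) * \<tau>))" for n i j
  have residual: "\<bar>FW n i j\<bar> \<le> R" if n: "n \<in> {1..N}" and i: "i \<in> {1..Mx-1}" and j: "j \<in> {1..My-1}" for n i j
  proof -
    let ?x = "X i" and ?y = "Z j" and ?t = "(real n - 1/2) * \<tau>"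
    define wU where "wU c t = D 0 0 c ?x ?y t" for c t
    define wL where "wL c t = lapl hx hy c ?x ?y t" for c t
    have ij: "i \<le> Mx" "i - 1 \<le> Mx" "i + 1 \<le> Mx" "j \<le> My" "j - 1 \<le> My" "j + 1 \<le> My" using i j by auto
    have nb: "?x - hx \<in> {0..Lx}" "?x + hx \<in> {0..Lx}" "?y - hy \<in> {0..Ly}" "?y + hy \<in> {0..Ly}"
      unfolding Xint(2,3)[OF i] Zint(2,3)[OF j] using ij by (intro Xin Zin; simp)+
    have xy: "?x \<in> {0..Lx}" "?y \<in> {0..Ly}" using Xint(1)[OF i] Zint(1)[OF j] by auto
    have "smooth_in_time wU T (4 * M)" unfolding wU_def by (rule time_slice[OF xy])
    then have cU: "corrected_grid wU T (4 * M) N \<tau> \<eta> \<gamma>0 \<omega> B"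
      unfolding corrected_grid_def time_grid_def time_grid_axioms_def corrected_grid_axioms_def
      using grid gamma0 omega \<eta> B \<eta>_sum \<eta>_conv by auto
    have "smooth_in_time wL T (4 * M)" unfolding wL_def by (rule lapl_time_slice[OF h(1,2) nb])
    then have cL: "corrected_grid wL T (4 * M) N \<tau> \<eta> \<gamma>0 \<omega> B"
      unfolding corrected_grid_def time_grid_def time_grid_axioms_def corrected_grid_axioms_def
      using grid gamma0 omega \<eta> B \<eta>_sum \<eta>_conv by auto
    have nN: "1 \<le> n" "n \<le> N" "n - 1 \<le> N" using n by auto
    have tin: "?t \<in> {0<..T}"
    proof -
      have "(real n - 1/2) * \<tau> \<le> real N * \<tau>" using nN h by (intro mult_right_mono) auto
      then show ?thesis using nN h by auto
    qed
    have uw: "u (X i') (Z j') (real k * \<tau>) = D 0 0 0 (X i') (Z j') (real k * \<tau>)"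
      if "k \<le> N" "i' \<le> Mx" "j' \<le> My" for k i' j'
      using u[OF Xin Zin Tin] that by simp
    have \<zeta>d: "(\<zeta> k - \<zeta> (k - 1)) / \<tau> = \<eta> k" if "k \<ge> 1" for k
      using that h by (cases k) (auto simp: \<zeta>_def distrib_left)
    have real_pred: "real (k - 1) = real k - 1" if "k \<ge> 1" for k using that by simp
    \<comment> \<open>The discrete Laplacian commutes with time derivatives, so the one of u_tt(.,0)
      is \<open>wL 2 0\<close>: \<open>W\<close> corrects the discrete Laplacian exactly as it
      corrects u.\<close>
    have lapW: "laplacian_h hx hy (W k) i j = wL 0 (real k * \<tau>) + \<zeta> k * wL 2 0" if "k \<le> N" for k
    proof -
      note e = uw[OF that ij(1,4)] uw[OF that ij(2,4)] uw[OF that ij(3,4)] uw[OF that ij(1,5)] uw[OF that ij(1,6)]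
      show ?thesis
        unfolding laplacian_h_def W_def wL_def lapl_def g_def Xint(2,3)[OF i] Zint(2,3)[OF j] e
        by (simp add: add_divide_distrib diff_divide_distrib algebra_simps)
    qed
    have Wn: "W k i j = wU 0 (real k * \<tau>) + \<zeta> k * wU 2 0" if "k \<le> N" for k
      using that ij by (simp add: W_def wU_def g_def uw)
    have v: "nabla_t \<tau> W k i j = (wU 0 (real k * \<tau>) - wU 0 ((real k - 1) * \<tau>)) / \<tau> + \<eta> k * wU 2 0"
      if "k \<in> {1..n}" for k
    proof -
      have kk: "k \<le> N" "k - 1 \<le> N" "k \<ge> 1" using that nN by auto
      have "nabla_t \<tau> W k i j = (wU 0 (real k * \<tau>) - wU 0 ((real k - 1) * \<tau>)) / \<tau> + (\<zeta> k - \<zeta> (k - 1)) / \<tau> * wU 2 0"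
        unfolding nabla_t_def Wn[OF kk(1)] Wn[OF kk(2)] real_pred[OF kk(3)]
        by (simp add: add_divide_distrib diff_divide_distrib left_diff_distrib)
      then show ?thesis unfolding \<zeta>d[OF kk(3)] .
    qed
    have z: "nabla_t \<tau> (\<lambda>k'. laplacian_h hx hy (W k')) k i j
        = (wL 0 (real k * \<tau>) - wL 0 ((real k - 1) * \<tau>)) / \<tau> + \<eta> k * wL 2 0" if "k \<in> {1..n}" for k
    proof -
      have kk: "k \<le> N" "k - 1 \<le> N" "k \<ge> 1" using that nN by auto
      have "nabla_t \<tau> (\<lambda>k'. laplacian_h hx hy (W k')) k i j
          = (wL 0 (real k * \<tau>) - wL 0 ((real k - 1) * \<tau>)) / \<tau> + (\<zeta> k - \<zeta> (k - 1)) / \<tau> * wL 2 0"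
        unfolding nabla_t_def lapW[OF kk(1)] lapW[OF kk(2)] real_pred[OF kk(3)]
        by (simp add: add_divide_distrib diff_divide_distrib left_diff_distrib)
      then show ?thesis unfolding \<zeta>d[OF kk(3)] .
    qed
    have hU: "half_avg W n i j = (wU 0 (real n * \<tau>) + wU 0 ((real n - 1) * \<tau>)) / 2
        + (\<tau> * (\<Sum>k=1..n. \<eta> k) + \<tau> * (\<Sum>k=1..n-1. \<eta> k)) / 2 * wU 2 0"
      unfolding half_avg_def \<zeta>_def[symmetric] Wn[OF nN(2)] Wn[OF nN(3)] real_pred[OF nN(1)]
      by (simp add: add_divide_distrib distrib_right)
    have lap_avg: "laplacian_h hx hy (half_avg W n) i j
        = (laplacian_h hx hy (W n) i j + laplacian_h hx hy (W (n - 1)) i j) / 2"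
      by (simp add: laplacian_h_def half_avg_def add_divide_distrib diff_divide_distrib)
    have hL: "laplacian_h hx hy (half_avg W n) i j = (wL 0 (real n * \<tau>) + wL 0 ((real n - 1) * \<tau>)) / 2
        + (\<tau> * (\<Sum>k=1..n. \<eta> k) + \<tau> * (\<Sum>k=1..n-1. \<eta> k)) / 2 * wL 2 0"
      unfolding lap_avg \<zeta>_def[symmetric] lapW[OF nN(2)] lapW[OF nN(3)] real_pred[OF nN(1)]
      by (simp add: add_divide_distrib distrib_right)
    have lam_cont: "continuous_on {0..T} (\<lambda>t. D 2 0 1 ?x ?y t + D 0 2 1 ?x ?y t)"
      using xy D_t[of 2 0 1 ?x ?y] D_t[of 0 2 1 ?x ?y]
      by (intro continuous_on_add DERIV_continuous_on) auto
    have lam0: "\<bar>wL 0 t - (D 2 0 0 ?x ?y t + D 0 2 0 ?x ?y t)\<bar> \<le> \<delta>" if "t \<in> {0..T}" for t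
      unfolding wL_def \<delta>_def using lapl_estimates(1)[OF h(1,2) nb _ that, of 0] by simp
    have lam1: "\<bar>wL 1 t - (D 2 0 1 ?x ?y t + D 0 2 1 ?x ?y t)\<bar> \<le> \<delta>" if "t \<in> {0..T}" for t
      unfolding wL_def \<delta>_def using lapl_estimates(1)[OF h(1,2) nb _ that, of 1] by simp
    note ex = exact_equation[OF u P Xint(1)[OF i] Zint(1)[OF j] tin, folded wU_def]
    have "\<bar>FW n i j\<bar> \<le> consistency_constant p q s a b1 b2 b3 c d \<gamma> \<alpha> \<beta> T (4 * M) B * (\<tau> powr \<omega> + \<delta>)"
      unfolding FW_def wU_def[symmetric]
      by (rule consistency[OF cU cL a \<gamma> c \<alpha> d \<beta> b n corr[OF n] refl lam_cont lam0 lam1 ex v z hU hL])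
    also have "\<dots> \<le> \<bar>consistency_constant p q s a b1 b2 b3 c d \<gamma> \<alpha> \<beta> T (4 * M) B\<bar> * ((1 + M) * Y)"
    proof (intro mult_mono)
      show "\<tau> powr \<omega> + \<delta> \<le> (1 + M) * Y"
        using M_nonneg by (simp add: \<delta>_def Y distrib_left distrib_right)
    qed (use M_nonneg in \<open>auto simp: \<delta>_def\<close>)
    finally show ?thesis by (simp add: R_def K mult.assoc)
  qed
  have scheme: "(\<Sum>l=1..p. a l * mu1 \<tau> (\<gamma> l) *
        (l1_sum (a_coeff (\<gamma> l)) (\<lambda>k. nabla_t \<tau> U k i j) n - a_coeff (\<gamma> l) (n - 1) * D 0 0 1 (X i) (Z j) 0))
      + b1 * nabla_t \<tau> U n i j
      + (\<Sum>m=1..q. c m * mu2 \<tau> (\<alpha> m) * (\<Sum>k=1..n. c_coeff n (\<alpha> m) (n - k) * nabla_t \<tau> U k i j))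
      + b2 * half_avg U n i j
      = b3 * laplacian_h hx hy (half_avg U n) i j
      + (\<Sum>r=1..s. d r * mu2 \<tau> (\<beta> r) * (\<Sum>k=1..n. c_coeff n (\<beta> r) (n - k) *
          nabla_t \<tau> (\<lambda>k'. laplacian_h hx hy (U k')) k i j))
      + f (X i) (Z j) ((real n - 1/2) * \<tau>)"
    if n: "n \<in> {1..N}" and i: "i \<in> {1..Mx-1}" and j: "j \<in> {1..My-1}" for n i j
  proof -
    have "(X i, Z j) \<in> Omega Lx Ly" using Xint(1)[OF i] Zint(1)[OF j] by (simp add: Omega_def)
    then have "Dt T u (X i) (Z j) 0 = \<phi>1 (X i) (Z j)" using P unfolding solves_P_def by blast
    moreover have "Dt T u (X i) (Z j) 0 = D 0 0 1 (X i) (Z j) 0"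
      using Xint(1)[OF i] Zint(1)[OF j] L_pos by (intro Dt_u[OF u]) auto
    ultimately have \<phi>1: "D 0 0 1 (X i) (Z j) 0 = \<phi>1 (X i) (Z j)" by simp
    have "\<forall>n\<in>{1..N}. \<forall>i\<in>{1..Mx-1}. \<forall>j\<in>{1..My-1}.
        (\<Sum>l=1..p. a l * mu1 \<tau> (\<gamma> l) *
           (a_coeff (\<gamma> l) 0 * nabla_t \<tau> U n i j
            - (\<Sum>k=1..n-1. (a_coeff (\<gamma> l) (n - k - 1) - a_coeff (\<gamma> l) (n - k)) * nabla_t \<tau> U k i j)
            - a_coeff (\<gamma> l) (n - 1) * \<phi>1 (X i) (Z j)))
        + b1 * nabla_t \<tau> U n i j
        + (\<Sum>m=1..q. c m * mu2 \<tau> (\<alpha> m) *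
             (\<Sum>k=1..n. c_coeff n (\<alpha> m) (n - k) * nabla_t \<tau> U k i j))
        + b2 * half_avg U n i j
        = b3 * laplacian_h hx hy (half_avg U n) i j
        + (\<Sum>r=1..s. d r * mu2 \<tau> (\<beta> r) *
             (\<Sum>k=1..n. c_coeff n (\<beta> r) (n - k) *
                nabla_t \<tau> (\<lambda>k'. laplacian_h hx hy (U k')) k i j))
        + f (X i) (Z j) ((real n - 1/2) * \<tau>)"
      using S unfolding solves_S_def Let_def X_def Z_def grid(4-6) by (rule conjunct1)
    then show ?thesis using n i j unfolding l1_sum_def \<phi>1 by blast
  qed
  have err: "(\<Sum>l=1..p. (a l * mu1 \<tau> (\<gamma> l)) * l1_sum (a_coeff (\<gamma> l)) (\<lambda>k. nabla_t \<tau> E k i j) n)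
      + b1 * nabla_t \<tau> E n i j
      + (\<Sum>m=1..q. (c m * mu2 \<tau> (\<alpha> m)) * (\<Sum>k=1..n. c_coeff n (\<alpha> m) (n - k) * nabla_t \<tau> E k i j))
      + b2 * half_avg E n i j
      = b3 * laplacian_h hx hy (half_avg E n) i j
      + (\<Sum>r=1..s. (d r * mu2 \<tau> (\<beta> r)) * (\<Sum>k=1..n. c_coeff n (\<beta> r) (n - k) *
          nabla_t \<tau> (\<lambda>k'. laplacian_h hx hy (E k')) k i j))
      + FW n i j"
    if n: "n \<in> {1..N}" and i: "i \<in> {1..Mx-1}" and j: "j \<in> {1..My-1}" for n i j
  proof -
    have t: "nabla_t \<tau> E k i j = nabla_t \<tau> W k i j - nabla_t \<tau> U k i j" for k
      by (simp add: nabla_t_def E_def diff_divide_distrib)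
    have lE: "laplacian_h hx hy (E k) i j = laplacian_h hx hy (W k) i j - laplacian_h hx hy (U k) i j" for k
      by (simp add: laplacian_h_def E_def add_divide_distrib diff_divide_distrib)
    have tl: "nabla_t \<tau> (\<lambda>k'. laplacian_h hx hy (E k')) k i j
        = nabla_t \<tau> (\<lambda>k'. laplacian_h hx hy (W k')) k i j - nabla_t \<tau> (\<lambda>k'. laplacian_h hx hy (U k')) k i j" for k
      by (simp add: nabla_t_def lE diff_divide_distrib)
    have hE: "half_avg E n i j = half_avg W n i j - half_avg U n i j"
      by (simp add: half_avg_def E_def diff_divide_distrib add_divide_distrib)
    have lh: "laplacian_h hx hy (half_avg E n) i j = laplacian_h hx hy (half_avg W n) i j - laplacian_h hx hy (half_avg U n) i j"
      by (simp add: laplacian_h_def half_avg_def E_def add_divide_distrib diff_divide_distrib)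
    show ?thesis
      using scheme[OF n i j] unfolding t tl hE lh l1_sum_diff FW_def
      by (simp add: right_diff_distrib sum_subtractf)
  qed
  have coeff_nonneg: "0 \<le> a l * mu1 \<tau> (\<gamma> l)" if "l \<in> {1..p}" for l
  proof -
    have "Gamma (3 - \<gamma> l) > 0" using \<gamma>[OF that] by (intro Gamma_real_pos) auto
    then show ?thesis using a[OF that] by (simp add: mu1_def)
  qed
  have mu2_nonneg: "0 \<le> mu2 \<tau> x" if "0 < x \<and> x < 1" for x
  proof -
    have "Gamma (2 - x) > 0" using that by (intro Gamma_real_pos) auto
    then show ?thesis by (simp add: mu2_def)
  qed
  have "(norm1 b2 b3 Mx My hx hy (E n))\<^sup>2
      \<le> (real N * \<tau>) * (real Mx * hx) * (real My * hy) * R\<^sup>2 / (2 * b1)"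
  proof (rule energy_estimate[where A = "\<lambda>l. a l * mu1 \<tau> (\<gamma> l)" and Cc = "\<lambda>m. c m * mu2 \<tau> (\<alpha> m)"
        and Dd = "\<lambda>r. d r * mu2 \<tau> (\<beta> r)" and \<rho> = FW, OF coeff_nonneg _ _ b(1) _ _ _ _ _ h(3,1,2) _ _ E0 EV err residual])
    show "0 \<le> c m * mu2 \<tau> (\<alpha> m)" if "m \<in> {1..q}" for m
      using c[OF that] \<alpha>[OF that] mu2_nonneg by simp
    show "0 \<le> d r * mu2 \<tau> (\<beta> r)" if "r \<in> {1..s}" for r
      using d[OF that] \<beta>[OF that] mu2_nonneg by simp
  qed (use b grid n K0 Y0 \<gamma> \<alpha> \<beta> in \<open>auto simp: R_def\<close>)
  then have main: "(norm1 b2 b3 Mx My hx hy (E n))\<^sup>2 \<le> T * Lx * Ly * (K * Y)\<^sup>2 / (2 * b1)"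
    by (simp add: h R_def)
  define G where "G = B * (1 + T)\<^sup>2 * Y * M"
  have G: "0 \<le> G" using B Y0 M_nonneg by (simp add: G_def)
  have \<zeta>G: "\<bar>\<zeta> n * x\<bar> \<le> G" if "\<bar>x\<bar> \<le> M" for x
    unfolding abs_mult G_def using \<zeta>_le[of n] n that by (intro mult_mono) auto
  have corr_norm: "(norm1 b2 b3 Mx My hx hy (\<lambda>i j. \<zeta> n * g (X i) (Z j)))\<^sup>2
      \<le> (real Mx * hx) * (real My * hy) * ((b2 + 2 * b3) * G\<^sup>2)"
  proof (rule norm1_sq_le)
    fix i j assume ij: "i \<in> {1..Mx}" "j \<in> {1..My}"
    then have ij': "X i \<in> {0..Lx}" "X (i - 1) \<in> {0..Lx}" "Z j \<in> {0..Ly}" "Z (j - 1) \<in> {0..Ly}"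
      by (intro Xin Zin; auto)+
    show "\<bar>\<zeta> n * g (X i) (Z j)\<bar> \<le> G"
      unfolding g_def using ij' L_pos by (intro \<zeta>G D_bound) auto
    have dX: "\<bar>X i - X (i - 1)\<bar> = hx" "\<bar>Z j - Z (j - 1)\<bar> = hy"
      using ij h by (auto simp: X_def Z_def left_diff_distrib)
    have "\<bar>g (X i) (Z j) - g (X (i - 1)) (Z j)\<bar> \<le> M * hx"
      using space_lipschitz(1)[OF ij', of 0 2] L_pos unfolding g_def dX by simp
    then have "\<bar>(g (X i) (Z j) - g (X (i - 1)) (Z j)) / hx\<bar> \<le> M"
      using h by (simp add: abs_divide pos_divide_le_eq)
    from \<zeta>G[OF this] show "\<bar>nabla_x hx (\<lambda>i j. \<zeta> n * g (X i) (Z j)) i j\<bar> \<le> G"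
      by (simp add: nabla_x_def right_diff_distrib)
    have "\<bar>g (X i) (Z j) - g (X i) (Z (j - 1))\<bar> \<le> M * hy"
      using space_lipschitz(2)[OF ij', of 0 2] L_pos unfolding g_def dX by simp
    then have "\<bar>(g (X i) (Z j) - g (X i) (Z (j - 1))) / hy\<bar> \<le> M"
      using h by (simp add: abs_divide pos_divide_le_eq)
    from \<zeta>G[OF this] show "\<bar>nabla_y hy (\<lambda>i j. \<zeta> n * g (X i) (Z j)) i j\<bar> \<le> G"
      by (simp add: nabla_y_def right_diff_distrib)
  qed (use h b G in auto)
  have "(norm1 b2 b3 Mx My hx hy (\<lambda>i j. E n i j - \<zeta> n * g (X i) (Z j)))\<^sup>2
      \<le> 2 * (norm1 b2 b3 Mx My hx hy (E n))\<^sup>2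
        + 2 * (norm1 b2 b3 Mx My hx hy (\<lambda>i j. \<zeta> n * g (X i) (Z j)))\<^sup>2"
    using h b by (intro norm1_sq_diff_le) auto
  also have "\<dots> \<le> 2 * (T * Lx * Ly * (K * Y)\<^sup>2 / (2 * b1))
      + 2 * ((real Mx * hx) * (real My * hy) * ((b2 + 2 * b3) * G\<^sup>2))"
    using main corr_norm by (intro add_mono mult_left_mono) auto
  also have "\<dots> = (T * Lx * Ly * K\<^sup>2 / b1 + 2 * (b2 + 2 * b3) * (B * (1 + T)\<^sup>2 * M)\<^sup>2 * Lx * Ly) * Y\<^sup>2"
  proof -
    have "2 * (T * Lx * Ly * (k * y) / (2 * b1)) + 2 * (Lx * Ly * (e * (v * y)))
        = (T * Lx * Ly * k / b1 + 2 * e * v * Lx * Ly) * y" for k y e v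
      by (simp add: algebra_simps)
    moreover have "G\<^sup>2 = (B * (1 + T)\<^sup>2 * M)\<^sup>2 * Y\<^sup>2"
      by (simp add: G_def power_mult_distrib mult_ac)
    ultimately show ?thesis by (simp only: h power_mult_distrib[of K])
  qed
  finally show ?thesis by (simp add: E_def W_def X_def Z_def)
qed

theorem theorem5p3:
  fixes p q s :: nat
    and a c d \<gamma> \<alpha> \<beta> :: "nat \<Rightarrow> real"
    and b1 b2 b3 T Lx Ly :: real
    and f u :: "real \<Rightarrow> real \<Rightarrow> real \<Rightarrow> real"
    and \<phi>0 \<phi>1 :: "real \<Rightarrow> real \<Rightarrow> real"
  assumes "p \<ge> 1" and "q \<ge> 1" and "s \<ge> 1"
    and "\<And>l. l \<in> {1..p} \<Longrightarrow> a l > 0"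
    and "b1 > 0" and "b2 > 0" and "b3 > 0"
    and "\<And>m. m \<in> {1..q} \<Longrightarrow> c m > 0"
    and "\<And>r. r \<in> {1..s} \<Longrightarrow> d r > 0"
    and "\<And>l. l \<in> {1..p} \<Longrightarrow> 1 < \<gamma> l \<and> \<gamma> l < 2"
    and "\<And>m. m \<in> {1..q} \<Longrightarrow> 0 < \<alpha> m \<and> \<alpha> m < 1"
    and "\<And>r. r \<in> {1..s} \<Longrightarrow> 0 < \<beta> r \<and> \<beta> r < 1"
    and "T > 0" and "Lx > 0" and "Ly > 0"
    and "\<And>x y. (x, y) \<in> frontier (Omega Lx Ly) \<Longrightarrow> \<phi>0 x y = 0"
    and "solves_P p q s a b1 b2 b3 c d \<gamma> \<alpha> \<beta> T Lx Ly f \<phi>0 \<phi>1 u"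
    and "C443 Lx Ly T u"
  shows "\<exists>C>0. \<forall>Mx My N U.
    Mx \<ge> 2 \<longrightarrow> My \<ge> 2 \<longrightarrow> N \<ge> 1 \<longrightarrow>
    solves_S p q s a b1 b2 b3 c d \<gamma> \<alpha> \<beta> T Lx Ly f \<phi>0 \<phi>1 Mx My N U \<longrightarrow>
    (let hx = Lx / real Mx; hy = Ly / real My; \<tau> = T / real N in
      \<forall>n\<in>{1..N}.
        norm1 b2 b3 Mx My hx hy
          (\<lambda>i j. u (real i * hx) (real j * hy) (real n * \<tau>) - U n i j)
        \<le> C * sqrt (T * Lx * Ly /
                ((\<Sum>l=1..p. a l * T powr (1 - \<gamma> l) / Gamma (2 - \<gamma> l)) + 2 * b1))
            * (\<tau> powr Min ((\<lambda>l. 3 - \<gamma> l) ` {1..p} \<union> (\<lambda>m. 2 - \<alpha> m) ` {1..q}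
                             \<union> (\<lambda>r. 2 - \<beta> r) ` {1..s})
               + hx\<^sup>2 + hy\<^sup>2))"
proof -
  note a = assms(4) and b = assms(5-7) and c = assms(8) and d = assms(9)
    and \<gamma> = assms(10) and \<alpha> = assms(11) and \<beta> = assms(12)
  define Os where "Os = (\<lambda>l. 3 - \<gamma> l) ` {1..p} \<union> (\<lambda>m. 2 - \<alpha> m) ` {1..q} \<union> (\<lambda>r. 2 - \<beta> r) ` {1..s}"
  define \<omega> where "\<omega> = Min Os"
  have Os: "finite Os" "Os \<noteq> {}" using assms(1) by (auto simp: Os_def)
  have \<omega>_le: "\<omega> \<le> x" if "x \<in> Os" for x unfolding \<omega>_def using Os that by simp
  have \<gamma>': "1 < \<gamma> l \<and> \<gamma> l < 2 \<and> \<omega> \<le> 3 - \<gamma> l" if "l \<in> {1..p}" for l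
    using \<gamma>[OF that] \<omega>_le[of "3 - \<gamma> l"] that by (auto simp: Os_def)
  have \<alpha>': "0 < \<alpha> m \<and> \<alpha> m < 1 \<and> \<omega> \<le> 2 - \<alpha> m" if "m \<in> {1..q}" for m
    using \<alpha>[OF that] \<omega>_le[of "2 - \<alpha> m"] that by (auto simp: Os_def)
  have \<beta>': "0 < \<beta> r \<and> \<beta> r < 1 \<and> \<omega> \<le> 2 - \<beta> r" if "r \<in> {1..s}" for r
    using \<beta>[OF that] \<omega>_le[of "2 - \<beta> r"] that by (auto simp: Os_def)
  have \<omega>0: "0 \<le> \<omega>"
  proof -
    have "\<omega> \<in> Os" unfolding \<omega>_def using Os by (rule Min_in)
    then consider l where "l \<in> {1..p}" "\<omega> = 3 - \<gamma> l" | m where "m \<in> {1..q}" "\<omega> = 2 - \<alpha> m"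
      | r where "r \<in> {1..s}" "\<omega> = 2 - \<beta> r"
      unfolding Os_def by blast
    then show ?thesis
    proof cases
      case 1
      then show ?thesis using \<gamma>[of l] by simp
    next
      case 2
      then show ?thesis using \<alpha>[of m] by simp
    next
      case 3
      then show ?thesis using \<beta>[of r] by simp
    qed
  qed
  obtain D M where cyl: "cylinder_function Lx Ly T M D"
    and u: "\<And>x y t. x \<in> {0..Lx} \<Longrightarrow> y \<in> {0..Ly} \<Longrightarrow> t \<in> {0..T} \<Longrightarrow> D 0 0 0 x y t = u x y t"
    by (rule C443_cylinder_function[OF assms(18,14,15,13)]) (rule that)
  obtain l0 where l0: "l0 \<in> {1..p}" "\<And>l. l \<in> {1..p} \<Longrightarrow> \<gamma> l \<le> \<gamma> l0"
  proof -
    have "Max (\<gamma> ` {1..p}) \<in> \<gamma> ` {1..p}" using assms(1) by (intro Max_in) auto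
    then obtain l0 where "l0 \<in> {1..p}" "\<gamma> l0 = Max (\<gamma> ` {1..p})" by auto
    then show ?thesis using that[of l0] by simp
  qed
  obtain B where B: "B \<ge> 0"
    and corrector: "\<And>N. N \<ge> 1 \<Longrightarrow> \<exists>\<eta>. is_corrector p a \<gamma> b1 (\<gamma> l0) B N (T / real N) \<eta>"
    using corrector_exists[of p a \<gamma> b1 T l0, OF a \<gamma> b(1) assms(13) l0] by blast
  define K where "K = \<bar>consistency_constant p q s a b1 b2 b3 c d \<gamma> \<alpha> \<beta> T (4 * M) B\<bar> * (1 + M)"
  define Q where "Q = T * Lx * Ly * K\<^sup>2 / b1 + 2 * (b2 + 2 * b3) * (B * (1 + T)\<^sup>2 * M)\<^sup>2 * Lx * Ly"
  have Q: "0 \<le> Q" unfolding Q_def using b assms(13-15) by (intro add_nonneg_nonneg mult_nonneg_nonneg) auto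
  define S0 where "S0 = sqrt (T * Lx * Ly / ((\<Sum>l=1..p. a l * T powr (1 - \<gamma> l) / Gamma (2 - \<gamma> l)) + 2 * b1))"
  have "0 \<le> (\<Sum>l=1..p. a l * T powr (1 - \<gamma> l) / Gamma (2 - \<gamma> l))"
  proof (intro sum_nonneg divide_nonneg_pos mult_nonneg_nonneg)
    fix l assume l: "l \<in> {1..p}"
    show "0 \<le> a l" using a[OF l] by simp
    show "0 < Gamma (2 - \<gamma> l)" using \<gamma>[OF l] by (intro Gamma_real_pos) auto
  qed simp
  then have S0: "S0 > 0" unfolding S0_def using assms(13-15) b by simp
  \<comment> \<open>\<open>S0\<close> is the square root of the claim, positive and free of the
    mesh, so dividing by it is harmless; the summand 1 makes C strictly positive even when
    \<open>Q\<close> is zero.\<close>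
  define C where "C = sqrt Q / S0 + 1"
  have C: "C > 0" "sqrt Q \<le> C * S0"
    using Q S0 by (auto simp: C_def distrib_right intro: add_nonneg_pos)
  show ?thesis
    unfolding Let_def Os_def[symmetric] \<omega>_def[symmetric] S0_def[symmetric]
  proof (intro exI[of _ C] conjI allI impI ballI)
    show "C > 0" by (rule C)
    fix Mx My N n :: nat and U
    assume grid: "2 \<le> Mx" "2 \<le> My" "1 \<le> N" and n: "n \<in> {1..N}"
      and S: "solves_S p q s a b1 b2 b3 c d \<gamma> \<alpha> \<beta> T Lx Ly f \<phi>0 \<phi>1 Mx My N U"
    let ?hx = "Lx / real Mx" and ?hy = "Ly / real My" and ?\<tau> = "T / real N"
    define Y where "Y = ?\<tau> powr \<omega> + ?hx\<^sup>2 + ?hy\<^sup>2"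
    have Y: "0 \<le> Y" by (simp add: Y_def)
    obtain \<eta> where \<eta>: "is_corrector p a \<gamma> b1 (\<gamma> l0) B N ?\<tau> \<eta>"
      using corrector[OF grid(3)] by blast
    have "(norm1 b2 b3 Mx My ?hx ?hy (\<lambda>i j. u (real i * ?hx) (real j * ?hy) (real n * ?\<tau>) - U n i j))\<^sup>2 \<le> Q * Y\<^sup>2"
      unfolding Q_def
      by (rule grid_error[OF cyl u assms(17,16) a \<gamma>' c \<alpha>' d \<beta>' b grid refl refl refl S _ _ \<omega>0 _ B \<eta> K_def Y_def n])
        (use \<gamma>'[OF l0(1)] in auto)
    then have "norm1 b2 b3 Mx My ?hx ?hy (\<lambda>i j. u (real i * ?hx) (real j * ?hy) (real n * ?\<tau>) - U n i j) \<le> sqrt (Q * Y\<^sup>2)"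
      by (rule real_le_rsqrt)
    also have "\<dots> = sqrt Q * Y" using Y by (simp add: real_sqrt_mult)
    also have "\<dots> \<le> C * S0 * Y" using C(2) Y by (rule mult_right_mono)
    finally show "norm1 b2 b3 Mx My ?hx ?hy (\<lambda>i j. u (real i * ?hx) (real j * ?hy) (real n * ?\<tau>) - U n i j)
      \<le> C * S0 * (?\<tau> powr \<omega> + ?hx\<^sup>2 + ?hy\<^sup>2)" unfolding Y_def .
  qed
qed

end
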